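(* Let $M$ be a sub-Riemannian manifold and $x_0\in M$. Then there exists at least one geodesic $\gamma:[0,T]\to M$ starting at $x_0$ (for some $T>0$) that is ample at every $t\in[0,T]$.
   Context: Sub-Riemannian structure. $M$ is a connected smooth $n$-manifold, $(\mathbb U,f)$ a pair with $\mathbb U\to M$ a smooth Euclidean vector bundle of rank $r$ and $f:\mathbb U\to TM$ a smooth fibrewise linear bundle map over $\mathrm{id}_M$. In an orthonormal trivialization $f(x,u)=\sum_{i=1}^ru_iX_i(x)$ (the $X_i$ may be linearly dependent, and are assumed globally defined). The $X_i$ are assumed bracket-generating (their iterated Lie brackets span $T_xM$ at every $x$). Geodesics. $H(\lambda)=\frac12\sum_i\langle\lambda,X_i\rangle^2$ on $T^*M$, with Hamiltonian field $\vec H$ (assumed complete). A geodesic is $\gamma(t)=\pi(e^{t\vec H}(\lambda))$, $\lambda\in T^*_{x_0}M$, with control $u_i(t)=\langle e^{t\vec H}(\lambda),X_i\rangle$. Ample. Let $P_{0,t}$ be the flow from time $0$ to $t$ of the time-dependent field $\sum_iu_i(t)X_i$, $C_i(t)=(P_{0,t})_*^{-1}X_i(\gamma(t))\in T_{x_0}M$, and $\mathcal F^i_\gamma(t)=\mathrm{span}\{C_l^{(j)}(t):0\le j\le i-1,\ 1\le l\le r\}$, $i\ge1$. $\gamma$ is ample at $t$ if $\mathcal F^m_\gamma(t)=T_{x_0}M$ for some integer $m=m(t)$. *)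

theory Defs
  imports "HOL-Analysis.Analysis" "HOL-Library.Function_Algebras"
begin

text \<open>Functions into a real vector space form a real vector space pointwise. Tangent vectors are
  coded below as functions, so that \<^const>\<open>span\<close>, sums and scalar multiples are the library's.\<close>

instantiation "fun" :: (type, scaleR) scaleR
begin
definition scaleR_fun :: "real \<Rightarrow> ('a \<Rightarrow> 'b) \<Rightarrow> 'a \<Rightarrow> 'b"
  where "scaleR_fun r f = (\<lambda>x. r *\<^sub>R f x)"
instance ..
end

instance "fun" :: (type, real_vector) real_vector
  by standard (auto simp: fun_eq_iff scaleR_fun_def plus_fun_def scaleR_add_right scaleR_add_left)


section \<open>Smooth manifolds\<close>

text \<open>Smoothness on an open subset of a Euclidean space.\<close>

primrec Ck_on :: "nat \<Rightarrow> 'a::euclidean_space set \<Rightarrow> ('a \<Rightarrow> 'b::euclidean_space) \<Rightarrow> bool" where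
  "Ck_on 0 S f \<longleftrightarrow> continuous_on S f"
| "Ck_on (Suc k) S f \<longleftrightarrow>
     (\<forall>x\<in>S. f differentiable (at x)) \<and> (\<forall>v. Ck_on k S (\<lambda>x. frechet_derivative f (at x) v))"

definition smooth_on :: "'a::euclidean_space set \<Rightarrow> ('a \<Rightarrow> 'b::euclidean_space) \<Rightarrow> bool" where
  "smooth_on S f \<longleftrightarrow> (\<forall>k. Ck_on k S f)"

text \<open>A chart is a pair of its domain and the coordinate map; values of the map outside the domain
  are irrelevant. The dimension of a manifold is the dimension of its model space \<^typ>\<open>'e\<close>.\<close>

type_synonym ('a, 'e) chart = "'a set \<times> ('a \<Rightarrow> 'e)"

abbreviation cdom :: "('a, 'e) chart \<Rightarrow> 'a set" where "cdom \<equiv> fst"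
abbreviation cmap :: "('a, 'e) chart \<Rightarrow> 'a \<Rightarrow> 'e" where "cmap \<equiv> snd"
abbreviation cinv :: "('a, 'e) chart \<Rightarrow> 'e \<Rightarrow> 'a" where "cinv c \<equiv> inv_into (cdom c) (cmap c)"

record ('a, 'e) mfd =
  mtop :: "'a topology"
  atlas :: "('a, 'e) chart set"

abbreviation mcarrier :: "('a, 'e) mfd \<Rightarrow> 'a set" where "mcarrier M \<equiv> topspace (mtop M)"

definition is_chart :: "'a topology \<Rightarrow> ('a, 'e::euclidean_space) chart \<Rightarrow> bool" where
  "is_chart X c \<longleftrightarrow> openin X (cdom c) \<and> open (cmap c ` cdom c) \<and>
     homeomorphic_map (subtopology X (cdom c)) (top_of_set (cmap c ` cdom c)) (cmap c)"

definition smooth_manifold :: "('a, 'e::euclidean_space) mfd \<Rightarrow> bool" where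
  "smooth_manifold M \<longleftrightarrow>
     Hausdorff_space (mtop M) \<and> second_countable (mtop M) \<and>
     (\<forall>c\<in>atlas M. is_chart (mtop M) c) \<and> (\<Union>c\<in>atlas M. cdom c) = mcarrier M \<and>
     (\<forall>c\<in>atlas M. \<forall>d\<in>atlas M. smooth_on (cmap c ` (cdom c \<inter> cdom d)) (cmap d \<circ> cinv c))"

definition charts_at :: "('a, 'e) mfd \<Rightarrow> 'a \<Rightarrow> ('a, 'e) chart set" where
  "charts_at M x = {c \<in> atlas M. x \<in> cdom c}"

definition smooth_map_on ::
  "'a set \<Rightarrow> ('a, 'e::euclidean_space) mfd \<Rightarrow> ('b, 'f::euclidean_space) mfd \<Rightarrow> ('a \<Rightarrow> 'b) \<Rightarrow> bool" where
  "smooth_map_on S M N g \<longleftrightarrow>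
     openin (mtop M) S \<and> continuous_map (subtopology (mtop M) S) (mtop N) g \<and>
     (\<forall>c\<in>atlas M. \<forall>d\<in>atlas N.
        smooth_on (cmap c ` (S \<inter> cdom c \<inter> g -` cdom d)) (cmap d \<circ> g \<circ> cinv c))"

abbreviation smooth_map ::
  "('a, 'e::euclidean_space) mfd \<Rightarrow> ('b, 'f::euclidean_space) mfd \<Rightarrow> ('a \<Rightarrow> 'b) \<Rightarrow> bool" where
  "smooth_map M \<equiv> smooth_map_on (mcarrier M) M"

definition euclidean_mfd :: "('e::euclidean_space, 'e) mfd" where
  "euclidean_mfd = \<lparr>mtop = euclidean, atlas = {(UNIV, id)}\<rparr>"

definition times_euclidean ::
  "('a, 'e::euclidean_space) mfd \<Rightarrow> ('a \<times> 'f::euclidean_space, 'e \<times> 'f) mfd" where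
  "times_euclidean M =
     \<lparr>mtop = prod_topology (mtop M) euclidean,
      atlas = (\<lambda>c. (cdom c \<times> UNIV, \<lambda>(x, a). (cmap c x, a))) ` atlas M\<rparr>"


section \<open>Tangent and cotangent bundles\<close>

text \<open>A tangent vector at \<open>x\<close> is the family of its coordinate vectors in all charts around \<open>x\<close>,
  related by the Jacobians of the coordinate changes. The family is set to zero on all other charts,
  so that equal tangent vectors are equal families.\<close>

type_synonym ('a, 'e) tvec = "('a, 'e) chart \<Rightarrow> 'e"

definition tangent_space :: "('a, 'e::euclidean_space) mfd \<Rightarrow> 'a \<Rightarrow> ('a, 'e) tvec set" where
  "tangent_space M x =
     {v. (\<forall>c\<in>charts_at M x. \<forall>d\<in>charts_at M x.
            v d = frechet_derivative (cmap d \<circ> cinv c) (at (cmap c x)) (v c)) \<and>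
         (\<forall>c. c \<notin> charts_at M x \<longrightarrow> v c = 0)}"

text \<open>The tangent vector at \<open>x\<close> whose coordinates in the chart \<open>c\<close> are \<open>w\<close>.\<close>

definition coord_vec ::
  "('a, 'e::euclidean_space) mfd \<Rightarrow> ('a, 'e) chart \<Rightarrow> 'a \<Rightarrow> 'e \<Rightarrow> ('a, 'e) tvec" where
  "coord_vec M c x w = (\<lambda>d. if d \<in> charts_at M x
     then frechet_derivative (cmap d \<circ> cinv c) (at (cmap c x)) w else 0)"

text \<open>The differential at \<open>x\<close> of a map \<open>g\<close> that is smooth near \<open>x\<close>.\<close>

definition differential ::
  "('a, 'e::euclidean_space) mfd \<Rightarrow> ('b, 'f::euclidean_space) mfd \<Rightarrow> ('a \<Rightarrow> 'b) \<Rightarrow> 'a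
     \<Rightarrow> ('a, 'e) tvec \<Rightarrow> ('b, 'f) tvec" where
  "differential M N g x v = (\<lambda>d. if d \<in> charts_at N (g x)
     then let c = (SOME c. c \<in> charts_at M x)
          in frechet_derivative (cmap d \<circ> g \<circ> cinv c) (at (cmap c x)) (v c)
     else 0)"

text \<open>The cotangent space is the dual of the tangent space; functionals are extended by zero.\<close>

type_synonym ('a, 'e) covec = "('a, 'e) tvec \<Rightarrow> real"

definition cotangent_space :: "('a, 'e::euclidean_space) mfd \<Rightarrow> 'a \<Rightarrow> ('a, 'e) covec set" where
  "cotangent_space M x =
     {l. (\<forall>v\<in>tangent_space M x. \<forall>w\<in>tangent_space M x. l (v + w) = l v + l w) \<and>
         (\<forall>s. \<forall>v\<in>tangent_space M x. l (s *\<^sub>R v) = s * l v) \<and>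
         (\<forall>v. v \<notin> tangent_space M x \<longrightarrow> l v = 0)}"

text \<open>The manifold whose topology makes all the given bijections onto open sets homeomorphisms.\<close>

definition mfd_of_charts :: "('a, 'e::euclidean_space) chart set \<Rightarrow> ('a, 'e) mfd" where
  "mfd_of_charts A =
     \<lparr>mtop = topology_generated_by {cdom c \<inter> cmap c -` W |c W. c \<in> A \<and> open W}, atlas = A\<rparr>"

definition tangent_chart ::
  "('a, 'e::euclidean_space) mfd \<Rightarrow> ('a, 'e) chart \<Rightarrow> ('a \<times> ('a, 'e) tvec, 'e \<times> 'e) chart" where
  "tangent_chart M c = (Sigma (cdom c) (tangent_space M), \<lambda>(x, v). (cmap c x, v c))"

definition tangent_bundle ::
  "('a, 'e::euclidean_space) mfd \<Rightarrow> ('a \<times> ('a, 'e) tvec, 'e \<times> 'e) mfd" where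
  "tangent_bundle M = mfd_of_charts (tangent_chart M ` atlas M)"

text \<open>Canonical coordinates \<open>(x, p)\<close>: the coefficient \<open>p\<^sub>b\<close> is the value on the coordinate field
  \<open>\<partial>\<^sub>b\<close>.\<close>

definition cotangent_chart ::
  "('a, 'e::euclidean_space) mfd \<Rightarrow> ('a, 'e) chart \<Rightarrow> ('a \<times> ('a, 'e) covec, 'e \<times> 'e) chart" where
  "cotangent_chart M c =
     (Sigma (cdom c) (cotangent_space M),
      \<lambda>(x, l). (cmap c x, \<Sum>b\<in>Basis. l (coord_vec M c x b) *\<^sub>R b))"

definition cotangent_bundle ::
  "('a, 'e::euclidean_space) mfd \<Rightarrow> ('a \<times> ('a, 'e) covec, 'e \<times> 'e) mfd" where
  "cotangent_bundle M = mfd_of_charts (cotangent_chart M ` atlas M)"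


section \<open>Vector fields\<close>

definition lie_bracket ::
  "('a, 'e::euclidean_space) mfd \<Rightarrow> ('a \<Rightarrow> ('a, 'e) tvec) \<Rightarrow> ('a \<Rightarrow> ('a, 'e) tvec)
     \<Rightarrow> 'a \<Rightarrow> ('a, 'e) tvec" where
  "lie_bracket M Y Z x = (\<lambda>c. if c \<in> charts_at M x
     then frechet_derivative (\<lambda>q. Z (cinv c q) c) (at (cmap c x)) (Y x c)
        - frechet_derivative (\<lambda>q. Y (cinv c q) c) (at (cmap c x)) (Z x c)
     else 0)"

inductive_set iterated_brackets ::
  "('a, 'e::euclidean_space) mfd \<Rightarrow> ('r \<Rightarrow> 'a \<Rightarrow> ('a, 'e) tvec) \<Rightarrow> ('a \<Rightarrow> ('a, 'e) tvec) set"
  for M X where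
  "X i \<in> iterated_brackets M X"
| "Y \<in> iterated_brackets M X \<Longrightarrow> Z \<in> iterated_brackets M X
     \<Longrightarrow> lie_bracket M Y Z \<in> iterated_brackets M X"

definition bracket_generating ::
  "('a, 'e::euclidean_space) mfd \<Rightarrow> ('r \<Rightarrow> 'a \<Rightarrow> ('a, 'e) tvec) \<Rightarrow> bool" where
  "bracket_generating M X \<longleftrightarrow>
     (\<forall>x\<in>mcarrier M. span {Y x |Y. Y \<in> iterated_brackets M X} = tangent_space M x)"

text \<open>Integral curves on an interval \<open>I\<close> of a time-dependent vector field \<open>V\<close>. At boundary points of
  \<open>I\<close> the derivative is one-sided.\<close>

definition integral_curve ::
  "('a, 'e::euclidean_space) mfd \<Rightarrow> (real \<Rightarrow> 'a \<Rightarrow> ('a, 'e) tvec) \<Rightarrow> real set \<Rightarrow> (real \<Rightarrow> 'a) \<Rightarrow> bool" where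
  "integral_curve M V I \<Gamma> \<longleftrightarrow>
     continuous_map (top_of_set I) (mtop M) \<Gamma> \<and>
     (\<forall>t\<in>I. \<forall>c\<in>charts_at M (\<Gamma> t).
        ((\<lambda>s. cmap c (\<Gamma> s)) has_vector_derivative V t (\<Gamma> t) c) (at t within I))"

text \<open>The flow from time \<open>0\<close> to time \<open>t\<close>. It is meaningful at those \<open>y\<close> from which an
  integral curve exists up to time \<open>t\<close>; in general these do not exhaust the manifold.\<close>

definition flow ::
  "('a, 'e::euclidean_space) mfd \<Rightarrow> (real \<Rightarrow> 'a \<Rightarrow> ('a, 'e) tvec) \<Rightarrow> real \<Rightarrow> 'a \<Rightarrow> 'a" where
  "flow M V t y = (THE z. \<exists>\<Gamma>. integral_curve M V (closed_segment 0 t) \<Gamma> \<and> \<Gamma> 0 = y \<and> \<Gamma> t = z)"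

definition complete_field ::
  "('a, 'e::euclidean_space) mfd \<Rightarrow> ('a \<Rightarrow> ('a, 'e) tvec) \<Rightarrow> bool" where
  "complete_field M V \<longleftrightarrow> (\<forall>y\<in>mcarrier M. \<exists>\<Gamma>. integral_curve M (\<lambda>t. V) UNIV \<Gamma> \<and> \<Gamma> 0 = y)"

text \<open>The Hamiltonian field of \<open>h\<close> on the cotangent bundle, in canonical coordinates
  \<open>(\<partial>h/\<partial>p, - \<partial>h/\<partial>x)\<close>.\<close>

definition hamiltonian_field ::
  "('a, 'e::euclidean_space) mfd \<Rightarrow> ('a \<times> ('a, 'e) covec \<Rightarrow> real)
     \<Rightarrow> 'a \<times> ('a, 'e) covec \<Rightarrow> ('a \<times> ('a, 'e) covec, 'e \<times> 'e) tvec" where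
  "hamiltonian_field M h z = (\<lambda>c. if c \<in> charts_at (cotangent_bundle M) z
     then let dh = frechet_derivative (h \<circ> cinv c) (at (cmap c z))
          in (\<Sum>b\<in>Basis. dh (0, b) *\<^sub>R b, - (\<Sum>b\<in>Basis. dh (b, 0) *\<^sub>R b))
     else 0)"


section \<open>Euclidean vector bundles and sub-Riemannian structures\<close>

text \<open>The rank of the bundle is the cardinality of the index type \<^typ>\<open>'r\<close>. The operations are
  meaningful on points of the same fibre only.\<close>

record ('b, 'a, 'e, 'r::finite) vbundle =
  total :: "('b, 'e \<times> (real^'r)) mfd"
  proj :: "'b \<Rightarrow> 'a"
  badd :: "'b \<Rightarrow> 'b \<Rightarrow> 'b"
  bscale :: "real \<Rightarrow> 'b \<Rightarrow> 'b"
  binner :: "'b \<Rightarrow> 'b \<Rightarrow> real"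

definition fibre :: "('b, 'a, 'e, 'r::finite) vbundle \<Rightarrow> 'a \<Rightarrow> 'b set" where
  "fibre U x = {b \<in> mcarrier (total U). proj U b = x}"

definition local_trivialization ::
  "('a, 'e::euclidean_space) mfd \<Rightarrow> ('b, 'a, 'e, 'r::finite) vbundle \<Rightarrow> 'a set
     \<Rightarrow> ('a \<times> (real^'r) \<Rightarrow> 'b) \<Rightarrow> bool" where
  "local_trivialization M U V \<Psi> \<longleftrightarrow>
     openin (mtop M) V \<and>
     bij_betw \<Psi> (V \<times> UNIV) (\<Union>x\<in>V. fibre U x) \<and>
     smooth_map_on (V \<times> UNIV) (times_euclidean M) (total U) \<Psi> \<and>
     smooth_map_on (\<Union>x\<in>V. fibre U x) (total U) (times_euclidean M) (inv_into (V \<times> UNIV) \<Psi>) \<and>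
     (\<forall>x\<in>V. \<forall>a b s. proj U (\<Psi> (x, a)) = x \<and>
        \<Psi> (x, a + b) = badd U (\<Psi> (x, a)) (\<Psi> (x, b)) \<and>
        \<Psi> (x, s *\<^sub>R a) = bscale U s (\<Psi> (x, a)))"

text \<open>The fibrewise inner product is smooth when its coefficients in local trivializations are.\<close>

definition euclidean_vector_bundle ::
  "('a, 'e::euclidean_space) mfd \<Rightarrow> ('b, 'a, 'e, 'r::finite) vbundle \<Rightarrow> bool" where
  "euclidean_vector_bundle M U \<longleftrightarrow>
     smooth_manifold (total U) \<and>
     smooth_map (total U) M (proj U) \<and>
     (\<forall>x\<in>mcarrier M. \<exists>V \<Psi>. x \<in> V \<and> local_trivialization M U V \<Psi> \<and>
        (\<forall>a b. smooth_map_on V M euclidean_mfd (\<lambda>y. binner U (\<Psi> (y, a)) (\<Psi> (y, b))))) \<and>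
     (\<forall>x\<in>mcarrier M. \<forall>a\<in>fibre U x. \<forall>b\<in>fibre U x. \<forall>c\<in>fibre U x. \<forall>s.
        binner U a b = binner U b a \<and>
        binner U (badd U a b) c = binner U a c + binner U b c \<and>
        binner U (bscale U s a) b = s * binner U a b) \<and>
     (\<forall>x\<in>mcarrier M. \<forall>a\<in>fibre U x. 0 \<le> binner U a a \<and> (binner U a a = 0 \<longrightarrow> a = bscale U 0 a))"

text \<open>A smooth bundle map to the tangent bundle over the identity, linear on fibres.\<close>

definition bundle_map_to_tangent ::
  "('a, 'e::euclidean_space) mfd \<Rightarrow> ('b, 'a, 'e, 'r::finite) vbundle
     \<Rightarrow> ('b \<Rightarrow> 'a \<times> ('a, 'e) tvec) \<Rightarrow> bool" where
  "bundle_map_to_tangent M U f \<longleftrightarrow>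
     smooth_map (total U) (tangent_bundle M) f \<and>
     (\<forall>b\<in>mcarrier (total U). fst (f b) = proj U b) \<and>
     (\<forall>x\<in>mcarrier M. \<forall>a\<in>fibre U x. \<forall>b\<in>fibre U x. \<forall>s.
        snd (f (badd U a b)) = snd (f a) + snd (f b) \<and>
        snd (f (bscale U s a)) = s *\<^sub>R snd (f a))"

definition orthonormal_frame ::
  "('a, 'e::euclidean_space) mfd \<Rightarrow> ('b, 'a, 'e, 'r::finite) vbundle \<Rightarrow> ('r \<Rightarrow> 'a \<Rightarrow> 'b) \<Rightarrow> bool" where
  "orthonormal_frame M U \<sigma> \<longleftrightarrow>
     (\<forall>i. smooth_map M (total U) (\<sigma> i)) \<and>
     (\<forall>x\<in>mcarrier M. \<forall>i j. \<sigma> i x \<in> fibre U x \<and>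
        binner U (\<sigma> i x) (\<sigma> j x) = (if i = j then 1 else 0))"

text \<open>The fields \<open>X\<^sub>i\<close> with \<open>f (\<Sum>\<^sub>i u\<^sub>i \<sigma>\<^sub>i) = \<Sum>\<^sub>i u\<^sub>i X\<^sub>i\<close>.\<close>

definition frame_fields ::
  "('b \<Rightarrow> 'a \<times> ('a, 'e) tvec) \<Rightarrow> ('r \<Rightarrow> 'a \<Rightarrow> 'b) \<Rightarrow> 'r \<Rightarrow> 'a \<Rightarrow> ('a, 'e) tvec" where
  "frame_fields f \<sigma> i x = snd (f (\<sigma> i x))"

definition sub_riemannian_manifold ::
  "('a, 'e::euclidean_space) mfd \<Rightarrow> ('b, 'a, 'e, 'r::finite) vbundle
     \<Rightarrow> ('b \<Rightarrow> 'a \<times> ('a, 'e) tvec) \<Rightarrow> ('r \<Rightarrow> 'a \<Rightarrow> 'b) \<Rightarrow> bool" where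
  "sub_riemannian_manifold M U f \<sigma> \<longleftrightarrow>
     smooth_manifold M \<and> connected_space (mtop M) \<and>
     euclidean_vector_bundle M U \<and> bundle_map_to_tangent M U f \<and>
     orthonormal_frame M U \<sigma> \<and> bracket_generating M (frame_fields f \<sigma>)"


section \<open>Geodesics and ampleness\<close>

definition sr_hamiltonian ::
  "('r::finite \<Rightarrow> 'a \<Rightarrow> ('a, 'e) tvec) \<Rightarrow> 'a \<times> ('a, 'e) covec \<Rightarrow> real" where
  "sr_hamiltonian X z = 1/2 * (\<Sum>i\<in>UNIV. (snd z (X i (fst z)))\<^sup>2)"

abbreviation sr_field ::
  "('a, 'e::euclidean_space) mfd \<Rightarrow> ('r::finite \<Rightarrow> 'a \<Rightarrow> ('a, 'e) tvec)
     \<Rightarrow> 'a \<times> ('a, 'e) covec \<Rightarrow> ('a \<times> ('a, 'e) covec, 'e \<times> 'e) tvec" where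
  "sr_field M X \<equiv> hamiltonian_field M (sr_hamiltonian X)"

definition geodesic ::
  "('a, 'e::euclidean_space) mfd \<Rightarrow> ('r::finite \<Rightarrow> 'a \<Rightarrow> ('a, 'e) tvec)
     \<Rightarrow> 'a \<Rightarrow> real \<Rightarrow> (real \<Rightarrow> 'a) \<Rightarrow> ('r \<Rightarrow> real \<Rightarrow> real) \<Rightarrow> bool" where
  "geodesic M X x0 T \<gamma> u \<longleftrightarrow>
     (\<exists>l\<in>cotangent_space M x0. \<forall>t\<in>{0..T}.
        let z = flow (cotangent_bundle M) (\<lambda>_. sr_field M X) t (x0, l)
        in \<gamma> t = fst z \<and> (\<forall>i. u i t = snd z (X i (\<gamma> t))))"

abbreviation control_field ::
  "('r::finite \<Rightarrow> 'a \<Rightarrow> ('a, 'e::euclidean_space) tvec) \<Rightarrow> ('r \<Rightarrow> real \<Rightarrow> real)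
     \<Rightarrow> real \<Rightarrow> 'a \<Rightarrow> ('a, 'e) tvec" where
  "control_field X u t x \<equiv> (\<Sum>i\<in>UNIV. u i t *\<^sub>R X i x)"

definition pulled_back_field ::
  "('a, 'e::euclidean_space) mfd \<Rightarrow> ('r::finite \<Rightarrow> 'a \<Rightarrow> ('a, 'e) tvec)
     \<Rightarrow> (real \<Rightarrow> 'a) \<Rightarrow> ('r \<Rightarrow> real \<Rightarrow> real) \<Rightarrow> 'r \<Rightarrow> real \<Rightarrow> ('a, 'e) tvec" where
  "pulled_back_field M X \<gamma> u i t =
     inv_into (tangent_space M (\<gamma> 0)) (differential M M (flow M (control_field X u) t) (\<gamma> 0))
       (X i (\<gamma> t))"

text \<open>The \<open>j\<close>-th derivative on \<open>I\<close> of a curve in a fixed tangent space, taken in coordinates.\<close>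

primrec tvec_deriv ::
  "real set \<Rightarrow> (real \<Rightarrow> ('a, 'e::euclidean_space) tvec) \<Rightarrow> nat \<Rightarrow> real \<Rightarrow> ('a, 'e) tvec" where
  "tvec_deriv I C 0 t = C t"
| "tvec_deriv I C (Suc j) t =
     (\<lambda>c. vector_derivative (\<lambda>s. tvec_deriv I C j s c) (at t within I))"

definition geodesic_flag ::
  "('a, 'e::euclidean_space) mfd \<Rightarrow> ('r::finite \<Rightarrow> 'a \<Rightarrow> ('a, 'e) tvec)
     \<Rightarrow> real \<Rightarrow> (real \<Rightarrow> 'a) \<Rightarrow> ('r \<Rightarrow> real \<Rightarrow> real) \<Rightarrow> nat \<Rightarrow> real \<Rightarrow> ('a, 'e) tvec set" where
  "geodesic_flag M X T \<gamma> u i t =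
     span {tvec_deriv {0..T} (pulled_back_field M X \<gamma> u l) j t |j l. j < i}"

definition ample_at ::
  "('a, 'e::euclidean_space) mfd \<Rightarrow> ('r::finite \<Rightarrow> 'a \<Rightarrow> ('a, 'e) tvec)
     \<Rightarrow> real \<Rightarrow> (real \<Rightarrow> 'a) \<Rightarrow> ('r \<Rightarrow> real \<Rightarrow> real) \<Rightarrow> real \<Rightarrow> bool" where
  "ample_at M X T \<gamma> u t \<longleftrightarrow> (\<exists>m\<ge>1. geodesic_flag M X T \<gamma> u m t = tangent_space M (\<gamma> 0))"

end

(*
  In a chart around x0, the j-th derivative of the pulled-back field C_l at time t is the image, under
  the inverse of the differential of P_{0,t}, of a vector field Z_l^j(x(t), p(t)) obtained from X_l by
  iterated Lie derivatives along the geodesic. Ampleness is therefore an open condition along the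
  geodesic, and it suffices to find a covector p such that the vectors Z_l^j(x0, p) span at time 0.

  Suppose that there is none. Write x(t, p) for the Taylor series in t of the exponential map and Dx
  for its Jacobian in p, a matrix of real power series. Then:
  (1) If eta annihilates all Z_l^j(x0, p), the power series solution w of w' = - A^T w, w(0) = eta,
      where A is the linearization of the controlled field, satisfies w Dx = 0.
  (2) If w Dx = 0, then w X_i(x) = 0 for all i. With Dp the Jacobian of the momenta and z such that
      Dp z = w (up to a scalar factor), the symmetry of Dx^T Dp gives Dx z = 0. Differentiating
      w Dx = 0 in t and pairing with z yields sum_i (w X_i)^2 = 0, which is impossible over the real
      power series unless all terms vanish.
  (3) Hence the X_i are tangent to the image of the exponential map at covectors where the rank of Dx
      is maximal, and so are all their iterated brackets, as for vector fields tangent to a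
      submanifold.
  By (1) and (3) w annihilates every iterated bracket along x(t, p); at t = 0 this says that eta
  annihilates every bracket at x0, contradicting the bracket-generating condition.
*)
theory Submission
  imports Defs "HOL-Computational_Algebra.Formal_Power_Series"
begin

section \<open>Calculus of smooth functions\<close>

lemma has_derivative_frechet:
  "f differentiable (at x) \<Longrightarrow> (f has_derivative frechet_derivative f (at x)) (at x)"
  by (simp add: frechet_derivative_works[symmetric])

lemma frechet_eq:
  "(f has_derivative f') (at x) \<Longrightarrow> frechet_derivative f (at x) = f'"
  by (metis frechet_derivative_at)

lemma frechet_derivative_cong_open:
  assumes "open S" "x \<in> S" "\<And>y. y \<in> S \<Longrightarrow> f y = g y"
  shows "frechet_derivative f (at x) = frechet_derivative g (at x)"
proof -
  have "(f has_derivative D) (at x) \<longleftrightarrow> (g has_derivative D) (at x)" for D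
    using has_derivative_transform_within_open[of f D x UNIV S g]
      has_derivative_transform_within_open[of g D x UNIV S f] assms by auto
  then show ?thesis by (simp add: frechet_derivative_def)
qed

lemma differentiable_cong_open:
  assumes "open S" "x \<in> S" "\<And>y. y \<in> S \<Longrightarrow> f y = g y" "f differentiable (at x)"
  shows "g differentiable (at x)"
  using assms has_derivative_transform_within_open[of f _ x UNIV S g]
  unfolding differentiable_def by auto

lemma Ck_on_Suc_imp: "Ck_on (Suc k) S f \<Longrightarrow> Ck_on k S f"
proof (induction k arbitrary: f)
  case 0
  then show ?case
    by (auto intro!: continuous_at_imp_continuous_on differentiable_imp_continuous_within)
next
  case (Suc k)
  then show ?case by auto
qed

lemma Ck_on_subset: "Ck_on k S f \<Longrightarrow> S' \<subseteq> S \<Longrightarrow> Ck_on k S' f"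
  by (induction k arbitrary: f) (auto intro: continuous_on_subset)

lemma Ck_on_cong:
  assumes "open S" "\<And>y. y \<in> S \<Longrightarrow> f y = g y" "Ck_on k S f"
  shows "Ck_on k S g"
  using assms(2,3)
proof (induction k arbitrary: f g)
  case 0
  then show ?case using continuous_on_cong by auto
next
  case (Suc k)
  have "Ck_on k S (\<lambda>x. frechet_derivative g (at x) v)" for v
    using Suc.IH[of "\<lambda>x. frechet_derivative f (at x) v"] Suc.prems
      frechet_derivative_cong_open[OF assms(1), of _ f g] by auto
  then show ?case using Suc.prems differentiable_cong_open[OF assms(1), of _ f g] by auto
qed

lemma Ck_on_local:
  assumes "\<And>x. x \<in> S \<Longrightarrow> \<exists>V. open V \<and> x \<in> V \<and> Ck_on k V f"
  shows "Ck_on k S f"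
  using assms
proof (induction k arbitrary: f)
  case 0
  then show ?case
    by (auto intro!: continuous_at_imp_continuous_on) (metis continuous_on_eq_continuous_at)
next
  case (Suc k)
  have "Ck_on k S (\<lambda>x. frechet_derivative f (at x) v)" for v
    by (rule Suc.IH) (use Suc.prems in force)
  then show ?case using Suc.prems by force
qed

lemma Ck_on_const: "Ck_on k S (\<lambda>x. c)"
  by (induction k arbitrary: c) auto

lemma Ck_on_linear: "bounded_linear L \<Longrightarrow> Ck_on k S L"
proof (cases k)
  case 0
  then show "bounded_linear L \<Longrightarrow> ?thesis" by (simp add: linear_continuous_on)
next
  case (Suc j)
  assume L: "bounded_linear L"
  have "frechet_derivative L (at x) = L" for x
    using L by (intro frechet_eq bounded_linear_imp_has_derivative)
  then show ?thesis using Suc L by (auto simp: Ck_on_const bounded_linear_imp_differentiable)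
qed

lemma Ck_on_compose_linear:
  assumes "open S" and L: "bounded_linear L" and "Ck_on k S f"
  shows "Ck_on k S (\<lambda>x. L (f x))"
  using assms(3)
proof (induction k arbitrary: f)
  case 0
  then show ?case using linear_continuous_on_compose[of S f L] L
    by (simp add: bounded_linear.linear)
next
  case (Suc k)
  have hd: "((\<lambda>x. L (f x)) has_derivative (\<lambda>v. L (frechet_derivative f (at x) v))) (at x)" if "x \<in> S" for x
    using Suc.prems that
    by (auto intro!: bounded_linear.has_derivative[OF L] has_derivative_frechet)
  have "Ck_on k S (\<lambda>x. frechet_derivative (\<lambda>x. L (f x)) (at x) v)" for v
    by (rule Ck_on_cong[OF \<open>open S\<close> _ Suc.IH[of "\<lambda>x. frechet_derivative f (at x) v"]])
      (use Suc.prems frechet_eq[OF hd] in auto)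
  then show ?case using hd by (auto simp: differentiable_def)
qed

lemma Ck_on_add:
  assumes "open S" "Ck_on k S f" "Ck_on k S g"
  shows "Ck_on k S (\<lambda>x. f x + g x)"
  using assms(2,3)
proof (induction k arbitrary: f g)
  case 0
  then show ?case by (simp add: continuous_on_add)
next
  case (Suc k)
  have hd: "((\<lambda>x. f x + g x) has_derivative
      (\<lambda>v. frechet_derivative f (at x) v + frechet_derivative g (at x) v)) (at x)" if "x \<in> S" for x
    using Suc.prems that by (auto intro!: has_derivative_add has_derivative_frechet)
  have "Ck_on k S (\<lambda>x. frechet_derivative (\<lambda>x. f x + g x) (at x) v)" for v
    by (rule Ck_on_cong[OF \<open>open S\<close> _ Suc.IH[of "\<lambda>x. frechet_derivative f (at x) v"
            "\<lambda>x. frechet_derivative g (at x) v"]])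
      (use Suc.prems frechet_eq[OF hd] in auto)
  then show ?case using hd by (auto simp: differentiable_def)
qed

lemma Ck_on_bilinear:
  assumes "open S" and B: "bounded_bilinear B" and "Ck_on k S f" "Ck_on k S g"
  shows "Ck_on k S (\<lambda>x. B (f x) (g x))"
  using assms(3,4)
proof (induction k arbitrary: f g)
  case 0
  then show ?case using bounded_bilinear.continuous_on[OF B] by auto
next
  case (Suc k)
  have hd: "((\<lambda>x. B (f x) (g x)) has_derivative
      (\<lambda>v. B (f x) (frechet_derivative g (at x) v) + B (frechet_derivative f (at x) v) (g x))) (at x)"
    if "x \<in> S" for x
    using Suc.prems that by (auto intro!: bounded_bilinear.FDERIV[OF B] has_derivative_frechet)
  have "Ck_on k S (\<lambda>x. B (f x) (frechet_derivative g (at x) v) + B (frechet_derivative f (at x) v) (g x))" for v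
    using Suc.prems Ck_on_Suc_imp[OF Suc.prems(1)] Ck_on_Suc_imp[OF Suc.prems(2)]
    by (intro Ck_on_add[OF \<open>open S\<close>] Suc.IH) auto
  then have "Ck_on k S (\<lambda>x. frechet_derivative (\<lambda>x. B (f x) (g x)) (at x) v)" for v
    by (rule Ck_on_cong[OF \<open>open S\<close>, rotated]) (use frechet_eq[OF hd] in auto)
  then show ?case using hd by (auto simp: differentiable_def)
qed

lemma Ck_on_sum:
  assumes "open S" "\<And>i. i \<in> I \<Longrightarrow> Ck_on k S (f i)"
  shows "Ck_on k S (\<lambda>x. \<Sum>i\<in>I. f i x)"
  using assms(2)
  by (induction I rule: infinite_finite_induct) (auto intro: Ck_on_const Ck_on_add[OF assms(1)])

lemma derivative_basis_sum:
  assumes "f differentiable (at x)"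
  shows "frechet_derivative f (at x) v = (\<Sum>b\<in>Basis. (v \<bullet> b) *\<^sub>R frechet_derivative f (at x) b)"
proof -
  interpret bounded_linear "frechet_derivative f (at x)"
    using assms has_derivative_bounded_linear has_derivative_frechet by blast
  have "frechet_derivative f (at x) v = frechet_derivative f (at x) (\<Sum>b\<in>Basis. (v \<bullet> b) *\<^sub>R b)"
    by (simp add: euclidean_representation)
  then show ?thesis by (simp add: sum scaleR)
qed

lemma Ck_on_comp:
  assumes "open S" "open S'" "\<And>x. x \<in> S \<Longrightarrow> f x \<in> S'" "Ck_on k S f" "Ck_on k S' g"
  shows "Ck_on k S (\<lambda>x. g (f x))"
  using assms(3-5)
proof (induction k arbitrary: f g)
  case 0
  then show ?case using continuous_on_compose2[of S' g S f] by auto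
next
  case (Suc k)
  have hd: "((\<lambda>x. g (f x)) has_derivative
      (\<lambda>v. \<Sum>b\<in>Basis. (frechet_derivative f (at x) v \<bullet> b) *\<^sub>R frechet_derivative g (at (f x)) b)) (at x)"
    if x: "x \<in> S" for x
  proof -
    have g: "g differentiable (at (f x))" using Suc.prems x by auto
    have "((\<lambda>x. g (f x)) has_derivative
      (\<lambda>v. frechet_derivative g (at (f x)) (frechet_derivative f (at x) v))) (at x)"
      using Suc.prems x g by (intro has_derivative_compose[of f _ x UNIV g] has_derivative_frechet) auto
    then show ?thesis by (subst (asm) derivative_basis_sum[OF g])
  qed
  have "Ck_on k S (\<lambda>x. \<Sum>b\<in>Basis. (frechet_derivative f (at x) v \<bullet> b) *\<^sub>R frechet_derivative g (at (f x)) b)" for v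
    using Suc.prems Ck_on_Suc_imp[OF Suc.prems(2)]
    by (intro Ck_on_sum Ck_on_bilinear[OF _ bounded_bilinear_scaleR]
        Ck_on_compose_linear[of S "\<lambda>u. u \<bullet> _"] Suc.IH bounded_linear_inner_left \<open>open S\<close>) auto
  then have "Ck_on k S (\<lambda>x. frechet_derivative (\<lambda>x. g (f x)) (at x) v)" for v
    by (rule Ck_on_cong[OF \<open>open S\<close>, rotated]) (use frechet_eq[OF hd] in auto)
  then show ?case using hd by (auto simp: differentiable_def)
qed

lemma smooth_on_subset: "smooth_on S f \<Longrightarrow> S' \<subseteq> S \<Longrightarrow> smooth_on S' f"
  by (auto simp: smooth_on_def intro: Ck_on_subset)

lemma smooth_on_cong:
  "open S \<Longrightarrow> smooth_on S f \<Longrightarrow> (\<And>y. y \<in> S \<Longrightarrow> f y = g y) \<Longrightarrow> smooth_on S g"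
  by (auto simp: smooth_on_def intro: Ck_on_cong)

lemma smooth_on_local:
  "(\<And>x. x \<in> S \<Longrightarrow> \<exists>V. open V \<and> x \<in> V \<and> smooth_on V f) \<Longrightarrow> smooth_on S f"
  unfolding smooth_on_def by (meson Ck_on_local)

lemma smooth_on_differentiable: "smooth_on S f \<Longrightarrow> x \<in> S \<Longrightarrow> f differentiable (at x)"
  unfolding smooth_on_def by (metis Ck_on.simps(2))

lemma smooth_on_has_derivative:
  "smooth_on S f \<Longrightarrow> x \<in> S \<Longrightarrow> (f has_derivative frechet_derivative f (at x)) (at x)"
  by (simp add: has_derivative_frechet smooth_on_differentiable)

lemma smooth_on_continuous: "smooth_on S f \<Longrightarrow> continuous_on S f"
  unfolding smooth_on_def by (metis Ck_on.simps(1))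

lemma smooth_on_deriv_const: "smooth_on S f \<Longrightarrow> smooth_on S (\<lambda>x. frechet_derivative f (at x) v)"
  unfolding smooth_on_def by (metis Ck_on.simps(2))

lemma smooth_on_const: "smooth_on S (\<lambda>x. c)"
  by (simp add: smooth_on_def Ck_on_const)

lemma smooth_on_linear: "bounded_linear L \<Longrightarrow> smooth_on S L"
  by (simp add: smooth_on_def Ck_on_linear)

lemma smooth_on_compose_linear:
  "bounded_linear L \<Longrightarrow> open S \<Longrightarrow> smooth_on S f \<Longrightarrow> smooth_on S (\<lambda>x. L (f x))"
  by (simp add: smooth_on_def Ck_on_compose_linear)

lemma smooth_on_add:
  "open S \<Longrightarrow> smooth_on S f \<Longrightarrow> smooth_on S g \<Longrightarrow> smooth_on S (\<lambda>x. f x + g x)"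
  by (simp add: smooth_on_def Ck_on_add)

lemma smooth_on_bilinear:
  "bounded_bilinear B \<Longrightarrow> open S \<Longrightarrow> smooth_on S f \<Longrightarrow> smooth_on S g \<Longrightarrow>
   smooth_on S (\<lambda>x. B (f x) (g x))"
  by (simp add: smooth_on_def Ck_on_bilinear)

lemma smooth_on_minus: "open S \<Longrightarrow> smooth_on S f \<Longrightarrow> smooth_on S (\<lambda>x. - f x)"
  using smooth_on_compose_linear[of "\<lambda>x. - x" S f] bounded_linear_minus[OF bounded_linear_ident] by simp

lemma smooth_on_diff:
  "open S \<Longrightarrow> smooth_on S f \<Longrightarrow> smooth_on S g \<Longrightarrow> smooth_on S (\<lambda>x. f x - g x)"
  using smooth_on_add[of S f "\<lambda>x. - g x"] smooth_on_minus[of S g] by simp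

lemmas smooth_on_scaleR = smooth_on_bilinear[OF bounded_bilinear_scaleR]
lemmas smooth_on_inner = smooth_on_bilinear[OF bounded_bilinear_inner]
lemma smooth_on_mult:
  fixes f g :: "_ \<Rightarrow> real"
  shows "open S \<Longrightarrow> smooth_on S f \<Longrightarrow> smooth_on S g \<Longrightarrow> smooth_on S (\<lambda>x. f x * g x)"
  by (rule smooth_on_bilinear[OF bounded_bilinear_mult])

lemma smooth_on_sum:
  "open S \<Longrightarrow> (\<And>i. i \<in> I \<Longrightarrow> smooth_on S (f i)) \<Longrightarrow> smooth_on S (\<lambda>x. \<Sum>i\<in>I. f i x)"
  by (simp add: smooth_on_def Ck_on_sum)

lemma smooth_on_comp:
  "open S \<Longrightarrow> open S' \<Longrightarrow> (\<And>x. x \<in> S \<Longrightarrow> f x \<in> S') \<Longrightarrow> smooth_on S f \<Longrightarrow> smooth_on S' g \<Longrightarrow>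
   smooth_on S (\<lambda>x. g (f x))"
  using Ck_on_comp by (fastforce simp: smooth_on_def)

lemma smooth_on_Pair:
  assumes "open S" "smooth_on S f" "smooth_on S g"
  shows "smooth_on S (\<lambda>x. (f x, g x))"
proof -
  have "smooth_on S (\<lambda>x. (f x, 0) + (0, g x))"
    by (intro smooth_on_add smooth_on_compose_linear[of "\<lambda>x. (x, 0)"]
        smooth_on_compose_linear[of "\<lambda>x. (0, x)"] assms bounded_linear_Pair
        bounded_linear_ident bounded_linear_zero)
  then show ?thesis by simp
qed

lemma smooth_on_deriv:
  assumes "open S" "smooth_on S f" "smooth_on S V"
  shows "smooth_on S (\<lambda>x. frechet_derivative f (at x) (V x))"
proof (rule smooth_on_cong[OF \<open>open S\<close>])
  show "smooth_on S (\<lambda>x. \<Sum>b\<in>Basis. (V x \<bullet> b) *\<^sub>R frechet_derivative f (at x) b)"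
    using assms by (intro smooth_on_sum smooth_on_scaleR smooth_on_inner smooth_on_deriv_const
        smooth_on_const)
next
  fix y assume "y \<in> S"
  then show "(\<Sum>b\<in>Basis. (V y \<bullet> b) *\<^sub>R frechet_derivative f (at y) b) = frechet_derivative f (at y) (V y)"
    using derivative_basis_sum[OF smooth_on_differentiable[OF assms(2)]] by metis
qed

lemma line_derivative:
  fixes g :: "'a::real_normed_vector \<Rightarrow> real"
  assumes "g differentiable (at (c + t *\<^sub>R w))"
  shows "((\<lambda>\<tau>. g (c + \<tau> *\<^sub>R w)) has_real_derivative frechet_derivative g (at (c + t *\<^sub>R w)) w) (at t)"
proof -
  have g: "(g has_derivative frechet_derivative g (at (c + t *\<^sub>R w))) (at (c + t *\<^sub>R w))"
    using assms by (rule has_derivative_frechet)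
  have "((\<lambda>\<tau>. g (c + \<tau> *\<^sub>R w)) has_derivative
      (\<lambda>h. frechet_derivative g (at (c + t *\<^sub>R w)) (h *\<^sub>R w))) (at t)"
    by (rule has_derivative_compose[of "\<lambda>\<tau>. c + \<tau> *\<^sub>R w", OF _ g])
      (auto intro!: derivative_eq_intros)
  moreover have "frechet_derivative g (at (c + t *\<^sub>R w)) (h *\<^sub>R w) =
      frechet_derivative g (at (c + t *\<^sub>R w)) w * h" for h
    using has_derivative_bounded_linear[OF g] by (simp add: linear_simps)
  ultimately show ?thesis by (simp add: has_field_derivative_def)
qed

lemma second_difference_mvt:
  fixes f :: "'a::euclidean_space \<Rightarrow> real"
  assumes "smooth_on (ball x e) f" "0 < s" "s * (norm u + norm v) < e"
  shows "\<exists>y. norm (y - x) \<le> s * (norm u + norm v) \<and>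
     f (x + s *\<^sub>R u + s *\<^sub>R v) - f (x + s *\<^sub>R u) - f (x + s *\<^sub>R v) + f x =
       s * (s * frechet_derivative (\<lambda>y. frechet_derivative f (at y) u) (at y) v)"
proof -
  have nb: "norm (\<tau> *\<^sub>R u + \<eta> *\<^sub>R v) \<le> s * (norm u + norm v)"
    if "0 \<le> \<tau>" "\<tau> \<le> s" "0 \<le> \<eta>" "\<eta> \<le> s" for \<tau> \<eta>
  proof -
    have "norm (\<tau> *\<^sub>R u + \<eta> *\<^sub>R v) \<le> \<tau> * norm u + \<eta> * norm v"
      using norm_triangle_ineq[of "\<tau> *\<^sub>R u" "\<eta> *\<^sub>R v"] that by simp
    also have "\<dots> \<le> s * norm u + s * norm v"
      using that by (intro add_mono mult_right_mono) auto
    finally show ?thesis by (simp add: algebra_simps)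
  qed
  have inb: "x + \<tau> *\<^sub>R u + \<eta> *\<^sub>R v \<in> ball x e"
    if "0 \<le> \<tau>" "\<tau> \<le> s" "0 \<le> \<eta>" "\<eta> \<le> s" for \<tau> \<eta>
  proof -
    have "dist x (x + \<tau> *\<^sub>R u + \<eta> *\<^sub>R v) = norm (\<tau> *\<^sub>R u + \<eta> *\<^sub>R v)"
      by (metis add.assoc add_diff_cancel_left' dist_commute dist_norm)
    then show ?thesis using nb[OF that] assms(3) by simp
  qed
  let ?D = "\<lambda>y. frechet_derivative f (at y)"
  have "\<exists>\<xi>. 0 < \<xi> \<and> \<xi> < s \<and> (\<lambda>\<tau>. f (x + s *\<^sub>R v + \<tau> *\<^sub>R u) - f (x + \<tau> *\<^sub>R u)) s -
      (\<lambda>\<tau>. f (x + s *\<^sub>R v + \<tau> *\<^sub>R u) - f (x + \<tau> *\<^sub>R u)) 0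
      = (s - 0) * (?D (x + s *\<^sub>R v + \<xi> *\<^sub>R u) u - ?D (x + \<xi> *\<^sub>R u) u)"
  proof (rule MVT2[OF \<open>0 < s\<close>])
    fix t assume t: "0 \<le> t" "t \<le> s"
    have "f differentiable (at (x + s *\<^sub>R v + t *\<^sub>R u))" "f differentiable (at (x + t *\<^sub>R u))"
      using inb[of t s] inb[of t 0] t \<open>0 < s\<close>
      by (auto intro!: smooth_on_differentiable[OF assms(1)] simp: add_ac)
    then show "((\<lambda>\<tau>. f (x + s *\<^sub>R v + \<tau> *\<^sub>R u) - f (x + \<tau> *\<^sub>R u)) has_real_derivative
       ?D (x + s *\<^sub>R v + t *\<^sub>R u) u - ?D (x + t *\<^sub>R u) u) (at t)"
      by (intro DERIV_diff line_derivative)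
  qed
  then obtain \<xi> where \<xi>: "0 < \<xi>" "\<xi> < s" "f (x + s *\<^sub>R v + s *\<^sub>R u) - f (x + s *\<^sub>R u) - (f (x + s *\<^sub>R v) - f x)
      = s * (?D (x + s *\<^sub>R v + \<xi> *\<^sub>R u) u - ?D (x + \<xi> *\<^sub>R u) u)" by auto
  have "\<exists>\<eta>. 0 < \<eta> \<and> \<eta> < s \<and> (\<lambda>\<tau>. ?D (x + \<xi> *\<^sub>R u + \<tau> *\<^sub>R v) u) s - (\<lambda>\<tau>. ?D (x + \<xi> *\<^sub>R u + \<tau> *\<^sub>R v) u) 0
      = (s - 0) * frechet_derivative (\<lambda>y. ?D y u) (at (x + \<xi> *\<^sub>R u + \<eta> *\<^sub>R v)) v"
  proof (rule MVT2[OF \<open>0 < s\<close>])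
    fix t assume t: "0 \<le> t" "t \<le> s"
    have "(\<lambda>y. ?D y u) differentiable (at (x + \<xi> *\<^sub>R u + t *\<^sub>R v))"
      using inb[of \<xi> t] t \<xi> by (intro smooth_on_differentiable[OF smooth_on_deriv_const[OF assms(1)]]) auto
    then show "((\<lambda>\<tau>. ?D (x + \<xi> *\<^sub>R u + \<tau> *\<^sub>R v) u) has_real_derivative
       frechet_derivative (\<lambda>y. ?D y u) (at (x + \<xi> *\<^sub>R u + t *\<^sub>R v)) v) (at t)"
      by (rule line_derivative)
  qed
  then obtain \<eta> where \<eta>: "0 < \<eta>" "\<eta> < s" "?D (x + \<xi> *\<^sub>R u + s *\<^sub>R v) u - ?D (x + \<xi> *\<^sub>R u) u
      = s * frechet_derivative (\<lambda>y. ?D y u) (at (x + \<xi> *\<^sub>R u + \<eta> *\<^sub>R v)) v" by auto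
  show ?thesis
  proof (intro exI[of _ "x + \<xi> *\<^sub>R u + \<eta> *\<^sub>R v"] conjI)
    show "norm (x + \<xi> *\<^sub>R u + \<eta> *\<^sub>R v - x) \<le> s * (norm u + norm v)"
      using nb[of \<xi> \<eta>] \<xi> \<eta> by (simp add: add.assoc)
    have comm: "x + s *\<^sub>R v + \<xi> *\<^sub>R u = x + \<xi> *\<^sub>R u + s *\<^sub>R v"
        "x + s *\<^sub>R v + s *\<^sub>R u = x + s *\<^sub>R u + s *\<^sub>R v"
      by simp_all
    show "f (x + s *\<^sub>R u + s *\<^sub>R v) - f (x + s *\<^sub>R u) - f (x + s *\<^sub>R v) + f x =
       s * (s * frechet_derivative (\<lambda>y. ?D y u) (at (x + \<xi> *\<^sub>R u + \<eta> *\<^sub>R v)) v)"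
      using \<xi>(3)[unfolded comm \<eta>(3)] by simp
  qed
qed

lemma mixed_derivatives_real:
  fixes f :: "'a::euclidean_space \<Rightarrow> real"
  assumes "open S" "smooth_on S f" "x \<in> S"
  shows "frechet_derivative (\<lambda>y. frechet_derivative f (at y) u) (at x) v =
         frechet_derivative (\<lambda>y. frechet_derivative f (at y) v) (at x) u"
proof -
  define G where "G u v y = frechet_derivative (\<lambda>y. frechet_derivative f (at y) u) (at y) v" for u v y
  obtain e where e: "e > 0" "ball x e \<subseteq> S" using assms openE by blast
  have sm: "smooth_on (ball x e) f" using assms(2) e(2) by (rule smooth_on_subset)
  have cont: "isCont (G u v) x" for u v
    using smooth_on_continuous[OF smooth_on_deriv_const[OF smooth_on_deriv_const[OF assms(2)]]] assms
    unfolding G_def by (simp add: continuous_on_eq_continuous_at)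
  have "\<bar>G u v x - G v u x\<bar> \<le> 2 * d" if "d > 0" for d :: real
  proof -
    obtain r1 where r1: "r1 > 0" "\<And>y. dist y x < r1 \<Longrightarrow> dist (G u v y) (G u v x) < d"
      using cont[of u v] \<open>d > 0\<close> unfolding continuous_at by (metis LIM_def dist_self)
    obtain r2 where r2: "r2 > 0" "\<And>y. dist y x < r2 \<Longrightarrow> dist (G v u y) (G v u x) < d"
      using cont[of v u] \<open>d > 0\<close> unfolding continuous_at by (metis LIM_def dist_self)
    define s where "s = min e (min r1 r2) / (2 * (norm u + norm v + 1))"
    have pos: "norm u + norm v + 1 > 0" by (meson add_nonneg_pos norm_ge_zero add_nonneg_nonneg zero_less_one)
    have s0: "s > 0" using e r1 r2 pos by (simp add: s_def)
    have "s * (norm u + norm v) \<le> s * (norm u + norm v + 1)" using s0 by simp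
    also have "\<dots> = min e (min r1 r2) / 2" using pos by (simp add: s_def field_simps)
    also have "\<dots> < min e (min r1 r2)" using e r1 r2 by linarith
    finally have sb: "s * (norm u + norm v) < min e (min r1 r2)" .
    obtain y1 where y1: "norm (y1 - x) \<le> s * (norm u + norm v)"
      "f (x + s *\<^sub>R u + s *\<^sub>R v) - f (x + s *\<^sub>R u) - f (x + s *\<^sub>R v) + f x = s * (s * G u v y1)"
      using second_difference_mvt[OF sm s0, of u v] sb unfolding G_def by auto
    obtain y2 where y2: "norm (y2 - x) \<le> s * (norm u + norm v)"
      "f (x + s *\<^sub>R v + s *\<^sub>R u) - f (x + s *\<^sub>R v) - f (x + s *\<^sub>R u) + f x = s * (s * G v u y2)"
      using second_difference_mvt[OF sm s0, of v u] sb unfolding G_def by (auto simp: add.commute)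
    have comm: "x + s *\<^sub>R v + s *\<^sub>R u = x + s *\<^sub>R u + s *\<^sub>R v" by simp
    have "s * (s * G u v y1) = s * (s * G v u y2)" using y1(2) y2(2)[unfolded comm] by linarith
    then have "G u v y1 = G v u y2" using s0 by simp
    moreover have "dist (G u v y1) (G u v x) < d" "dist (G v u y2) (G v u x) < d"
      using r1(2)[of y1] r2(2)[of y2] y1(1) y2(1) sb by (auto simp: dist_norm)
    ultimately show ?thesis by (auto simp: dist_real_def)
  qed
  then have "\<bar>G u v x - G v u x\<bar> \<le> 0"
    by (metis dense_ge half_gt_zero_iff mult.commute nonzero_mult_div_cancel_right
        times_divide_eq_right zero_neq_numeral)
  then show ?thesis by (simp add: G_def)
qed

lemma linear_frechet_smooth: "smooth_on S f \<Longrightarrow> x \<in> S \<Longrightarrow> linear (frechet_derivative f (at x))"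
  by (rule linear_frechet_derivative[OF smooth_on_differentiable])

lemma norm_linear_le_Basis:
  assumes "linear (f :: 'a::euclidean_space \<Rightarrow> 'b::real_normed_vector)" "\<And>b. b \<in> Basis \<Longrightarrow> norm (f b) \<le> K"
  shows "norm (f v) \<le> real DIM('a) * K * norm v"
proof -
  have "f v = f (\<Sum>b\<in>Basis. (v \<bullet> b) *\<^sub>R b)" by (simp add: euclidean_representation)
  also have "\<dots> = (\<Sum>b\<in>Basis. (v \<bullet> b) *\<^sub>R f b)" by (simp add: linear_sum[OF assms(1)] linear_cmul[OF assms(1)])
  finally have "norm (f v) = norm (\<Sum>b\<in>Basis. (v \<bullet> b) *\<^sub>R f b)" by simp
  also have "\<dots> \<le> (\<Sum>b\<in>(Basis::'a set). norm v * K)"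
  proof (rule sum_norm_le)
    fix b :: 'a assume b: "b \<in> Basis"
    show "norm ((v \<bullet> b) *\<^sub>R f b) \<le> norm v * K"
      unfolding norm_scaleR using assms(2)[OF b] Basis_le_norm[OF b, of v] by (intro mult_mono) auto
  qed
  finally show ?thesis by (simp add: mult_ac)
qed

lemma smooth_cball_bounds:
  fixes f :: "'a::euclidean_space \<Rightarrow> 'b::euclidean_space"
  assumes "smooth_on S f" "cball q R \<subseteq> S"
  obtains L where "0 \<le> L" "\<And>x v. x \<in> cball q R \<Longrightarrow> norm (frechet_derivative f (at x) v) \<le> L * norm v"
    "\<And>x y. x \<in> cball q R \<Longrightarrow> y \<in> cball q R \<Longrightarrow> norm (f x - f y) \<le> L * norm (x - y)"
proof -
  have sm: "smooth_on (cball q R) f" using assms by (rule smooth_on_subset)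
  have lin: "linear (frechet_derivative f (at x))" if "x \<in> cball q R" for x
    using linear_frechet_smooth[OF sm that] .
  have "\<forall>b. \<exists>K. \<forall>x\<in>cball q R. norm (frechet_derivative f (at x) b) \<le> K"
  proof
    fix b
    have "compact ((\<lambda>x. frechet_derivative f (at x) b) ` cball q R)"
      by (intro compact_continuous_image smooth_on_continuous smooth_on_deriv_const sm compact_cball)
    from bounded_iff[THEN iffD1, OF compact_imp_bounded[OF this]]
    obtain K where K: "\<And>z. z \<in> (\<lambda>x. frechet_derivative f (at x) b) ` cball q R \<Longrightarrow> norm z \<le> K" by blast
    show "\<exists>K. \<forall>x\<in>cball q R. norm (frechet_derivative f (at x) b) \<le> K"
      by (intro exI[of _ K] ballI K imageI)
  qed
  from choice[OF this] obtain K where K: "\<And>x b. x \<in> cball q R \<Longrightarrow> norm (frechet_derivative f (at x) b) \<le> K b"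
    by blast
  define K' where "K' = (\<Sum>b\<in>(Basis::'a set). \<bar>K b\<bar>)"
  have K': "norm (frechet_derivative f (at x) b) \<le> K'" if "x \<in> cball q R" "b \<in> Basis" for x b
  proof -
    have "norm (frechet_derivative f (at x) b) \<le> \<bar>K b\<bar>" using K[OF that(1), of b] by linarith
    also have "\<dots> \<le> K'" unfolding K'_def by (rule member_le_sum) (use that(2) in auto)
    finally show ?thesis .
  qed
  define L where "L = real DIM('a) * K'"
  have L0: "0 \<le> L" by (simp add: L_def K'_def sum_nonneg)
  have L: "norm (frechet_derivative f (at x) v) \<le> L * norm v" if "x \<in> cball q R" for x v
    unfolding L_def
  proof (rule norm_linear_le_Basis[where f = "frechet_derivative f (at x)"])
    show "linear (frechet_derivative f (at x))" by (rule lin[OF that])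
    show "norm (frechet_derivative f (at x) b) \<le> K'" if "b \<in> Basis" for b by (rule K'[OF \<open>x \<in> cball q R\<close> that])
  qed
  have "norm (f x - f y) \<le> L * norm (x - y)" if "x \<in> cball q R" "y \<in> cball q R" for x y
  proof (rule differentiable_bound[OF convex_cball _ _ that])
    fix z assume z: "z \<in> cball q R"
    show "(f has_derivative frechet_derivative f (at z)) (at z within cball q R)"
      by (rule has_derivative_at_withinI[OF smooth_on_has_derivative[OF sm z]])
    show "onorm (frechet_derivative f (at z)) \<le> L" by (intro onorm_bound L0 L z)
  qed
  from L0 L this show ?thesis by (rule that)
qed

lemma smooth_uniformly_differentiable:
  fixes f :: "'a::euclidean_space \<Rightarrow> 'b::euclidean_space"
  assumes "smooth_on S f" "cball q R \<subseteq> S" "0 < \<omega>"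
  shows "\<exists>\<rho>>0. \<forall>x\<in>cball q R. \<forall>y\<in>cball q R. dist x y < \<rho> \<longrightarrow>
      norm (f y - f x - frechet_derivative f (at x) (y - x)) \<le> \<omega> * norm (y - x)"
proof -
  have sm: "smooth_on (cball q R) f" using assms(1,2) by (rule smooth_on_subset)
  let ?D = "\<lambda>x. frechet_derivative f (at x)"
  have lin: "linear (?D x)" if "x \<in> cball q R" for x using linear_frechet_smooth[OF sm that] .
  define \<omega>' where "\<omega>' = \<omega> / DIM('a)"
  have \<omega>': "0 < \<omega>'" using assms(3) by (simp add: \<omega>'_def)
  have "\<forall>b. \<exists>\<rho>. 0 < \<rho> \<and> (\<forall>x\<in>cball q R. \<forall>y\<in>cball q R. dist y x < \<rho> \<longrightarrow> norm (?D y b - ?D x b) < \<omega>')"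
  proof
    fix b
    have "uniformly_continuous_on (cball q R) (\<lambda>x. ?D x b)"
      by (intro compact_uniformly_continuous smooth_on_continuous smooth_on_deriv_const sm compact_cball)
    from uniformly_continuous_onE[OF this \<omega>'] obtain d where "d > 0"
      "\<And>x y. x \<in> cball q R \<Longrightarrow> y \<in> cball q R \<Longrightarrow> dist y x < d \<Longrightarrow> dist (?D y b) (?D x b) < \<omega>'"
      by blast
    then show "\<exists>\<rho>. 0 < \<rho> \<and> (\<forall>x\<in>cball q R. \<forall>y\<in>cball q R. dist y x < \<rho> \<longrightarrow> norm (?D y b - ?D x b) < \<omega>')"
      by (intro exI[of _ d] conjI ballI impI) (simp_all only: dist_norm[of "?D _ b"])
  qed
  from choice[OF this] obtain \<rho>b where \<rho>b: "\<And>b. 0 < \<rho>b b" "\<And>b x y. x \<in> cball q R \<Longrightarrow> y \<in> cball q R \<Longrightarrow> dist y x < \<rho>b b \<Longrightarrow>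
      norm (?D y b - ?D x b) < \<omega>'" by blast
  define \<rho> where "\<rho> = Min (\<rho>b ` (Basis :: 'a set))"
  have \<rho>: "0 < \<rho>" "\<And>b. b \<in> Basis \<Longrightarrow> \<rho> \<le> \<rho>b b" using \<rho>b(1) by (auto simp: \<rho>_def)
  have "norm (f y - f x - ?D x (y - x)) \<le> \<omega> * norm (y - x)"
    if x: "x \<in> cball q R" and y: "y \<in> cball q R" and d: "dist x y < \<rho>" for x y
  proof -
    let ?C = "cball q R \<inter> cball x (dist x y)"
    have "norm ((f y - ?D x y) - (f x - ?D x x)) \<le> \<omega> * norm (y - x)"
    proof (rule differentiable_bound[where S = ?C and f' = "\<lambda>z v. ?D z v - ?D x v"])
      fix z assume z: "z \<in> ?C"
      show "((\<lambda>z. f z - ?D x z) has_derivative (\<lambda>v. ?D z v - ?D x v)) (at z within ?C)"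
      proof (rule has_derivative_diff)
        have "z \<in> cball q R" using z by simp
        then show "(f has_derivative ?D z) (at z within ?C)"
          by (rule has_derivative_at_withinI[OF smooth_on_has_derivative[OF sm]])
        show "(?D x has_derivative ?D x) (at z within ?C)"
          by (rule linear_imp_has_derivative[OF lin[OF x]])
      qed
      show "onorm (\<lambda>v. ?D z v - ?D x v) \<le> \<omega>"
      proof (rule onorm_bound)
        fix v
        have "norm (?D z v - ?D x v) \<le> real DIM('a) * \<omega>' * norm v"
        proof (rule norm_linear_le_Basis[where f = "\<lambda>v. ?D z v - ?D x v"])
          show "linear (\<lambda>v. ?D z v - ?D x v)" using z x by (intro linear_compose_sub lin) auto
          fix b :: 'a assume "b \<in> Basis"
          then have "dist z x < \<rho>b b" using z d \<rho>(2)[of b] by (simp add: dist_commute)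
          then show "norm (?D z b - ?D x b) \<le> \<omega>'" using z x \<rho>b(2)[of x z b] by simp
        qed
        then show "norm (?D z v - ?D x v) \<le> \<omega> * norm v" by (simp add: \<omega>'_def)
      qed (use assms in simp)
    qed (use x y in \<open>auto intro: convex_Int\<close>)
    moreover have "f y - f x - ?D x (y - x) = (f y - ?D x y) - (f x - ?D x x)"
      by (simp add: linear_diff[OF lin[OF x]])
    ultimately show ?thesis by (simp only:)
  qed
  then show ?thesis using \<rho>(1) by blast
qed

section \<open>Linear algebra over power series\<close>

lemma det_row_expand:
  fixes G :: "'n::finite \<Rightarrow> 'a::comm_ring_1^'n"
  shows "det (\<chi> i. if i = k then v else G i) = (\<Sum>a\<in>UNIV. v$a * det (\<chi> i. if i = k then axis a 1 else G i))"
proof -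
  have v: "v = (\<Sum>a\<in>UNIV. v$a *s axis a 1)"
    by (simp add: vec_eq_iff axis_def if_distrib cong: if_cong)
  have "det (\<chi> i. if i = k then v else G i) = det (\<chi> i. if i = k then (\<Sum>a\<in>UNIV. v$a *s axis a 1) else G i)"
    using arg_cong[OF v, of "\<lambda>v. det (\<chi> i. if i = k then v else G i)"] .
  also have "\<dots> = (\<Sum>a\<in>UNIV. det (\<chi> i. if i = k then v$a *s axis a 1 else G i))"
    by (rule det_linear_row_sum) simp
  finally show ?thesis by (simp add: det_row_mul)
qed

lemma det_row_replace:
  fixes G :: "'n::finite \<Rightarrow> 'a::comm_ring_1^'n"
  shows "det (\<chi> i. if i = k then G l else G i) = (if l = k then det (\<chi> i. G i) else 0)"
proof (cases "l = k")
  case True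
  then have "(\<lambda>i. if i = k then G l else G i) = G" by auto
  then show ?thesis using True by simp
next
  case False
  then show ?thesis
    using det_identical_rows[of l k "\<chi> i. if i = k then G l else G i"]
    by (auto simp: row_def vec_eq_iff)
qed

lemma right_adjugate:
  fixes A :: "'a::comm_ring_1^'n::finite^'n"
  shows "A ** (\<chi> j k. det (\<chi> i. if i = k then axis j 1 else A $ i)) = mat (det A)"
proof -
  have A: "(\<chi> i. A $ i) = A" by (simp add: vec_eq_iff)
  have "(\<Sum>j\<in>UNIV. A$i$j * det (\<chi> i. if i = k then axis j 1 else A $ i)) = (if i = k then det A else 0)" for i k
    using det_row_expand[of k "A$i" "($) A", symmetric] det_row_replace[of k "($) A" i] A by simp
  then show ?thesis by (simp add: matrix_matrix_mult_def mat_def)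
qed

lemma mat_mult_left: "mat d ** A = (\<chi> i j. d * A$i$j)" for A :: "'a::comm_ring_1^'n::finite^'n"
  by (simp add: matrix_matrix_mult_def mat_def if_distrib[of "\<lambda>x. x * _"] vec_eq_iff cong: if_cong)

lemma mat_mult_right: "A ** mat d = (\<chi> i j. d * A$i$j)" for A :: "'a::comm_ring_1^'n::finite^'n"
  by (simp add: matrix_matrix_mult_def mat_def if_distrib vec_eq_iff mult.commute cong: if_cong)

lemma right_adjugate_commutes:
  fixes A C :: "'a::idom^'n::finite^'n"
  assumes C: "A ** C = mat (det A)" and "det A \<noteq> 0"
  shows "C ** A = mat (det A)"
proof -
  obtain B where B: "transpose A ** B = mat (det A)"
    using right_adjugate[of "transpose A"] by auto
  have "transpose (transpose A ** B) = mat (det A)"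
    unfolding B by (auto simp: transpose_def mat_def vec_eq_iff)
  then have B': "transpose B ** A = mat (det A)" by (simp add: matrix_transpose_mul)
  have eq: "mat (det A) ** C = transpose B ** mat (det A)"
    by (metis B' C matrix_mul_assoc)
  have "det A * C$i$j = det A * transpose B$i$j" for i j
    using arg_cong[OF eq, of "\<lambda>M. M$i$j"] unfolding mat_mult_left mat_mult_right by simp
  then have "C = transpose B" using assms(2) by (simp add: vec_eq_iff)
  then show ?thesis using B' by simp
qed

text \<open>Stated without division, since power series determinants need not be units.\<close>

lemma cramer_rows:
  fixes G :: "'n::finite \<Rightarrow> 'a::idom^'n"
  assumes "det (\<chi> i. G i) \<noteq> 0"
  shows "det (\<chi> i. G i) * Y $ a = (\<Sum>k\<in>UNIV. det (\<chi> i. if i = k then Y else G i) * G k $ a)"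
proof -
  let ?A = "\<chi> i. G i"
  define C where "C = (\<chi> j k. det (\<chi> i. if i = k then axis j 1 else G i))"
  have "?A ** C = mat (det ?A)" using right_adjugate[of ?A] by (simp add: C_def cong: if_cong)
  then have "C ** ?A = mat (det ?A)" using assms by (rule right_adjugate_commutes)
  then have CA: "(\<Sum>k\<in>UNIV. C$j$k * G k $ a) = (if j = a then det ?A else 0)" for j
    by (simp add: matrix_matrix_mult_def mat_def vec_eq_iff)
  have "(\<Sum>k\<in>UNIV. det (\<chi> i. if i = k then Y else G i) * G k $ a)
      = (\<Sum>k\<in>UNIV. \<Sum>j\<in>UNIV. Y$j * (C$j$k * G k $ a))"
    by (simp add: det_row_expand[of _ Y] C_def sum_distrib_right mult.assoc)
  also have "\<dots> = (\<Sum>j\<in>UNIV. Y$j * (\<Sum>k\<in>UNIV. C$j$k * G k $ a))"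
    by (subst sum.swap) (simp add: sum_distrib_left)
  also have "\<dots> = det ?A * Y $ a" by (simp add: CA if_distrib cong: if_cong)
  finally show ?thesis by simp
qed

lemma solve_up_to_det:
  fixes A :: "'a::idom^'n::finite^'n"
  shows "\<exists>z. \<forall>a. (\<Sum>j\<in>UNIV. A$a$j * z j) = det A * w a"
proof -
  obtain C where C: "A ** C = mat (det A)" using right_adjugate[of A] by blast
  have "(\<Sum>j\<in>UNIV. A$a$j * (\<Sum>k\<in>UNIV. C$j$k * w k)) = det A * w a" for a
  proof -
    have "(\<Sum>j\<in>UNIV. A$a$j * (\<Sum>k\<in>UNIV. C$j$k * w k)) = (\<Sum>k\<in>UNIV. (A**C)$a$k * w k)"
      by (simp add: matrix_matrix_mult_def sum_distrib_left sum_distrib_right mult.assoc)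
        (rule sum.swap)
    also have "\<dots> = det A * w a" by (simp add: C mat_def if_distrib[of "\<lambda>x. x * _"] cong: if_cong)
    finally show ?thesis .
  qed
  then show ?thesis by (intro exI[of _ "\<lambda>j. \<Sum>k\<in>UNIV. C$j$k * w k"]) blast
qed

lemma left_kernel_zero:
  fixes A :: "'a::idom^'n::finite^'n"
  assumes "det A \<noteq> 0" "\<And>j. (\<Sum>a\<in>UNIV. v a * A$a$j) = 0"
  shows "v a = 0"
proof -
  obtain C where C: "A ** C = mat (det A)" using right_adjugate[of A] by blast
  have "0 = (\<Sum>j\<in>UNIV. (\<Sum>b\<in>UNIV. v b * A$b$j) * C$j$a)" using assms(2) by simp
  also have "\<dots> = (\<Sum>b\<in>UNIV. v b * (A**C)$b$a)"
    by (simp add: matrix_matrix_mult_def sum_distrib_left sum_distrib_right mult.assoc)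
      (rule sum.swap)
  also have "\<dots> = v a * det A" by (simp add: C mat_def if_distrib cong: if_cong)
  finally show ?thesis using assms(1) by simp
qed

lemma fps_sum_squares_eq_0:
  fixes f :: "'i \<Rightarrow> real fps"
  assumes "finite I" "(\<Sum>i\<in>I. f i * f i) = 0" "i \<in> I"
  shows "f i = 0"
proof -
  have "\<forall>i\<in>I. fps_nth (f i) k = 0" for k
  proof (induction k rule: less_induct)
    case (less k)
    have sq: "fps_nth (f i * f i) (2*k) = (fps_nth (f i) k)\<^sup>2" if "i \<in> I" for i
    proof -
      have "fps_nth (f i) j * fps_nth (f i) (2*k - j) = 0" if "j \<in> {0..2*k} - {k}" for j
      proof (cases "j < k")
        case False
        then have "2*k - j < k" using that by auto
        then show ?thesis using less \<open>i \<in> I\<close> by auto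
      qed (use less \<open>i \<in> I\<close> in auto)
      then have "(\<Sum>j\<in>{0..2*k}. fps_nth (f i) j * fps_nth (f i) (2*k - j)) = (\<Sum>j\<in>{k}. fps_nth (f i) j * fps_nth (f i) (2*k - j))"
        by (intro sum.mono_neutral_right) auto
      then show ?thesis by (simp add: fps_mult_nth power2_eq_square)
    qed
    have "(\<Sum>i\<in>I. (fps_nth (f i) k)\<^sup>2) = fps_nth (\<Sum>i\<in>I. (f i * f i)) (2*k)"
      unfolding fps_sum_nth by (rule sum.cong) (simp_all add: sq)
    then have "(\<Sum>i\<in>I. (fps_nth (f i) k)\<^sup>2) = 0" using assms(2) by simp
    then show ?case using assms(1) by (simp add: sum_nonneg_eq_0_iff)
  qed
  then show ?thesis using assms(3) by (simp add: fps_eq_iff)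
qed

lemma fps_linear_ode:
  fixes A :: "'n::finite \<Rightarrow> 'n \<Rightarrow> real fps"
  shows "\<exists>w. \<forall>a. fps_deriv (w a) = (\<Sum>b\<in>UNIV. A a b * w b) \<and> fps_nth (w a) 0 = \<eta> a"
proof -
  define step where "step ws = (\<lambda>a. (\<Sum>b\<in>UNIV. \<Sum>i\<in>{0..<length ws}. fps_nth (A a b) (length ws - 1 - i) * (ws ! i) b) / real (length ws))"
    for ws :: "('n \<Rightarrow> real) list"
  define L where "L = rec_nat [\<eta>] (\<lambda>k ws. ws @ [step ws])"
  have L0: "L 0 = [\<eta>]" and LS: "L (Suc k) = L k @ [step (L k)]" for k
    by (simp_all add: L_def)
  have len: "length (L k) = Suc k" for k by (induction k) (simp_all add: L0 LS)
  define c where "c i = L i ! i" for i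
  have c: "L k ! i = c i" if "i \<le> k" for i k
    using that
  proof (induction k)
    case (Suc k)
    then show ?case by (cases "i \<le> k") (simp_all add: LS len nth_append c_def le_Suc_eq)
  qed (simp add: c_def)
  have c_Suc: "c (Suc k) a = (\<Sum>b\<in>UNIV. \<Sum>i=0..k. fps_nth (A a b) (k - i) * c i b) / real (Suc k)" for k a
  proof -
    have "c (Suc k) = step (L k)" by (simp add: c_def LS nth_append len)
    moreover have "(\<Sum>i\<in>{0..<Suc k}. fps_nth (A a b) (k - i) * (L k ! i) b) = (\<Sum>i=0..k. fps_nth (A a b) (k - i) * c i b)" for b
      by (rule sum.cong) (auto simp: c)
    ultimately show ?thesis by (simp add: step_def len)
  qed
  define w where "w a = Abs_fps (\<lambda>k. c k a)" for a
  have "fps_deriv (w a) = (\<Sum>b\<in>UNIV. A a b * w b)" for a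
  proof (rule fps_ext)
    fix k
    have "fps_nth (A a b * w b) k = (\<Sum>i=0..k. fps_nth (A a b) (k - i) * c i b)" for b
      unfolding mult.commute[of "A a b" "w b"] fps_mult_nth by (simp add: w_def mult.commute)
    then show "fps_nth (fps_deriv (w a)) k = fps_nth (\<Sum>b\<in>UNIV. A a b * w b) k"
      by (simp add: fps_sum_nth w_def c_Suc del: of_nat_Suc)
  qed
  moreover have "fps_nth (w a) 0 = \<eta> a" for a by (simp add: w_def c_def L0)
  ultimately show ?thesis by blast
qed

section \<open>Taylor series along the Hamiltonian flow\<close>

lemma sum_Basis_prod:
  "(\<Sum>b\<in>Basis. F (b :: 'a::euclidean_space \<times> 'b::euclidean_space)) =
   (\<Sum>b\<in>Basis. F (b, 0)) + (\<Sum>b\<in>Basis. F (0, b))"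
proof -
  have "(\<Sum>b\<in>Basis. F (b :: 'a \<times> 'b)) = sum F ((\<lambda>u. (u, 0)) ` Basis) + sum F ((\<lambda>u. (0, u)) ` Basis)"
    unfolding Basis_prod_def by (rule sum.union_disjoint) auto
  then show ?thesis by (simp add: sum.reindex inj_on_def)
qed

lemma sum_Basis_axis:
  fixes F :: "real^'n \<Rightarrow> 'b::comm_monoid_add"
  shows "(\<Sum>b\<in>Basis. F b) = (\<Sum>i\<in>UNIV. F (axis i 1))"
proof -
  have B: "(Basis :: (real^'n) set) = (\<lambda>i. axis i 1) ` UNIV" by (auto simp: Basis_vec_def)
  show ?thesis unfolding B by (subst sum.reindex) (auto simp: inj_on_def axis_eq_axis)
qed

definition hvec :: "('e::euclidean_space \<times> 'e \<Rightarrow> real) \<Rightarrow> 'e \<times> 'e \<Rightarrow> 'e \<times> 'e" where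
  "hvec h y = (let dh = frechet_derivative h (at y)
     in (\<Sum>b\<in>Basis. dh (0, b) *\<^sub>R b, - (\<Sum>b\<in>Basis. dh (b, 0) *\<^sub>R b)))"

lemma smooth_on_hvec:
  assumes "open S" "smooth_on S h"
  shows "smooth_on S (hvec h)"
proof -
  have "smooth_on S (\<lambda>y. (\<Sum>b\<in>Basis. frechet_derivative h (at y) (0, b) *\<^sub>R b,
      - (\<Sum>b\<in>Basis. frechet_derivative h (at y) (b, 0) *\<^sub>R b)))"
    using assms by (intro smooth_on_Pair smooth_on_minus smooth_on_sum smooth_on_scaleR
        smooth_on_deriv_const smooth_on_const)
  then show ?thesis by (rule smooth_on_cong[OF assms(1)]) (simp add: hvec_def Let_def)
qed

locale sr_frame =
  fixes S :: "(real^'n) set" and X :: "'r::finite \<Rightarrow> real^'n \<Rightarrow> real^'n"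
  assumes open_S: "open S" and smooth_X: "smooth_on S (X i)"
begin

abbreviation "phase \<equiv> S \<times> (UNIV :: (real^'n) set)"

definition ctrl :: "'r \<Rightarrow> (real^'n) \<times> (real^'n) \<Rightarrow> real" where
  "ctrl i y = snd y \<bullet> X i (fst y)"

definition ham :: "(real^'n) \<times> (real^'n) \<Rightarrow> real" where
  "ham y = 1/2 * (\<Sum>i\<in>UNIV. (ctrl i y)\<^sup>2)"

abbreviation "Hv \<equiv> hvec ham"

definition ham_lie :: "((real^'n) \<times> (real^'n) \<Rightarrow> 'c::real_normed_vector) \<Rightarrow> (real^'n) \<times> (real^'n) \<Rightarrow> 'c" where
  "ham_lie g y = frechet_derivative g (at y) (Hv y)"

lemma open_phase: "open phase" by (simp add: open_S open_Times)

lemma smooth_fst: "smooth_on S g \<Longrightarrow> smooth_on phase (\<lambda>y. g (fst y))"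
  by (rule smooth_on_comp[OF open_phase open_S]) (auto simp: smooth_on_linear bounded_linear_fst)

lemma smooth_nth: "open A \<Longrightarrow> smooth_on A g \<Longrightarrow> smooth_on A (\<lambda>y. g y $ a)"
  for g :: "'z::euclidean_space \<Rightarrow> real^'m"
  by (rule smooth_on_compose_linear[OF bounded_linear_vec_nth])

lemma smooth_coords: "smooth_on phase (\<lambda>y. fst y $ a)" "smooth_on phase (\<lambda>y. snd y $ a)"
  by (rule smooth_nth[OF open_phase smooth_on_linear[OF bounded_linear_fst]]
      smooth_nth[OF open_phase smooth_on_linear[OF bounded_linear_snd]])+

lemma smooth_ctrl: "smooth_on phase (ctrl i)"
  unfolding ctrl_def[abs_def]
  by (intro smooth_on_inner open_phase smooth_fst smooth_X smooth_on_linear bounded_linear_snd)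

lemma smooth_ham: "smooth_on phase ham"
  unfolding ham_def[abs_def] power2_eq_square
  by (intro smooth_on_mult smooth_on_sum open_phase smooth_ctrl smooth_on_const)

lemma smooth_Hv: "smooth_on phase Hv"
  by (rule smooth_on_hvec[OF open_phase smooth_ham])

lemma smooth_ham_lie: "smooth_on phase g \<Longrightarrow> smooth_on phase (ham_lie g)"
  for g :: "(real^'n) \<times> (real^'n) \<Rightarrow> 'c::euclidean_space"
  unfolding ham_lie_def[abs_def] by (rule smooth_on_deriv[OF open_phase _ smooth_Hv])

lemma smooth_ham_lie_pow: "smooth_on phase g \<Longrightarrow> smooth_on phase ((ham_lie ^^ k) g)"
  for g :: "(real^'n) \<times> (real^'n) \<Rightarrow> real"
  by (induction k) (auto intro: smooth_ham_lie)

lemma ctrl_deriv: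
  assumes "y \<in> phase"
  shows "frechet_derivative (ctrl i) (at y) v =
    snd v \<bullet> X i (fst y) + snd y \<bullet> frechet_derivative (X i) (at (fst y)) (fst v)"
proof -
  have "(ctrl i has_derivative (\<lambda>v. snd y \<bullet> frechet_derivative (X i) (at (fst y)) (fst v) + snd v \<bullet> X i (fst y))) (at y)"
    unfolding ctrl_def[abs_def]
  proof (rule has_derivative_inner)
    show "((\<lambda>x. X i (fst x)) has_derivative (\<lambda>v. frechet_derivative (X i) (at (fst y)) (fst v))) (at y)"
      using assms smooth_on_has_derivative[OF smooth_X]
      by (intro has_derivative_compose[of fst fst y UNIV "X i"]) (auto intro!: derivative_eq_intros)
  qed (auto intro!: derivative_eq_intros)
  from frechet_eq[OF this] show ?thesis by simp
qed

lemma ham_deriv: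
  assumes "y \<in> phase"
  shows "frechet_derivative ham (at y) v = (\<Sum>i\<in>UNIV. ctrl i y * frechet_derivative (ctrl i) (at y) v)"
proof -
  have "(ham has_derivative (\<lambda>v. 1/2 * (\<Sum>i\<in>UNIV. of_nat 2 * frechet_derivative (ctrl i) (at y) v * ctrl i y ^ (2-1)))) (at y)"
    unfolding ham_def[abs_def]
    by (intro has_derivative_mult_right has_derivative_sum has_derivative_power
        smooth_on_has_derivative[OF smooth_ctrl] assms)
  from frechet_eq[OF this] show ?thesis by (simp add: sum_distrib_left mult.commute)
qed

lemma fst_Hv: "y \<in> phase \<Longrightarrow> fst (Hv y) = (\<Sum>i\<in>UNIV. ctrl i y *\<^sub>R X i (fst y))"
proof -
  assume y: "y \<in> phase"
  have "fst (Hv y) = (\<Sum>b\<in>Basis. (\<Sum>i\<in>UNIV. ctrl i y * (b \<bullet> X i (fst y))) *\<^sub>R b)"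
    unfolding hvec_def Let_def
    using linear_0[OF linear_frechet_derivative[OF smooth_on_differentiable[OF smooth_X]], of "fst y"] y
    by (auto simp: ham_deriv[OF y] ctrl_deriv[OF y])
  also have "\<dots> = (\<Sum>i\<in>UNIV. ctrl i y *\<^sub>R (\<Sum>b\<in>Basis. (X i (fst y) \<bullet> b) *\<^sub>R b))"
    unfolding scaleR_sum_left scaleR_sum_right by (subst sum.swap) (simp add: inner_commute)
  finally show ?thesis by (simp add: euclidean_representation)
qed

text \<open>The Taylor series at time \<open>0\<close> of \<open>g\<close> along the Hamiltonian trajectory issued from \<open>z\<close>, and its
  derivative in the direction \<open>v\<close> of the initial condition. They are defined through iterated Lie
  derivatives, so that neither analyticity nor a flow is needed.\<close>

definition taylor :: "((real^'n) \<times> (real^'n) \<Rightarrow> real) \<Rightarrow> (real^'n) \<times> (real^'n) \<Rightarrow> real fps" where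
  "taylor g z = Abs_fps (\<lambda>k. (ham_lie ^^ k) g z / fact k)"

definition taylor_d :: "(real^'n) \<times> (real^'n) \<Rightarrow> ((real^'n) \<times> (real^'n) \<Rightarrow> real) \<Rightarrow> (real^'n) \<times> (real^'n) \<Rightarrow> real fps" where
  "taylor_d v g z = Abs_fps (\<lambda>k. frechet_derivative ((ham_lie ^^ k) g) (at z) v / fact k)"

lemma taylor_0: "fps_nth (taylor g z) 0 = g z"
  and taylor_Suc: "fps_nth (taylor g z) (Suc k) = fps_nth (taylor (ham_lie g) z) k / Suc k"
  by (simp_all add: taylor_def funpow_swap1 field_simps)

lemma taylor_d_0: "fps_nth (taylor_d v g z) 0 = frechet_derivative g (at z) v"
  and taylor_d_Suc: "fps_nth (taylor_d v g z) (Suc k) = fps_nth (taylor_d v (ham_lie g) z) k / Suc k"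
  by (simp_all add: taylor_d_def funpow_swap1 field_simps)

lemma taylor_deriv: "fps_deriv (taylor g z) = taylor (ham_lie g) z"
  by (rule fps_ext) (simp add: taylor_Suc)

lemma taylor_d_deriv: "fps_deriv (taylor_d v g z) = taylor_d v (ham_lie g) z"
  by (rule fps_ext) (simp add: taylor_d_Suc)

lemma ham_lie_cong: "(\<And>y. y \<in> phase \<Longrightarrow> f y = g y) \<Longrightarrow> y \<in> phase \<Longrightarrow> ham_lie f y = ham_lie g y"
  unfolding ham_lie_def using frechet_derivative_cong_open[OF open_phase, of y f g] by simp

lemma taylor_cong: "(\<And>y. y \<in> phase \<Longrightarrow> f y = g y) \<Longrightarrow> z \<in> phase \<Longrightarrow> taylor f z = taylor g z"
proof -
  assume eq: "\<And>y. y \<in> phase \<Longrightarrow> f y = g y" and z: "z \<in> phase"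
  have "y \<in> phase \<Longrightarrow> (ham_lie ^^ k) f y = (ham_lie ^^ k) g y" for k y
    by (induction k arbitrary: y) (auto intro: eq ham_lie_cong)
  then show ?thesis using z by (simp add: taylor_def)
qed

lemma taylor_d_cong: "(\<And>y. y \<in> phase \<Longrightarrow> f y = g y) \<Longrightarrow> z \<in> phase \<Longrightarrow> taylor_d v f z = taylor_d v g z"
proof -
  assume eq: "\<And>y. y \<in> phase \<Longrightarrow> f y = g y" and z: "z \<in> phase"
  have "y \<in> phase \<Longrightarrow> (ham_lie ^^ k) f y = (ham_lie ^^ k) g y" for k y
    by (induction k arbitrary: y) (auto intro: eq ham_lie_cong)
  then have "frechet_derivative ((ham_lie ^^ k) f) (at z) = frechet_derivative ((ham_lie ^^ k) g) (at z)" for k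
    by (rule frechet_derivative_cong_open[OF open_phase z])
  then show ?thesis by (simp add: taylor_d_def)
qed

lemma taylor_const: "taylor (\<lambda>y. c) z = fps_const c"
proof (rule fps_ext)
  have 0: "ham_lie (\<lambda>y. d) = (\<lambda>y. 0)" for d :: real by (simp add: ham_lie_def fun_eq_iff)
  have "(ham_lie ^^ Suc k) (\<lambda>y. c) = (\<lambda>y. 0)" for k
    by (induction k) (simp_all add: 0)
  then show "fps_nth (taylor (\<lambda>y. c) z) k = fps_nth (fps_const c) k" for k
    by (cases k) (auto simp: taylor_def)
qed

lemma frechet_add_mult:
  fixes f g :: "(real^'n) \<times> (real^'n) \<Rightarrow> real"
  assumes "smooth_on phase f" "smooth_on phase g" "y \<in> phase"
  shows "frechet_derivative (\<lambda>y. f y + g y) (at y) v = frechet_derivative f (at y) v + frechet_derivative g (at y) v"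
    and "frechet_derivative (\<lambda>y. f y * g y) (at y) v = frechet_derivative f (at y) v * g y + f y * frechet_derivative g (at y) v"
proof -
  have "((\<lambda>y. f y + g y) has_derivative (\<lambda>v. frechet_derivative f (at y) v + frechet_derivative g (at y) v)) (at y)"
    using assms by (intro has_derivative_add smooth_on_has_derivative)
  from frechet_eq[OF this] show "frechet_derivative (\<lambda>y. f y + g y) (at y) v = frechet_derivative f (at y) v + frechet_derivative g (at y) v" by simp
  have "((\<lambda>y. f y * g y) has_derivative (\<lambda>v. f y * frechet_derivative g (at y) v + frechet_derivative f (at y) v * g y)) (at y)"
    using assms by (intro has_derivative_mult smooth_on_has_derivative)
  from frechet_eq[OF this] show "frechet_derivative (\<lambda>y. f y * g y) (at y) v = frechet_derivative f (at y) v * g y + f y * frechet_derivative g (at y) v"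
    by simp
qed

lemma taylor_add:
  assumes "smooth_on phase f" "smooth_on phase g" "z \<in> phase"
  shows "taylor (\<lambda>y. f y + g y) z = taylor f z + taylor g z"
proof -
  have "fps_nth (taylor (\<lambda>y. f y + g y) z) k = fps_nth (taylor f z + taylor g z) k"
    if "smooth_on phase f" "smooth_on phase g" for k f g
    using that
  proof (induction k arbitrary: f g)
    case (Suc k)
    have "taylor (ham_lie (\<lambda>y. f y + g y)) z = taylor (\<lambda>y. ham_lie f y + ham_lie g y) z"
      using Suc.prems by (intro taylor_cong \<open>z \<in> phase\<close>) (simp add: ham_lie_def frechet_add_mult)
    then show ?case
      using Suc.IH[OF smooth_ham_lie[OF Suc.prems(1)] smooth_ham_lie[OF Suc.prems(2)]]
      by (simp add: taylor_Suc add_divide_distrib)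
  qed (simp add: taylor_0)
  then show ?thesis using assms by (intro fps_ext)
qed

lemma taylor_mult:
  assumes "smooth_on phase f" "smooth_on phase g" "z \<in> phase"
  shows "taylor (\<lambda>y. f y * g y) z = taylor f z * taylor g z"
proof -
  have "fps_nth (taylor (\<lambda>y. f y * g y) z) k = fps_nth (taylor f z * taylor g z) k"
    if "smooth_on phase f" "smooth_on phase g" for k f g
    using that
  proof (induction k arbitrary: f g)
    case (Suc k)
    note sm = Suc.prems smooth_ham_lie[OF Suc.prems(1)] smooth_ham_lie[OF Suc.prems(2)]
    have "taylor (ham_lie (\<lambda>y. f y * g y)) z = taylor (\<lambda>y. ham_lie f y * g y + f y * ham_lie g y) z"
      using Suc.prems by (intro taylor_cong \<open>z \<in> phase\<close>) (simp add: ham_lie_def frechet_add_mult)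
    also have "\<dots> = taylor (\<lambda>y. ham_lie f y * g y) z + taylor (\<lambda>y. f y * ham_lie g y) z"
      using sm assms(3) by (intro taylor_add smooth_on_mult open_phase)
    finally have "fps_nth (taylor (ham_lie (\<lambda>y. f y * g y)) z) k = fps_nth (fps_deriv (taylor f z * taylor g z)) k"
      using Suc.IH[of "ham_lie f" g] Suc.IH[of f "ham_lie g"] sm by (simp add: taylor_deriv)
    then show ?case by (simp only: taylor_Suc fps_deriv_nth) (simp add: field_simps)
  qed (simp add: taylor_0)
  then show ?thesis using assms by (intro fps_ext)
qed

lemma taylor_sum:
  assumes "\<And>i. i \<in> I \<Longrightarrow> smooth_on phase (f i)" "z \<in> phase"
  shows "taylor (\<lambda>y. \<Sum>i\<in>I. f i y) z = (\<Sum>i\<in>I. taylor (f i) z)"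
  using assms
  by (induction I rule: infinite_finite_induct)
    (simp_all add: taylor_const taylor_add smooth_on_sum[OF open_phase])

lemma taylor_minus:
  assumes "smooth_on phase f" "z \<in> phase"
  shows "taylor (\<lambda>y. - f y) z = - taylor f z"
proof -
  have "taylor (\<lambda>y. (-1) * f y) z = fps_const (-1) * taylor f z"
    using assms by (subst taylor_mult) (auto simp: taylor_const smooth_on_const)
  then show ?thesis by (simp add: fps_const_neg[symmetric] del: fps_const_neg)
qed

lemma deriv_commute:
  fixes g :: "(real^'n) \<times> (real^'n) \<Rightarrow> real"
  assumes "smooth_on phase g" "y \<in> phase"
  shows "frechet_derivative (ham_lie g) (at y) b =
    ham_lie (\<lambda>y. frechet_derivative g (at y) b) y +
    (\<Sum>c\<in>Basis. frechet_derivative (ham_lie (\<lambda>y. y \<bullet> c)) (at y) b * frechet_derivative g (at y) c)"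
proof -
  have lin: "frechet_derivative (\<lambda>y. y \<bullet> c) (at y) = (\<lambda>v. v \<bullet> c)" for c y :: "(real^'n) \<times> (real^'n)"
    by (rule frechet_eq) (auto intro!: derivative_eq_intros)
  have Hc: "ham_lie (\<lambda>y. y \<bullet> c) y = Hv y \<bullet> c" for y and c :: "(real^'n) \<times> (real^'n)"
    by (simp add: ham_lie_def lin)
  have Hg: "ham_lie g y = (\<Sum>c\<in>Basis. ham_lie (\<lambda>y. y \<bullet> c) y * frechet_derivative g (at y) c)" if "y \<in> phase" for y
    using derivative_basis_sum[OF smooth_on_differentiable[OF assms(1) that], of "Hv y"]
    unfolding Hc by (simp add: ham_lie_def)
  have smc: "smooth_on phase (ham_lie (\<lambda>y. y \<bullet> c))" for c
    by (intro smooth_ham_lie smooth_on_linear bounded_linear_inner_left)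
  have smg: "smooth_on phase (\<lambda>y. frechet_derivative g (at y) c)" for c
    by (rule smooth_on_deriv_const[OF assms(1)])
  have "frechet_derivative (ham_lie g) (at y) b =
     frechet_derivative (\<lambda>y. \<Sum>c\<in>Basis. ham_lie (\<lambda>y. y \<bullet> c) y * frechet_derivative g (at y) c) (at y) b"
    by (rule fun_cong[OF frechet_derivative_cong_open[OF open_phase assms(2) Hg]])
  also have "\<dots> = (\<Sum>c\<in>Basis. frechet_derivative (\<lambda>y. ham_lie (\<lambda>y. y \<bullet> c) y * frechet_derivative g (at y) c) (at y) b)"
  proof -
    have "((\<lambda>y. \<Sum>c\<in>Basis. ham_lie (\<lambda>y. y \<bullet> c) y * frechet_derivative g (at y) c) has_derivative
      (\<lambda>b. \<Sum>c\<in>Basis. frechet_derivative (\<lambda>y. ham_lie (\<lambda>y. y \<bullet> c) y * frechet_derivative g (at y) c) (at y) b)) (at y)"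
      by (intro has_derivative_sum smooth_on_has_derivative[OF smooth_on_mult[OF open_phase smc smg] assms(2)])
    from frechet_eq[OF this] show ?thesis by simp
  qed
  also have "\<dots> = (\<Sum>c\<in>Basis. frechet_derivative (ham_lie (\<lambda>y. y \<bullet> c)) (at y) b * frechet_derivative g (at y) c
      + ham_lie (\<lambda>y. y \<bullet> c) y * frechet_derivative (\<lambda>y. frechet_derivative g (at y) b) (at y) c)"
    by (intro sum.cong refl) (simp only: frechet_add_mult(2)[OF smc smg assms(2)] mixed_derivatives_real[OF open_phase assms, of _ b])
  finally have A: "frechet_derivative (ham_lie g) (at y) b = \<dots>" .
  have B: "(\<Sum>c\<in>Basis. ham_lie (\<lambda>y. y \<bullet> c) y * frechet_derivative (\<lambda>y. frechet_derivative g (at y) b) (at y) c)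
      = ham_lie (\<lambda>y. frechet_derivative g (at y) b) y"
    using derivative_basis_sum[OF smooth_on_differentiable[OF smg[of b] assms(2)], of "Hv y"]
    unfolding Hc by (simp add: ham_lie_def)
  show ?thesis unfolding A sum.distrib B by simp
qed

lemma taylor_d_chain_Basis:
  assumes "smooth_on phase g" "z \<in> phase"
  shows "taylor_d v g z = (\<Sum>b\<in>Basis. taylor (\<lambda>y. frechet_derivative g (at y) b) z * taylor_d v (\<lambda>y. y \<bullet> b) z)"
proof -
  have lin: "frechet_derivative (\<lambda>y. y \<bullet> c) (at y) = (\<lambda>v. v \<bullet> c)" for c y :: "(real^'n) \<times> (real^'n)"
    by (rule frechet_eq) (auto intro!: derivative_eq_intros)
  have smb: "smooth_on phase (ham_lie (\<lambda>y. y \<bullet> c))" for c :: "(real^'n) \<times> (real^'n)"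
    by (intro smooth_ham_lie smooth_on_linear bounded_linear_inner_left)
  define R where "R g = (\<Sum>b\<in>Basis. taylor (\<lambda>y. frechet_derivative g (at y) b) z * taylor_d v (\<lambda>y. y \<bullet> b) z)" for g
  have "\<forall>g. smooth_on phase g \<longrightarrow> (\<forall>i\<le>k. fps_nth (taylor_d v g z) i = fps_nth (R g) i)" for k
  proof (induction k)
    case 0
    have "fps_nth (taylor_d v g z) 0 = fps_nth (R g) 0" if "smooth_on phase g" for g
      using derivative_basis_sum[OF smooth_on_differentiable[OF that \<open>z \<in> phase\<close>], of v]
      by (simp add: R_def fps_sum_nth taylor_0 taylor_d_0 lin mult.commute)
    then show ?case by simp
  next
    case (Suc k)
    have "fps_nth (taylor_d v g z) (Suc k) = fps_nth (R g) (Suc k)" if g: "smooth_on phase g" for g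
    proof -
      let ?D = "\<lambda>b y. frechet_derivative g (at y) b"
      have smg: "smooth_on phase (?D c)" for c
        by (rule smooth_on_deriv_const[OF g])
      have "fps_deriv (R g) = (\<Sum>b\<in>Basis. taylor (ham_lie (?D b)) z * taylor_d v (\<lambda>y. y \<bullet> b) z) +
          (\<Sum>b\<in>Basis. taylor (?D b) z * taylor_d v (ham_lie (\<lambda>y. y \<bullet> b)) z)"
        by (simp add: R_def fps_deriv_sum taylor_deriv taylor_d_deriv sum.distrib add.commute)
      moreover have "fps_nth (\<Sum>c\<in>Basis. taylor (?D c) z * taylor_d v (ham_lie (\<lambda>y. y \<bullet> c)) z) k =
          fps_nth (\<Sum>c\<in>Basis. taylor (?D c) z * R (ham_lie (\<lambda>y. y \<bullet> c))) k"
        unfolding fps_sum_nth fps_mult_nth using Suc.IH smb by (intro sum.cong) auto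
      moreover have "R (ham_lie g) = (\<Sum>b\<in>Basis. taylor (ham_lie (?D b)) z * taylor_d v (\<lambda>y. y \<bullet> b) z) +
          (\<Sum>c\<in>Basis. taylor (?D c) z * R (ham_lie (\<lambda>y. y \<bullet> c)))"
      proof -
        have "taylor (\<lambda>y. frechet_derivative (ham_lie g) (at y) b) z = taylor (ham_lie (?D b)) z +
          (\<Sum>c\<in>Basis. taylor (\<lambda>y. frechet_derivative (ham_lie (\<lambda>y. y \<bullet> c)) (at y) b) z * taylor (?D c) z)" for b
        proof -
          have "taylor (\<lambda>y. frechet_derivative (ham_lie g) (at y) b) z = taylor (\<lambda>y. ham_lie (?D b) y +
            (\<Sum>c\<in>Basis. frechet_derivative (ham_lie (\<lambda>y. y \<bullet> c)) (at y) b * ?D c y)) z"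
            by (rule taylor_cong) (simp_all add: deriv_commute[OF g] assms(2))
          then show ?thesis
            using smooth_on_deriv_const[OF smb] smg assms(2) smooth_ham_lie[OF smg]
            by (simp add: taylor_add taylor_sum taylor_mult smooth_on_sum smooth_on_mult open_phase)
        qed
        then have "R (ham_lie g) = (\<Sum>b\<in>Basis. taylor (ham_lie (?D b)) z * taylor_d v (\<lambda>y. y \<bullet> b) z) +
          (\<Sum>b\<in>Basis. \<Sum>c\<in>Basis. taylor (\<lambda>y. frechet_derivative (ham_lie (\<lambda>y. y \<bullet> c)) (at y) b) z * taylor (?D c) z * taylor_d v (\<lambda>y. y \<bullet> b) z)"
          by (simp add: R_def distrib_right sum.distrib sum_distrib_right)
        moreover have "(\<Sum>b\<in>Basis. \<Sum>c\<in>Basis. taylor (\<lambda>y. frechet_derivative (ham_lie (\<lambda>y. y \<bullet> c)) (at y) b) z * taylor (?D c) z * taylor_d v (\<lambda>y. y \<bullet> b) z)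
          = (\<Sum>c\<in>Basis. taylor (?D c) z * R (ham_lie (\<lambda>y. y \<bullet> c)))"
          unfolding R_def sum_distrib_left by (subst sum.swap) (simp add: mult_ac)
        ultimately show ?thesis by simp
      qed
      ultimately have "fps_nth (fps_deriv (R g)) k = fps_nth (R (ham_lie g)) k" by simp
      also have "\<dots> = fps_nth (taylor_d v (ham_lie g) z) k" using Suc.IH smooth_ham_lie[OF g] by simp
      finally show ?thesis by (simp add: taylor_d_Suc field_simps del: of_nat_Suc)
    qed
    then show ?case using Suc.IH by (metis le_Suc_eq)
  qed
  then have "taylor_d v g z = R g" using assms(1) by (intro fps_ext) blast
  then show ?thesis by (simp add: R_def)
qed

abbreviation "X\<^sub>c a \<equiv> (\<lambda>y :: (real^'n) \<times> (real^'n). fst y $ a)"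
abbreviation "P\<^sub>c a \<equiv> (\<lambda>y :: (real^'n) \<times> (real^'n). snd y $ a)"
abbreviation "ex b \<equiv> (axis b 1 :: real^'n, 0 :: real^'n)"
abbreviation "ep b \<equiv> (0 :: real^'n, axis b 1 :: real^'n)"

lemma taylor_d_chain:
  assumes "smooth_on phase g" "z \<in> phase"
  shows "taylor_d v g z = (\<Sum>b\<in>UNIV. taylor (\<lambda>y. frechet_derivative g (at y) (ex b)) z * taylor_d v (X\<^sub>c b) z)
     + (\<Sum>b\<in>UNIV. taylor (\<lambda>y. frechet_derivative g (at y) (ep b)) z * taylor_d v (P\<^sub>c b) z)"
proof -
  have "(\<lambda>y. y \<bullet> ex b) = X\<^sub>c b" "(\<lambda>y. y \<bullet> ep b) = P\<^sub>c b" for b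
    by (auto simp: fun_eq_iff inner_axis)
  then show ?thesis
    by (simp add: taylor_d_chain_Basis[OF assms] sum_Basis_prod sum_Basis_axis)
qed

lemma taylor_d_mult:
  assumes "smooth_on phase f" "smooth_on phase g" "z \<in> phase"
  shows "taylor_d v (\<lambda>y. f y * g y) z = taylor_d v f z * taylor g z + taylor f z * taylor_d v g z"
proof -
  have "taylor (\<lambda>y. frechet_derivative (\<lambda>y. f y * g y) (at y) b) z =
     taylor (\<lambda>y. frechet_derivative f (at y) b) z * taylor g z + taylor f z * taylor (\<lambda>y. frechet_derivative g (at y) b) z" for b
  proof -
    have "taylor (\<lambda>y. frechet_derivative (\<lambda>y. f y * g y) (at y) b) z =
       taylor (\<lambda>y. frechet_derivative f (at y) b * g y + f y * frechet_derivative g (at y) b) z"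
      by (rule taylor_cong) (simp_all add: frechet_add_mult(2)[OF assms(1,2)] assms(3))
    then show ?thesis using smooth_on_deriv_const[OF assms(1)] smooth_on_deriv_const[OF assms(2)] assms
      by (simp add: taylor_add taylor_mult smooth_on_mult open_phase)
  qed
  then show ?thesis
    unfolding taylor_d_chain_Basis[OF assms(1,3)] taylor_d_chain_Basis[OF assms(2,3)]
      taylor_d_chain_Basis[OF smooth_on_mult[OF open_phase assms(1,2)] assms(3)]
    by (simp add: distrib_left distrib_right sum.distrib sum_distrib_left sum_distrib_right mult_ac)
qed

lemma taylor_d_const: "taylor_d v (\<lambda>y. c) z = 0"
proof (rule fps_ext)
  have 0: "ham_lie (\<lambda>y. d) = (\<lambda>y. 0)" for d :: real by (simp add: ham_lie_def fun_eq_iff)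
  have "(ham_lie ^^ k) (\<lambda>y. c) = (\<lambda>y. if k = 0 then c else 0)" for k
    by (induction k) (simp_all add: 0)
  then show "fps_nth (taylor_d v (\<lambda>y. c) z) k = fps_nth 0 k" for k
    by (simp add: taylor_d_def)
qed

lemma taylor_d_add:
  assumes "smooth_on phase f" "smooth_on phase g" "z \<in> phase"
  shows "taylor_d v (\<lambda>y. f y + g y) z = taylor_d v f z + taylor_d v g z"
proof -
  have "taylor (\<lambda>y. frechet_derivative (\<lambda>y. f y + g y) (at y) b) z =
     taylor (\<lambda>y. frechet_derivative f (at y) b) z + taylor (\<lambda>y. frechet_derivative g (at y) b) z" for b
  proof -
    have "taylor (\<lambda>y. frechet_derivative (\<lambda>y. f y + g y) (at y) b) z =
       taylor (\<lambda>y. frechet_derivative f (at y) b + frechet_derivative g (at y) b) z"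
      by (rule taylor_cong) (simp_all add: frechet_add_mult(1)[OF assms(1,2)] assms(3))
    then show ?thesis using smooth_on_deriv_const[OF assms(1)] smooth_on_deriv_const[OF assms(2)] assms
      by (simp add: taylor_add)
  qed
  then show ?thesis
    unfolding taylor_d_chain_Basis[OF assms(1,3)] taylor_d_chain_Basis[OF assms(2,3)]
      taylor_d_chain_Basis[OF smooth_on_add[OF open_phase assms(1,2)] assms(3)]
    by (simp add: distrib_right sum.distrib)
qed

lemma taylor_d_sum:
  assumes "\<And>i. i \<in> I \<Longrightarrow> smooth_on phase (f i)" "z \<in> phase"
  shows "taylor_d v (\<lambda>y. \<Sum>i\<in>I. f i y) z = (\<Sum>i\<in>I. taylor_d v (f i) z)"
  using assms
  by (induction I rule: infinite_finite_induct)
    (simp_all add: taylor_d_const taylor_d_add smooth_on_sum[OF open_phase])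

lemma taylor_d_minus:
  assumes "smooth_on phase f" "z \<in> phase"
  shows "taylor_d v (\<lambda>y. - f y) z = - taylor_d v f z"
proof -
  have "taylor_d v (\<lambda>y. (-1) * f y) z = fps_const (-1) * taylor_d v f z"
    using assms by (subst taylor_d_mult) (auto simp: taylor_const taylor_d_const smooth_on_const)
  then show ?thesis by (simp add: fps_const_neg[symmetric] del: fps_const_neg)
qed

lemma frechet_coords:
  "frechet_derivative (X\<^sub>c a) (at y) = (\<lambda>v. fst v $ a)"
  "frechet_derivative (P\<^sub>c a) (at y) = (\<lambda>v. snd v $ a)"
  by (rule frechet_eq, auto intro!: derivative_eq_intros bounded_linear.has_derivative[OF bounded_linear_vec_nth])+

lemma ham_lie_coords:
  "ham_lie (X\<^sub>c a) y = frechet_derivative ham (at y) (ep a)"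
  "ham_lie (P\<^sub>c a) y = - frechet_derivative ham (at y) (ex a)"
  unfolding ham_lie_def frechet_coords hvec_def Let_def
  by (simp_all add: sum_Basis_axis axis_def if_distrib cong: if_cong)

lemma symplectic_cancel:
  fixes A B C :: "'n \<Rightarrow> 'n \<Rightarrow> 'c::comm_ring_1"
  assumes B: "\<And>a b. B a b = B b a" and C: "\<And>a b. C a b = C b a"
  shows "(\<Sum>a\<in>UNIV. ((\<Sum>b\<in>UNIV. A a b * ux b) + (\<Sum>b\<in>UNIV. B a b * up b)) * vp a
     + ux a * - ((\<Sum>b\<in>UNIV. C a b * vx b) + (\<Sum>b\<in>UNIV. A b a * vp b))
     - (- ((\<Sum>b\<in>UNIV. C a b * ux b) + (\<Sum>b\<in>UNIV. A b a * up b)) * vx a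
     + up a * ((\<Sum>b\<in>UNIV. A a b * vx b) + (\<Sum>b\<in>UNIV. B a b * vp b)))) = 0"
proof -
  have s1: "(\<Sum>a\<in>UNIV. \<Sum>b\<in>UNIV. A a b * ux b * vp a) = (\<Sum>a\<in>UNIV. \<Sum>b\<in>UNIV. ux a * (A b a * vp b))"
    by (subst sum.swap) (simp add: mult_ac)
  have s2: "(\<Sum>a\<in>UNIV. \<Sum>b\<in>UNIV. B a b * up b * vp a) = (\<Sum>a\<in>UNIV. \<Sum>b\<in>UNIV. up a * (B a b * vp b))"
    by (subst sum.swap, subst B) (simp add: mult_ac)
  have s3: "(\<Sum>a\<in>UNIV. \<Sum>b\<in>UNIV. C a b * ux b * vx a) = (\<Sum>a\<in>UNIV. \<Sum>b\<in>UNIV. ux a * (C a b * vx b))"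
    by (subst sum.swap, subst C) (simp add: mult_ac)
  have s4: "(\<Sum>a\<in>UNIV. \<Sum>b\<in>UNIV. A b a * up b * vx a) = (\<Sum>a\<in>UNIV. \<Sum>b\<in>UNIV. up a * (A a b * vx b))"
    by (subst sum.swap) (simp add: mult_ac)
  show ?thesis
    by (simp add: distrib_left distrib_right left_diff_distrib right_diff_distrib sum.distrib sum_subtractf sum_negf sum_distrib_left sum_distrib_right)
      (simp add: s1 s2 s3 s4)
qed

text \<open>The vertical fibre is Lagrangian, and the Hamiltonian flow preserves the symplectic form.\<close>

lemma Lagrangian:
  assumes z: "z \<in> phase" and u: "fst u = 0" and v: "fst v = 0"
  shows "(\<Sum>a\<in>UNIV. taylor_d u (X\<^sub>c a) z * taylor_d v (P\<^sub>c a) z) = (\<Sum>a\<in>UNIV. taylor_d u (P\<^sub>c a) z * taylor_d v (X\<^sub>c a) z)"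
proof -
  let ?D = "\<lambda>e y. frechet_derivative ham (at y) e"
  define A where "A a b = taylor (\<lambda>y. frechet_derivative (?D (ep a)) (at y) (ex b)) z" for a b
  define B where "B a b = taylor (\<lambda>y. frechet_derivative (?D (ep a)) (at y) (ep b)) z" for a b
  define C where "C a b = taylor (\<lambda>y. frechet_derivative (?D (ex a)) (at y) (ex b)) z" for a b
  have mixed: "taylor (\<lambda>y. frechet_derivative (?D e) (at y) e') z = taylor (\<lambda>y. frechet_derivative (?D e') (at y) e) z" for e e'
    by (rule taylor_cong[OF mixed_derivatives_real[OF open_phase smooth_ham] z])
  have smD: "smooth_on phase (?D e)" for e by (rule smooth_on_deriv_const[OF smooth_ham])
  have dx: "fps_deriv (taylor_d u (X\<^sub>c a) z) = (\<Sum>b\<in>UNIV. A a b * taylor_d u (X\<^sub>c b) z) + (\<Sum>b\<in>UNIV. B a b * taylor_d u (P\<^sub>c b) z)" for u a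
    unfolding taylor_d_deriv ham_lie_coords[abs_def] taylor_d_chain[OF smD z] A_def B_def ..
  have dp: "fps_deriv (taylor_d u (P\<^sub>c a) z) = - ((\<Sum>b\<in>UNIV. C a b * taylor_d u (X\<^sub>c b) z) + (\<Sum>b\<in>UNIV. A b a * taylor_d u (P\<^sub>c b) z))" for u a
    unfolding taylor_d_deriv ham_lie_coords[abs_def] taylor_d_minus[OF smD z] taylor_d_chain[OF smD z] A_def C_def mixed[of "ex a" "ep _"] ..
  have sym: "B a b = B b a" "C a b = C b a" for a b
    unfolding B_def C_def by (rule mixed)+
  define W where "W = (\<Sum>a\<in>UNIV. taylor_d u (X\<^sub>c a) z * taylor_d v (P\<^sub>c a) z - taylor_d u (P\<^sub>c a) z * taylor_d v (X\<^sub>c a) z)"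
  have "fps_deriv W = 0"
    using symplectic_cancel[OF sym, where A = A and ux = "\<lambda>b. taylor_d u (X\<^sub>c b) z" and up = "\<lambda>b. taylor_d u (P\<^sub>c b) z"
        and vp = "\<lambda>b. taylor_d v (P\<^sub>c b) z" and vx = "\<lambda>b. taylor_d v (X\<^sub>c b) z"]
    unfolding W_def fps_deriv_sum fps_deriv_sub fps_deriv_mult dx dp by (simp add: add.commute)
  moreover have "fps_nth W 0 = 0"
    using u v by (simp add: W_def fps_sum_nth taylor_d_0 frechet_coords)
  ultimately have "W = 0" by (simp add: fps_deriv_eq_0_iff)
  then show ?thesis by (simp add: W_def sum_subtractf)
qed

abbreviation "XT i a z \<equiv> taylor (\<lambda>y. X i (fst y) $ a) z"
abbreviation "XD i a b z \<equiv> taylor (\<lambda>y. frechet_derivative (X i) (at (fst y)) (axis b 1) $ a) z"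

lemma frechet_base:
  assumes "smooth_on S Y" "y \<in> phase"
  shows "frechet_derivative (\<lambda>y. Y (fst y) $ a) (at y) v = frechet_derivative Y (at (fst y)) (fst v) $ a"
proof -
  have "((\<lambda>y. Y (fst y)) has_derivative (\<lambda>v. frechet_derivative Y (at (fst y)) (fst v))) (at y)"
    using assms smooth_on_has_derivative[OF assms(1)]
    by (intro has_derivative_compose[of fst fst y UNIV Y]) (auto intro!: derivative_eq_intros)
  from frechet_eq[OF bounded_linear.has_derivative[OF bounded_linear_vec_nth this]]
  show ?thesis by simp
qed

lemma taylor_d_base:
  fixes Y :: "real^'n \<Rightarrow> real^'n"
  assumes "smooth_on S Y" "z \<in> phase"
  shows "taylor_d v (\<lambda>y. Y (fst y) $ a) z =
    (\<Sum>b\<in>UNIV. taylor (\<lambda>y. frechet_derivative Y (at (fst y)) (axis b 1) $ a) z * taylor_d v (X\<^sub>c b) z)"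
proof -
  have sm: "smooth_on phase (\<lambda>y. Y (fst y) $ a)"
    by (intro smooth_nth[OF open_phase] smooth_fst assms)
  have "frechet_derivative Y (at q) 0 = 0" if "q \<in> S" for q
    using linear_0[OF linear_frechet_derivative[OF smooth_on_differentiable[OF assms(1) that]]] .
  then have "taylor (\<lambda>y. frechet_derivative (\<lambda>y. Y (fst y) $ a) (at y) (ep b)) z = taylor (\<lambda>y. 0) z" for b
    by (intro taylor_cong[OF _ assms(2)]) (auto simp: frechet_base[OF assms(1)])
  moreover have "taylor (\<lambda>y. frechet_derivative (\<lambda>y. Y (fst y) $ a) (at y) (ex b)) z =
      taylor (\<lambda>y. frechet_derivative Y (at (fst y)) (axis b 1) $ a) z" for b
    by (intro taylor_cong[OF _ assms(2)]) (auto simp: frechet_base[OF assms(1)])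
  ultimately show ?thesis by (simp add: taylor_d_chain[OF sm assms(2)] taylor_const)
qed

lemma smooth_X_nth: "smooth_on phase (\<lambda>y. X i (fst y) $ a)"
  by (intro smooth_nth[OF open_phase] smooth_fst smooth_X)

lemma ham_lie_X\<^sub>c: "y \<in> phase \<Longrightarrow> ham_lie (X\<^sub>c a) y = (\<Sum>i\<in>UNIV. ctrl i y * X i (fst y) $ a)"
  unfolding ham_lie_def frechet_coords by (simp add: fst_Hv)

lemma taylor_d_X\<^sub>c_deriv:
  assumes "z \<in> phase"
  shows "fps_deriv (taylor_d v (X\<^sub>c a) z) =
    (\<Sum>b\<in>UNIV. (\<Sum>i\<in>UNIV. taylor (ctrl i) z * XD i a b z) * taylor_d v (X\<^sub>c b) z) +
    (\<Sum>i\<in>UNIV. taylor_d v (ctrl i) z * XT i a z)"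
proof -
  have "fps_deriv (taylor_d v (X\<^sub>c a) z) = taylor_d v (\<lambda>y. \<Sum>i\<in>UNIV. ctrl i y * X i (fst y) $ a) z"
    unfolding taylor_d_deriv by (rule taylor_d_cong[OF ham_lie_X\<^sub>c assms])
  also have "\<dots> = (\<Sum>i\<in>UNIV. taylor_d v (ctrl i) z * XT i a z + taylor (ctrl i) z * (\<Sum>b\<in>UNIV. XD i a b z * taylor_d v (X\<^sub>c b) z))"
    by (subst taylor_d_sum[OF smooth_on_mult[OF open_phase smooth_ctrl smooth_X_nth] assms])
      (simp only: taylor_d_mult[OF smooth_ctrl smooth_X_nth assms] taylor_d_base[OF smooth_X assms])
  also have "\<dots> = (\<Sum>i\<in>UNIV. taylor_d v (ctrl i) z * XT i a z) + (\<Sum>i\<in>UNIV. taylor (ctrl i) z * (\<Sum>b\<in>UNIV. XD i a b z * taylor_d v (X\<^sub>c b) z))"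
    by (rule sum.distrib)
  also have "(\<Sum>i\<in>UNIV. taylor (ctrl i) z * (\<Sum>b\<in>UNIV. XD i a b z * taylor_d v (X\<^sub>c b) z)) =
     (\<Sum>b\<in>UNIV. (\<Sum>i\<in>UNIV. taylor (ctrl i) z * XD i a b z) * taylor_d v (X\<^sub>c b) z)"
    unfolding sum_distrib_left sum_distrib_right by (subst sum.swap) (simp add: mult.assoc)
  finally show ?thesis by (simp only: add.commute)
qed

end

section \<open>Existence of a spanning covector\<close>

definition field_bracket :: "('e::real_normed_vector \<Rightarrow> 'e) \<Rightarrow> ('e \<Rightarrow> 'e) \<Rightarrow> 'e \<Rightarrow> 'e" where
  "field_bracket Y Z q = frechet_derivative Z (at q) (Y q) - frechet_derivative Y (at q) (Z q)"

inductive_set bracket_fields :: "('r \<Rightarrow> 'e::real_normed_vector \<Rightarrow> 'e) \<Rightarrow> ('e \<Rightarrow> 'e) set" for X where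
  "X i \<in> bracket_fields X"
| "Y \<in> bracket_fields X \<Longrightarrow> Z \<in> bracket_fields X \<Longrightarrow> field_bracket Y Z \<in> bracket_fields X"

definition fps_family_deriv :: "(real \<Rightarrow> real fps) \<Rightarrow> real fps \<Rightarrow> bool" where
  "fps_family_deriv \<phi> d \<longleftrightarrow>
     (\<forall>k. ((\<lambda>s. fps_nth (\<phi> s) k) has_real_derivative fps_nth d k) (at 0))"

lemma fps_family_deriv_unique: "fps_family_deriv \<phi> d \<Longrightarrow> fps_family_deriv \<phi> d' \<Longrightarrow> d = d'"
  unfolding fps_family_deriv_def by (rule fps_ext, rule DERIV_unique) blast+

lemma fps_family_deriv_const: "fps_family_deriv (\<lambda>s. c) 0"
  by (simp add: fps_family_deriv_def)

lemma fps_family_deriv_add: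
  "fps_family_deriv \<phi> d \<Longrightarrow> fps_family_deriv \<psi> e \<Longrightarrow> fps_family_deriv (\<lambda>s. \<phi> s + \<psi> s) (d + e)"
  by (auto simp: fps_family_deriv_def intro: DERIV_add)

lemma fps_family_deriv_sum:
  "(\<And>i. i \<in> I \<Longrightarrow> fps_family_deriv (\<phi> i) (d i)) \<Longrightarrow>
   fps_family_deriv (\<lambda>s. \<Sum>i\<in>I. \<phi> i s) (\<Sum>i\<in>I. d i)"
  by (induction I rule: infinite_finite_induct)
    (simp_all add: fps_family_deriv_const fps_family_deriv_add)

lemma fps_family_deriv_mult:
  assumes "fps_family_deriv \<phi> d" "fps_family_deriv \<psi> e"
  shows "fps_family_deriv (\<lambda>s. \<phi> s * \<psi> s) (d * \<psi> 0 + \<phi> 0 * e)"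
  unfolding fps_family_deriv_def
proof
  fix k
  have "((\<lambda>s. \<Sum>i=0..k. fps_nth (\<phi> s) i * fps_nth (\<psi> s) (k - i)) has_real_derivative
     (\<Sum>i=0..k. fps_nth d i * fps_nth (\<psi> 0) (k - i) + fps_nth e (k - i) * fps_nth (\<phi> 0) i)) (at 0)"
    using assms by (intro DERIV_sum DERIV_mult) (auto simp: fps_family_deriv_def)
  then show "((\<lambda>s. fps_nth (\<phi> s * \<psi> s) k) has_real_derivative fps_nth (d * \<psi> 0 + \<phi> 0 * e) k) (at 0)"
    by (simp add: fps_mult_nth sum.distrib mult.commute[of "fps_nth e _"])
qed

lemma fps_family_deriv_prod:
  assumes "\<And>i. i \<in> I \<Longrightarrow> \<exists>d. fps_family_deriv (\<phi> i) d"
  shows "\<exists>d. fps_family_deriv (\<lambda>s. \<Prod>i\<in>I. \<phi> i s) d"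
  using assms
proof (induction I rule: infinite_finite_induct)
  case (insert i I)
  obtain d where d: "fps_family_deriv (\<phi> i) d" using insert.prems by blast
  obtain e where e: "fps_family_deriv (\<lambda>s. \<Prod>i\<in>I. \<phi> i s) e" using insert by blast
  show ?case unfolding prod.insert[OF insert.hyps] by (rule exI fps_family_deriv_mult d e)+
qed (auto intro: fps_family_deriv_const)

lemma fps_family_deriv_det:
  fixes A :: "real \<Rightarrow> real fps^'n::finite^'n"
  assumes "\<And>i j. \<exists>d. fps_family_deriv (\<lambda>s. A s $ i $ j) d"
  shows "\<exists>d. fps_family_deriv (\<lambda>s. det (A s)) d"
proof -
  have "\<exists>d. fps_family_deriv (\<lambda>s. \<Prod>i\<in>UNIV. A s $ i $ p i) d" for p
    by (rule fps_family_deriv_prod) (rule assms)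
  then obtain d where d: "\<And>p. fps_family_deriv (\<lambda>s. \<Prod>i\<in>UNIV. A s $ i $ p i) (d p)"
    using choice[of "\<lambda>p d. fps_family_deriv (\<lambda>s. \<Prod>i\<in>UNIV. A s $ i $ p i) d"] by blast
  have "fps_family_deriv (\<lambda>s. \<Sum>p\<in>{p. p permutes (UNIV::'n set)}. of_int (sign p) * (\<Prod>i\<in>UNIV. A s $ i $ p i))
     (\<Sum>p\<in>{p. p permutes (UNIV::'n set)}. 0 * (\<Prod>i\<in>UNIV. A 0 $ i $ p i) + of_int (sign p) * d p)"
    by (intro fps_family_deriv_sum fps_family_deriv_mult fps_family_deriv_const d)
  then show ?thesis unfolding det_def by (rule exI)
qed

context sr_frame
begin

lemma taylor_d_ctrl:
  assumes "z \<in> phase"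
  shows "taylor_d v (ctrl i) z = (\<Sum>b\<in>UNIV. taylor (\<lambda>y. frechet_derivative (ctrl i) (at y) (ex b)) z * taylor_d v (X\<^sub>c b) z)
     + (\<Sum>b\<in>UNIV. XT i b z * taylor_d v (P\<^sub>c b) z)"
proof -
  have "taylor (\<lambda>y. frechet_derivative (ctrl i) (at y) (ep b)) z = XT i b z" for b
  proof (rule taylor_cong[OF _ assms])
    fix y assume y: "y \<in> phase"
    then have "frechet_derivative (X i) (at (fst y)) 0 = 0"
      using linear_0[OF linear_frechet_derivative[OF smooth_on_differentiable[OF smooth_X]]] by auto
    then show "frechet_derivative (ctrl i) (at y) (ep b) = X i (fst y) $ b"
      by (simp add: ctrl_deriv[OF y] inner_axis')
  qed
  then show ?thesis by (simp add: taylor_d_chain[OF smooth_ctrl assms])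
qed

text \<open>Step (2) of the proof: \<open>\<zeta>\<close> below satisfies \<open>E \<zeta> = det E * w\<close> and, by the Lagrangian property,
  \<open>D \<zeta> = 0\<close>; pairing the time derivative of \<open>w D = 0\<close> with \<open>\<zeta>\<close> leaves a sum of squares.\<close>

lemma left_kernel_annihilates:
  assumes z: "z \<in> phase" and w: "\<And>j. (\<Sum>a\<in>UNIV. w a * taylor_d (ep j) (X\<^sub>c a) z) = 0"
  shows "(\<Sum>a\<in>UNIV. w a * XT i a z) = 0"
proof -
  define D where "D a j = taylor_d (ep j) (X\<^sub>c a) z" for a j
  define E where "E = (\<chi> a j. taylor_d (ep j) (P\<^sub>c a) z)"
  define A where "A a b = (\<Sum>i\<in>UNIV. taylor (ctrl i) z * XD i a b z)" for a b
  define U where "U i j = taylor_d (ep j) (ctrl i) z" for i j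
  define f where "f i = (\<Sum>a\<in>UNIV. w a * XT i a z)" for i
  have "fps_nth (E $ a $ j) 0 = (if a = j then 1 else 0)" for a j
    by (simp add: E_def taylor_d_0 frechet_coords axis_def)
  then have E0: "fps_nth (det E) 0 = 1"
  proof -
    assume E0: "\<And>a j. fps_nth (E $ a $ j) 0 = (if a = j then 1 else 0)"
    have prod0: "fps_nth (\<Prod>i\<in>I. F i) 0 = (\<Prod>i\<in>I. fps_nth (F i) 0)" for I :: "'n set" and F :: "'n \<Rightarrow> real fps"
      by (induction I rule: infinite_finite_induct) auto
    have "fps_nth (det E) 0 = det (\<chi> a j. fps_nth (E $ a $ j) 0)"
      by (simp add: det_def fps_sum_nth prod0 flip: fps_of_int)
    also have "(\<chi> a j. fps_nth (E $ a $ j) 0) = mat 1" by (simp add: E0 mat_def vec_eq_iff)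
    finally show ?thesis by simp
  qed
  then have detE: "det E \<noteq> 0" by auto
  obtain \<zeta> where \<zeta>: "\<And>a. (\<Sum>j\<in>UNIV. E $ a $ j * \<zeta> j) = det E * w a"
    using solve_up_to_det[of E w] by blast
  have lag: "(\<Sum>a\<in>UNIV. D a j * E $ a $ k) = (\<Sum>a\<in>UNIV. E $ a $ j * D a k)" for j k
    unfolding D_def E_def by (simp add: Lagrangian[OF z])
  have D\<zeta>: "(\<Sum>j\<in>UNIV. D a j * \<zeta> j) = 0" for a
  proof (rule left_kernel_zero[OF detE])
    fix k
    have "(\<Sum>a\<in>UNIV. (\<Sum>j\<in>UNIV. D a j * \<zeta> j) * E $ a $ k) = (\<Sum>j\<in>UNIV. (\<Sum>a\<in>UNIV. D a j * E $ a $ k) * \<zeta> j)"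
      unfolding sum_distrib_right by (subst sum.swap) (simp add: mult_ac)
    also have "\<dots> = (\<Sum>a\<in>UNIV. D a k * (\<Sum>j\<in>UNIV. E $ a $ j * \<zeta> j))"
      unfolding lag sum_distrib_left sum_distrib_right by (subst sum.swap) (simp add: mult_ac)
    also have "\<dots> = det E * (\<Sum>a\<in>UNIV. w a * D a k)"
      unfolding \<zeta> by (simp add: sum_distrib_left mult_ac)
    finally show "(\<Sum>a\<in>UNIV. (\<Sum>j\<in>UNIV. D a j * \<zeta> j) * E $ a $ k) = 0"
      using w by (simp add: D_def)
  qed
  have U\<zeta>: "(\<Sum>j\<in>UNIV. U i j * \<zeta> j) = det E * f i" for i
  proof -
    have "(\<Sum>j\<in>UNIV. U i j * \<zeta> j) =
       (\<Sum>b\<in>UNIV. taylor (\<lambda>y. frechet_derivative (ctrl i) (at y) (ex b)) z * (\<Sum>j\<in>UNIV. D b j * \<zeta> j))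
       + (\<Sum>b\<in>UNIV. XT i b z * (\<Sum>j\<in>UNIV. E $ b $ j * \<zeta> j))"
      unfolding U_def taylor_d_ctrl[OF z] distrib_right sum.distrib sum_distrib_left sum_distrib_right D_def E_def
      by (subst sum.swap, subst (3) sum.swap) (simp add: mult_ac)
    also have "\<dots> = det E * f i"
      unfolding D\<zeta> \<zeta> by (simp add: f_def sum_distrib_left mult_ac)
    finally show ?thesis .
  qed
  have D': "fps_deriv (D a j) = (\<Sum>b\<in>UNIV. A a b * D b j) + (\<Sum>i\<in>UNIV. U i j * XT i a z)" for a j
    unfolding D_def A_def U_def by (rule taylor_d_X\<^sub>c_deriv[OF z])
  have "(\<Sum>i\<in>UNIV. f i * U i j) = - (\<Sum>b\<in>UNIV. (fps_deriv (w b) + (\<Sum>a\<in>UNIV. w a * A a b)) * D b j)" for j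
  proof -
    have "0 = fps_deriv (\<Sum>a\<in>UNIV. w a * D a j)" using w by (simp add: D_def)
    also have "\<dots> = (\<Sum>a\<in>UNIV. fps_deriv (w a) * D a j) + (\<Sum>a\<in>UNIV. w a * (\<Sum>b\<in>UNIV. A a b * D b j))
        + (\<Sum>a\<in>UNIV. w a * (\<Sum>i\<in>UNIV. U i j * XT i a z))"
      by (simp add: fps_deriv_sum D' distrib_left sum.distrib)
    also have "(\<Sum>a\<in>UNIV. w a * (\<Sum>b\<in>UNIV. A a b * D b j)) = (\<Sum>b\<in>UNIV. (\<Sum>a\<in>UNIV. w a * A a b) * D b j)"
      unfolding sum_distrib_left sum_distrib_right by (subst sum.swap) (simp add: mult_ac)
    also have "(\<Sum>a\<in>UNIV. w a * (\<Sum>i\<in>UNIV. U i j * XT i a z)) = (\<Sum>i\<in>UNIV. f i * U i j)"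
      unfolding f_def sum_distrib_left sum_distrib_right by (subst sum.swap) (simp add: mult_ac)
    finally show ?thesis
      unfolding distrib_right sum.distrib by (simp only: eq_neg_iff_add_eq_0 add_ac)
  qed
  then have "(\<Sum>j\<in>UNIV. (\<Sum>i\<in>UNIV. f i * U i j) * \<zeta> j) =
      - (\<Sum>j\<in>UNIV. \<Sum>b\<in>UNIV. (fps_deriv (w b) + (\<Sum>a\<in>UNIV. w a * A a b)) * D b j * \<zeta> j)"
    by (simp add: sum_negf sum_distrib_right)
  also have "(\<Sum>j\<in>UNIV. \<Sum>b\<in>UNIV. (fps_deriv (w b) + (\<Sum>a\<in>UNIV. w a * A a b)) * D b j * \<zeta> j)
     = (\<Sum>b\<in>UNIV. (fps_deriv (w b) + (\<Sum>a\<in>UNIV. w a * A a b)) * (\<Sum>j\<in>UNIV. D b j * \<zeta> j))"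
    unfolding sum_distrib_left by (subst sum.swap) (simp add: mult.assoc)
  also have "\<dots> = 0" by (simp add: D\<zeta>)
  also have "(\<Sum>j\<in>UNIV. (\<Sum>i\<in>UNIV. f i * U i j) * \<zeta> j) = (\<Sum>i\<in>UNIV. f i * (\<Sum>j\<in>UNIV. U i j * \<zeta> j))"
    unfolding sum_distrib_left sum_distrib_right by (subst sum.swap) (simp add: mult.assoc)
  also have "\<dots> = det E * (\<Sum>i\<in>UNIV. f i * f i)"
    unfolding U\<zeta> by (simp add: sum_distrib_left mult_ac)
  finally have "(\<Sum>i\<in>UNIV. f i * f i) = 0" using detE by simp
  then show ?thesis using fps_sum_squares_eq_0[of UNIV f i] by (simp add: f_def)
qed

text \<open>If \<open>J\<close> is the differential of the flow of the controlled field, the \<open>j\<close>-th derivative of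
  \<open>J\<^sup>-\<^sup>1 X\<^sub>l\<close> along a Hamiltonian trajectory is \<open>J\<^sup>-\<^sup>1\<close> applied to this field.\<close>

primrec lie_field :: "'r \<Rightarrow> nat \<Rightarrow> (real^'n) \<times> (real^'n) \<Rightarrow> real^'n" where
  "lie_field l 0 y = X l (fst y)"
| "lie_field l (Suc j) y = ham_lie (lie_field l j) y - (\<Sum>i\<in>UNIV. ctrl i y *\<^sub>R frechet_derivative (X i) (at (fst y)) (lie_field l j y))"

lemma smooth_frechet_X:
  assumes "smooth_on phase V"
  shows "smooth_on phase (\<lambda>y. frechet_derivative (X i) (at (fst y)) (V y))"
proof -
  have "smooth_on phase (\<lambda>y. frechet_derivative (\<lambda>y. X i (fst y)) (at y) (V y, 0))"
    by (intro smooth_on_deriv open_phase smooth_fst smooth_X smooth_on_Pair assms smooth_on_const)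
  then show ?thesis
  proof (rule smooth_on_cong[OF open_phase])
    fix y assume y: "y \<in> phase"
    have "((\<lambda>y. X i (fst y)) has_derivative (\<lambda>v. frechet_derivative (X i) (at (fst y)) (fst v))) (at y)"
      using y smooth_on_has_derivative[OF smooth_X]
      by (intro has_derivative_compose[of fst fst y UNIV "X i"]) (auto intro!: derivative_eq_intros)
    from frechet_eq[OF this]
    show "frechet_derivative (\<lambda>y. X i (fst y)) (at y) (V y, 0) = frechet_derivative (X i) (at (fst y)) (V y)"
      by simp
  qed
qed

lemma smooth_lie_field: "smooth_on phase (lie_field l j)"
proof (induction j)
  case 0
  have "lie_field l 0 = (\<lambda>y. X l (fst y))" by (simp add: fun_eq_iff)
  then show ?case using smooth_fst[OF smooth_X[of l]] by simp
next
  case (Suc j)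
  have "lie_field l (Suc j) = (\<lambda>y. ham_lie (lie_field l j) y - (\<Sum>i\<in>UNIV. ctrl i y *\<^sub>R frechet_derivative (X i) (at (fst y)) (lie_field l j y)))"
    by (simp add: fun_eq_iff)
  moreover have "smooth_on phase \<dots>"
    by (intro smooth_on_diff smooth_ham_lie smooth_on_sum smooth_on_scaleR smooth_ctrl smooth_frechet_X open_phase Suc)
  ultimately show ?case by simp
qed

lemma ham_lie_nth:
  fixes g :: "(real^'n) \<times> (real^'n) \<Rightarrow> real^'n"
  assumes "smooth_on phase g" "y \<in> phase"
  shows "ham_lie (\<lambda>y. g y $ a) y = ham_lie g y $ a"
  unfolding ham_lie_def
  using frechet_eq[OF bounded_linear.has_derivative[OF bounded_linear_vec_nth smooth_on_has_derivative[OF assms]], of a]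
  by simp

lemma taylor_lie_field_Suc:
  assumes z: "z \<in> phase"
  shows "taylor (\<lambda>y. lie_field l (Suc j) y $ a) z = fps_deriv (taylor (\<lambda>y. lie_field l j y $ a) z) -
    (\<Sum>b\<in>UNIV. (\<Sum>i\<in>UNIV. taylor (ctrl i) z * XD i a b z) * taylor (\<lambda>y. lie_field l j y $ b) z)"
proof -
  have smn: "smooth_on phase (\<lambda>y. lie_field l j y $ b)" for b by (rule smooth_nth[OF open_phase smooth_lie_field])
  have smd: "smooth_on phase (\<lambda>y. frechet_derivative (X i) (at (fst y)) (axis b 1) $ a)" for i b
    by (rule smooth_nth[OF open_phase smooth_fst[OF smooth_on_deriv_const[OF smooth_X]]])
  have "taylor (\<lambda>y. lie_field l (Suc j) y $ a) z = taylor (\<lambda>y. ham_lie (\<lambda>y. lie_field l j y $ a) y +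
     (- (\<Sum>b\<in>UNIV. (\<Sum>i\<in>UNIV. ctrl i y * frechet_derivative (X i) (at (fst y)) (axis b 1) $ a) * lie_field l j y $ b))) z"
  proof (rule taylor_cong[OF _ z])
    fix y assume y: "y \<in> phase"
    have "frechet_derivative (X i) (at (fst y)) v $ a = (\<Sum>b\<in>UNIV. v $ b * frechet_derivative (X i) (at (fst y)) (axis b 1) $ a)" for i v
    proof -
      have "X i differentiable (at (fst y))" using y smooth_on_differentiable[OF smooth_X] by auto
      from derivative_basis_sum[OF this, of v] show ?thesis by (simp add: sum_Basis_axis inner_axis)
    qed
    note fb = this
    have "(\<Sum>i\<in>UNIV. ctrl i y *\<^sub>R frechet_derivative (X i) (at (fst y)) (lie_field l j y)) $ a =
      (\<Sum>i\<in>UNIV. ctrl i y * (\<Sum>b\<in>UNIV. lie_field l j y $ b * frechet_derivative (X i) (at (fst y)) (axis b 1) $ a))"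
      by (simp add: fb[of _ "lie_field l j y"])
    also have "\<dots> = (\<Sum>b\<in>UNIV. (\<Sum>i\<in>UNIV. ctrl i y * frechet_derivative (X i) (at (fst y)) (axis b 1) $ a) * lie_field l j y $ b)"
      unfolding sum_distrib_left sum_distrib_right by (subst sum.swap) (simp add: mult_ac)
    finally show "lie_field l (Suc j) y $ a = ham_lie (\<lambda>y. lie_field l j y $ a) y +
     (- (\<Sum>b\<in>UNIV. (\<Sum>i\<in>UNIV. ctrl i y * frechet_derivative (X i) (at (fst y)) (axis b 1) $ a) * lie_field l j y $ b))"
      using ham_lie_nth[OF smooth_lie_field y, of l j a] by simp
  qed
  also have "\<dots> = fps_deriv (taylor (\<lambda>y. lie_field l j y $ a) z) +
    (- taylor (\<lambda>y. \<Sum>b\<in>UNIV. (\<Sum>i\<in>UNIV. ctrl i y * frechet_derivative (X i) (at (fst y)) (axis b 1) $ a) * lie_field l j y $ b) z)"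
    unfolding taylor_deriv
    by (subst taylor_add, (intro smooth_ham_lie smn smooth_on_minus smooth_on_sum smooth_on_mult smooth_ctrl smd open_phase z)+)
      (subst taylor_minus, (intro smooth_ham_lie smn smooth_on_minus smooth_on_sum smooth_on_mult smooth_ctrl smd open_phase z refl)+)
  also have "taylor (\<lambda>y. \<Sum>b\<in>UNIV. (\<Sum>i\<in>UNIV. ctrl i y * frechet_derivative (X i) (at (fst y)) (axis b 1) $ a) * lie_field l j y $ b) z
     = (\<Sum>b\<in>UNIV. (\<Sum>i\<in>UNIV. taylor (ctrl i) z * XD i a b z) * taylor (\<lambda>y. lie_field l j y $ b) z)"
    by (simp add: taylor_sum taylor_mult smn smd smooth_ctrl smooth_on_sum smooth_on_mult open_phase z)
  finally show ?thesis by simp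
qed

lemma not_spanning_left_kernel:
  assumes z: "z \<in> phase" and \<eta>: "\<And>l j. \<eta> \<bullet> lie_field l j z = 0"
  obtains w where "\<And>a. fps_nth (w a) 0 = \<eta> $ a" "\<And>j. (\<Sum>a\<in>UNIV. w a * taylor_d (ep j) (X\<^sub>c a) z) = 0"
proof -
  define A where "A a b = (\<Sum>i\<in>UNIV. taylor (ctrl i) z * XD i a b z)" for a b
  obtain w where w: "\<And>a. fps_deriv (w a) = (\<Sum>b\<in>UNIV. - A b a * w b)" "\<And>a. fps_nth (w a) 0 = \<eta> $ a"
    using fps_linear_ode[of "\<lambda>a b. - A b a" "\<lambda>a. \<eta> $ a"] by metis
  have dw: "fps_deriv (\<Sum>a\<in>UNIV. w a * F a) = (\<Sum>a\<in>UNIV. w a * (fps_deriv (F a) - (\<Sum>b\<in>UNIV. A a b * F b)))" for F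
  proof -
    have "(\<Sum>a\<in>UNIV. (\<Sum>b\<in>UNIV. - A b a * w b) * F a) = - (\<Sum>a\<in>UNIV. w a * (\<Sum>b\<in>UNIV. A a b * F b))"
      unfolding sum_distrib_left sum_distrib_right by (subst sum.swap) (simp add: mult_ac sum_negf)
    then show ?thesis
      by (simp add: fps_deriv_sum w(1) sum.distrib right_diff_distrib sum_subtractf add.commute)
  qed
  define f where "f l j = (\<Sum>a\<in>UNIV. w a * taylor (\<lambda>y. lie_field l j y $ a) z)" for l j
  have f_Suc: "fps_deriv (f l j) = f l (Suc j)" for l j
    unfolding f_def dw taylor_lie_field_Suc[OF z] A_def ..
  have f0: "fps_nth (f l j) 0 = 0" for l j
    using \<eta>[of l j] by (simp add: f_def fps_sum_nth w taylor_0 inner_vec_def)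
  have "fps_nth (f l j) k = 0" for l j k
  proof (induction k arbitrary: j)
    case (Suc k)
    have "fps_nth (fps_deriv (f l j)) k = 0" using Suc by (simp add: f_Suc)
    then show ?case by simp
  qed (rule f0)
  then have "f l 0 = 0" for l by (intro fps_ext) simp
  then have ann: "(\<Sum>a\<in>UNIV. w a * XT l a z) = 0" for l by (simp add: f_def)
  have "(\<Sum>a\<in>UNIV. w a * taylor_d (ep j) (X\<^sub>c a) z) = 0" (is "?g = 0") for j
  proof -
    have "fps_deriv ?g = (\<Sum>a\<in>UNIV. w a * (\<Sum>i\<in>UNIV. taylor_d (ep j) (ctrl i) z * XT i a z))"
      unfolding dw taylor_d_X\<^sub>c_deriv[OF z] A_def by simp
    also have "\<dots> = (\<Sum>i\<in>UNIV. taylor_d (ep j) (ctrl i) z * (\<Sum>a\<in>UNIV. w a * XT i a z))"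
      unfolding sum_distrib_left by (subst sum.swap) (simp add: mult_ac)
    finally have "fps_deriv ?g = 0" by (simp add: ann)
    moreover have "fps_nth ?g 0 = 0" by (simp add: fps_sum_nth taylor_d_0 frechet_coords)
    ultimately show ?thesis by (simp add: fps_deriv_eq_0_iff)
  qed
  then show ?thesis using that w(2) by blast
qed

lemma smooth_field_bracket: "smooth_on S Y \<Longrightarrow> smooth_on S Z \<Longrightarrow> smooth_on S (field_bracket Y Z)"
  unfolding field_bracket_def[abs_def]
  by (intro smooth_on_diff smooth_on_deriv open_S)

lemma smooth_bracket_fields: "Y \<in> bracket_fields X \<Longrightarrow> smooth_on S Y"
  by (induction rule: bracket_fields.induct) (auto intro: smooth_X smooth_field_bracket)

lemma taylor_field_bracket:
  assumes "smooth_on S Y" "smooth_on S Z" "z \<in> phase"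
  shows "taylor (\<lambda>y. field_bracket Y Z (fst y) $ a) z =
    (\<Sum>b\<in>UNIV. taylor (\<lambda>y. frechet_derivative Z (at (fst y)) (axis b 1) $ a) z * taylor (\<lambda>y. Y (fst y) $ b) z)
    - (\<Sum>b\<in>UNIV. taylor (\<lambda>y. frechet_derivative Y (at (fst y)) (axis b 1) $ a) z * taylor (\<lambda>y. Z (fst y) $ b) z)"
proof -
  have smd: "smooth_on phase (\<lambda>y. frechet_derivative Y (at (fst y)) (axis b 1) $ a)"
    if "smooth_on S Y" for Y :: "real^'n \<Rightarrow> real^'n" and b
    by (rule smooth_nth[OF open_phase smooth_fst[OF smooth_on_deriv_const[OF that]]])
  have smn: "smooth_on phase (\<lambda>y. Y (fst y) $ b)" if "smooth_on S Y" for Y :: "real^'n \<Rightarrow> real^'n" and b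
    by (rule smooth_nth[OF open_phase smooth_fst[OF that]])
  have fb: "frechet_derivative Y (at q) v $ a = (\<Sum>b\<in>UNIV. frechet_derivative Y (at q) (axis b 1) $ a * v $ b)"
    if "smooth_on S Y" "q \<in> S" for Y :: "real^'n \<Rightarrow> real^'n" and q v
    using derivative_basis_sum[OF smooth_on_differentiable[OF that], of v]
    by (simp add: sum_Basis_axis inner_axis mult.commute)
  have sum1: "smooth_on phase (\<lambda>y. \<Sum>b\<in>UNIV. frechet_derivative Z (at (fst y)) (axis b 1) $ a * Y (fst y) $ b)"
    if "smooth_on S Y" "smooth_on S Z" for Y Z :: "real^'n \<Rightarrow> real^'n"
    by (intro smooth_on_sum smooth_on_mult smd smn open_phase that)
  have Tsum: "taylor (\<lambda>y. \<Sum>b\<in>UNIV. frechet_derivative Z (at (fst y)) (axis b 1) $ a * Y (fst y) $ b) z =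
     (\<Sum>b\<in>UNIV. taylor (\<lambda>y. frechet_derivative Z (at (fst y)) (axis b 1) $ a) z * taylor (\<lambda>y. Y (fst y) $ b) z)"
    if "smooth_on S Y" "smooth_on S Z" for Y Z :: "real^'n \<Rightarrow> real^'n"
    by (subst taylor_sum[OF smooth_on_mult[OF open_phase smd[OF that(2)] smn[OF that(1)]] assms(3)])
      (simp only: taylor_mult[OF smd[OF that(2)] smn[OF that(1)] assms(3)])
  have "taylor (\<lambda>y. field_bracket Y Z (fst y) $ a) z =
    taylor (\<lambda>y. (\<Sum>b\<in>UNIV. frechet_derivative Z (at (fst y)) (axis b 1) $ a * Y (fst y) $ b)
      + (- (\<Sum>b\<in>UNIV. frechet_derivative Y (at (fst y)) (axis b 1) $ a * Z (fst y) $ b))) z"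
    by (rule taylor_cong[OF _ assms(3)])
      (auto simp: field_bracket_def fb[OF assms(1), of _ "Z _"] fb[OF assms(2), of _ "Y _"])
  also have "\<dots> = taylor (\<lambda>y. \<Sum>b\<in>UNIV. frechet_derivative Z (at (fst y)) (axis b 1) $ a * Y (fst y) $ b) z
      + - taylor (\<lambda>y. \<Sum>b\<in>UNIV. frechet_derivative Y (at (fst y)) (axis b 1) $ a * Z (fst y) $ b) z"
    unfolding taylor_add[OF sum1[OF assms(1,2)] smooth_on_minus[OF open_phase sum1[OF assms(2,1)]] assms(3)]
      taylor_minus[OF sum1[OF assms(2,1)] assms(3)] ..
  finally show ?thesis by (simp add: Tsum assms)
qed

definition taylor_dd :: "(real^'n) \<times> (real^'n) \<Rightarrow> (real^'n) \<times> (real^'n) \<Rightarrow> ((real^'n) \<times> (real^'n) \<Rightarrow> real) \<Rightarrow> (real^'n) \<times> (real^'n) \<Rightarrow> real fps" where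
  "taylor_dd u v g z = Abs_fps (\<lambda>k. frechet_derivative (\<lambda>y. frechet_derivative ((ham_lie ^^ k) g) (at y) u) (at z) v / fact k)"

lemma taylor_dd_commute: "smooth_on phase g \<Longrightarrow> z \<in> phase \<Longrightarrow> taylor_dd u v g z = taylor_dd v u g z"
  by (simp add: taylor_dd_def mixed_derivatives_real[OF open_phase smooth_ham_lie_pow, of g z _ u v])

abbreviation "shift q \<mu> j s \<equiv> (q :: real^'n, \<mu> + s *\<^sub>R axis j 1 :: real^'n)"

lemma taylor_family_deriv:
  assumes "smooth_on phase g" "q \<in> S"
  shows "fps_family_deriv (\<lambda>s. taylor g (shift q \<mu> j s)) (taylor_d (ep j) g (q, \<mu>))"
proof -
  have "((\<lambda>s. (ham_lie ^^ k) g (shift q \<mu> j s)) has_real_derivative frechet_derivative ((ham_lie ^^ k) g) (at (q, \<mu>)) (ep j)) (at 0)" for k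
    using line_derivative[of "(ham_lie ^^ k) g" "(q, \<mu>)" 0 "ep j"] smooth_on_differentiable[OF smooth_ham_lie_pow[OF assms(1)]] assms(2)
    by simp
  then show ?thesis unfolding fps_family_deriv_def taylor_def taylor_d_def
    by (auto intro: DERIV_cdivide)
qed

lemma taylor_d_family_deriv:
  assumes "smooth_on phase g" "q \<in> S"
  shows "fps_family_deriv (\<lambda>s. taylor_d u g (shift q \<mu> j s)) (taylor_dd u (ep j) g (q, \<mu>))"
proof -
  have "((\<lambda>s. frechet_derivative ((ham_lie ^^ k) g) (at (shift q \<mu> j s)) u) has_real_derivative
      frechet_derivative (\<lambda>y. frechet_derivative ((ham_lie ^^ k) g) (at y) u) (at (q, \<mu>)) (ep j)) (at 0)" for k
    using line_derivative[of "\<lambda>y. frechet_derivative ((ham_lie ^^ k) g) (at y) u" "(q, \<mu>)" 0 "ep j"]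
      smooth_on_differentiable[OF smooth_on_deriv_const[OF smooth_ham_lie_pow[OF assms(1)]]] assms(2)
    by simp
  then show ?thesis unfolding fps_family_deriv_def taylor_dd_def taylor_d_def
    by (auto intro: DERIV_cdivide)
qed

end

text \<open>At a covector where \<open>I\<close> is a largest set of independent rows of the Jacobian of the formal
  exponential map, completing these rows by constant ones gives, through cofactors, left kernel
  vectors of the Jacobian that depend differentiably on the covector.\<close>

locale sr_frame_point = sr_frame S X for S :: "(real^'n) set" and X :: "'r::finite \<Rightarrow> real^'n \<Rightarrow> real^'n" +
  fixes q0 :: "real^'n"
  assumes q0: "q0 \<in> S"
begin

definition jac :: "real^'n \<Rightarrow> 'n \<Rightarrow> real fps^'n" where
  "jac \<mu> j = (\<chi> a. taylor_d (ep j) (X\<^sub>c a) (q0, \<mu>))"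

definition completed :: "'n set \<Rightarrow> real^'n \<Rightarrow> ('n \<Rightarrow> real fps^'n) \<Rightarrow> 'n \<Rightarrow> real fps^'n" where
  "completed I \<mu> c i = (if i \<in> I then jac \<mu> i else c i)"

definition series_field :: "(real^'n \<Rightarrow> real^'n) \<Rightarrow> real^'n \<Rightarrow> real fps^'n" where
  "series_field Y \<mu> = (\<chi> a. taylor (\<lambda>y. Y (fst y) $ a) (q0, \<mu>))"

lemma in_phase: "(q0, \<mu>) \<in> phase" by (simp add: q0)

definition max_rank :: "'n set \<Rightarrow> bool" where
  "max_rank I \<longleftrightarrow> (\<forall>I' \<mu> c. card I < card I' \<longrightarrow> det (\<chi> i. completed I' \<mu> c i) = 0)"

definition tangential :: "'n set \<Rightarrow> (real^'n \<Rightarrow> real^'n) \<Rightarrow> bool" where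
  "tangential I Y \<longleftrightarrow> (\<forall>\<mu> c k. k \<notin> I \<longrightarrow>
     det (\<chi> i. if i = k then series_field Y \<mu> else completed I \<mu> c i) = 0)"

lemma det_jac_row:
  assumes I: "max_rank I" and k: "k \<notin> I"
  shows "det (\<chi> i. if i = k then jac \<mu> j else completed I \<mu> c i) = 0"
proof (cases "j \<in> I")
  case True
  then have "completed I \<mu> c j = jac \<mu> j" "j \<noteq> k" using k by (auto simp: completed_def)
  then show ?thesis
    using det_row_replace[of k "completed I \<mu> c" j] by (simp cong: if_cong)
next
  case False
  have card: "card I < card (insert j I)" using False by simp
  show ?thesis
  proof (cases "j = k")
    case True
    have "(\<chi> i. if i = k then jac \<mu> j else completed I \<mu> c i) = (\<chi> i. completed (insert j I) \<mu> c i)"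
      using True by (auto simp: vec_eq_iff completed_def)
    then show ?thesis using I card by (simp add: max_rank_def)
  next
    case jk: False
    let ?A = "\<chi> i. if i = k then jac \<mu> j else completed I \<mu> c i"
    let ?p = "Transposition.transpose j k"
    have "(\<chi> i. ?A $ ?p i) = (\<chi> i. completed (insert j I) \<mu> (c(k := c j)) i)"
      using False k jk by (auto simp: vec_eq_iff completed_def Transposition.transpose_def)
    then have "det (\<chi> i. ?A $ ?p i) = 0" using I card by (simp add: max_rank_def)
    moreover have "?p permutes UNIV" by (simp add: permutes_swap_id)
    ultimately have "of_int (sign ?p) * det ?A = 0" using det_permute_rows[of ?p ?A] by simp
    then show ?thesis by (simp add: sign_def split: if_splits)
  qed
qed

lemma det_row_axis:
  "det (\<chi> i. if i = k then v else G i) = (\<Sum>a\<in>UNIV. det (\<chi> i. if i = k then axis a 1 else G i) * v $ a)"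
  for G :: "'n \<Rightarrow> real fps^'n"
  by (subst det_row_expand) (simp add: mult.commute)

lemma tangential_combination:
  assumes Y: "tangential I Y" and d: "det (\<chi> i. completed I \<mu> c i) \<noteq> 0"
  obtains \<alpha> where "\<And>a. det (\<chi> i. completed I \<mu> c i) * series_field Y \<mu> $ a = (\<Sum>l\<in>UNIV. \<alpha> l * jac \<mu> l $ a)"
proof -
  define \<alpha> where "\<alpha> l = (if l \<in> I then det (\<chi> i. if i = l then series_field Y \<mu> else completed I \<mu> c i) else 0)" for l
  have "det (\<chi> i. completed I \<mu> c i) * series_field Y \<mu> $ a = (\<Sum>l\<in>UNIV. \<alpha> l * jac \<mu> l $ a)" for a
    unfolding cramer_rows[OF d]
    by (rule sum.cong) (use Y in \<open>auto simp: \<alpha>_def completed_def tangential_def\<close>)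
  then show ?thesis using that by blast
qed

lemma tangential_bracket:
  assumes I: "max_rank I" and Y: "tangential I Y" "smooth_on S Y" and Z: "tangential I Z" "smooth_on S Z"
  shows "tangential I (field_bracket Y Z)"
  unfolding tangential_def
proof (intro allI impI)
  fix \<mu> c k
  assume k: "k \<notin> I"
  define W where "W \<mu> a = det (\<chi> i. if i = k then axis a 1 else completed I \<mu> c i)" for \<mu> a
  have Wdet: "det (\<chi> i. if i = k then v else completed I \<mu> c i) = (\<Sum>a\<in>UNIV. W \<mu> a * v $ a)" for v \<mu>
    unfolding W_def by (rule det_row_axis)
  have Wjac: "(\<Sum>a\<in>UNIV. W \<mu> a * jac \<mu> j $ a) = 0" for \<mu> j
    unfolding Wdet[symmetric] by (rule det_jac_row[OF I k])
  have WY: "(\<Sum>a\<in>UNIV. W \<mu> a * series_field Y \<mu> $ a) = 0" if "tangential I Y" for Y \<mu>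
    unfolding Wdet[symmetric] using that k by (simp add: tangential_def)
  show "det (\<chi> i. if i = k then series_field (field_bracket Y Z) \<mu> else completed I \<mu> c i) = 0"
  proof (cases "\<forall>a. W \<mu> a = 0")
    case True
    then show ?thesis by (simp add: Wdet)
  next
    case False
    then obtain a0 where a0: "W \<mu> a0 \<noteq> 0" by blast
    define \<Delta> where "\<Delta> = W \<mu> a0"
    have "(\<chi> i. completed I \<mu> (c(k := axis a0 1)) i) = (\<chi> i. if i = k then axis a0 1 else completed I \<mu> c i)"
      using k by (auto simp: vec_eq_iff completed_def)
    then have \<Delta>: "det (\<chi> i. completed I \<mu> (c(k := axis a0 1)) i) = \<Delta>" by (simp add: \<Delta>_def W_def)
    have nz: "det (\<chi> i. completed I \<mu> (c(k := axis a0 1)) i) \<noteq> 0" using a0 \<Delta> by (simp add: \<Delta>_def)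
    obtain \<alpha> where \<alpha>: "\<And>a. \<Delta> * series_field Y \<mu> $ a = (\<Sum>l\<in>UNIV. \<alpha> l * jac \<mu> l $ a)"
      using tangential_combination[OF Y(1) nz] unfolding \<Delta> by blast
    obtain \<beta> where \<beta>: "\<And>a. \<Delta> * series_field Z \<mu> $ a = (\<Sum>l\<in>UNIV. \<beta> l * jac \<mu> l $ a)"
      using tangential_combination[OF Z(1) nz] unfolding \<Delta> by blast
    have jac_deriv: "fps_family_deriv (\<lambda>s. jac (\<mu> + s *\<^sub>R axis j 1) l $ a) (taylor_dd (ep l) (ep j) (X\<^sub>c a) (q0, \<mu>))" for j l a
      unfolding jac_def using taylor_d_family_deriv[OF smooth_coords(1) q0] by simp
    have "\<exists>d. fps_family_deriv (\<lambda>s. W (\<mu> + s *\<^sub>R axis j 1) a) d" for j a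
      unfolding W_def
    proof (rule fps_family_deriv_det)
      fix i b
      show "\<exists>d. fps_family_deriv (\<lambda>s. (\<chi> i. if i = k then axis a 1 else completed I (\<mu> + s *\<^sub>R axis j 1) c i) $ i $ b) d"
        by (cases "i = k"; cases "i \<in> I")
          (auto simp: completed_def intro!: exI fps_family_deriv_const jac_deriv)
    qed
    then obtain W' where W': "\<And>j a. fps_family_deriv (\<lambda>s. W (\<mu> + s *\<^sub>R axis j 1) a) (W' j a)" by metis
    have J': "(\<Sum>a\<in>UNIV. W' j a * jac \<mu> l $ a) + (\<Sum>a\<in>UNIV. W \<mu> a * taylor_dd (ep l) (ep j) (X\<^sub>c a) (q0, \<mu>)) = 0" for j l
    proof -
      have "fps_family_deriv (\<lambda>s. \<Sum>a\<in>UNIV. W (\<mu> + s *\<^sub>R axis j 1) a * jac (\<mu> + s *\<^sub>R axis j 1) l $ a)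
         (\<Sum>a\<in>UNIV. W' j a * jac (\<mu> + 0 *\<^sub>R axis j 1) l $ a + W (\<mu> + 0 *\<^sub>R axis j 1) a * taylor_dd (ep l) (ep j) (X\<^sub>c a) (q0, \<mu>))"
        by (intro fps_family_deriv_sum fps_family_deriv_mult[OF W' jac_deriv])
      then show ?thesis
        using fps_family_deriv_unique[OF fps_family_deriv_const[of 0]] unfolding Wjac by (simp add: sum.distrib)
    qed
    have V': "(\<Sum>a\<in>UNIV. W' j a * series_field V \<mu> $ a) +
        (\<Sum>a\<in>UNIV. W \<mu> a * (\<Sum>b\<in>UNIV. taylor (\<lambda>y. frechet_derivative V (at (fst y)) (axis b 1) $ a) (q0, \<mu>) * jac \<mu> j $ b)) = 0"
      if V: "tangential I V" "smooth_on S V" for V j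
    proof -
      have sm: "smooth_on phase (\<lambda>y. V (fst y) $ a)" for a
        by (rule smooth_nth[OF open_phase smooth_fst[OF V(2)]])
      have "fps_family_deriv (\<lambda>s. \<Sum>a\<in>UNIV. W (\<mu> + s *\<^sub>R axis j 1) a * series_field V (\<mu> + s *\<^sub>R axis j 1) $ a)
         (\<Sum>a\<in>UNIV. W' j a * series_field V (\<mu> + 0 *\<^sub>R axis j 1) $ a + W (\<mu> + 0 *\<^sub>R axis j 1) a * taylor_d (ep j) (\<lambda>y. V (fst y) $ a) (q0, \<mu>))"
        using taylor_family_deriv[OF sm q0, where \<mu> = \<mu> and j = j]
        by (intro fps_family_deriv_sum fps_family_deriv_mult[OF W']) (simp add: series_field_def)
      then show ?thesis
        using fps_family_deriv_unique[OF fps_family_deriv_const[of 0]] unfolding WY[OF V(1)]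
        by (simp add: sum.distrib taylor_d_base[OF V(2) in_phase] jac_def)
    qed
    define R where "R j l = (\<Sum>a\<in>UNIV. W \<mu> a * taylor_dd (ep l) (ep j) (X\<^sub>c a) (q0, \<mu>))" for j l
    have R_sym: "R j l = R l j" for j l
      unfolding R_def by (simp add: taylor_dd_commute[OF smooth_coords(1) in_phase, of "ep l" "ep j"])
    have half: "\<Delta> * (\<Delta> * (\<Sum>a\<in>UNIV. W \<mu> a * (\<Sum>b\<in>UNIV. taylor (\<lambda>y. frechet_derivative V (at (fst y)) (axis b 1) $ a) (q0, \<mu>) * series_field V' \<mu> $ b)))
        = (\<Sum>j\<in>UNIV. \<Sum>l\<in>UNIV. \<beta> j * \<alpha> l * R j l)"
      if V: "tangential I V" "smooth_on S V"
        and \<alpha>: "\<And>a. \<Delta> * series_field V \<mu> $ a = (\<Sum>l\<in>UNIV. \<alpha> l * jac \<mu> l $ a)"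
        and \<beta>: "\<And>a. \<Delta> * series_field V' \<mu> $ a = (\<Sum>l\<in>UNIV. \<beta> l * jac \<mu> l $ a)" for V V' \<alpha> \<beta>
    proof -
      let ?DV = "\<lambda>a b. taylor (\<lambda>y. frechet_derivative V (at (fst y)) (axis b 1) $ a) (q0, \<mu>)"
      have "\<Delta> * (\<Sum>a\<in>UNIV. W \<mu> a * (\<Sum>b\<in>UNIV. ?DV a b * series_field V' \<mu> $ b))
         = (\<Sum>a\<in>UNIV. W \<mu> a * (\<Sum>b\<in>UNIV. ?DV a b * (\<Delta> * series_field V' \<mu> $ b)))"
        by (simp add: sum_distrib_left mult_ac)
      also have "\<dots> = (\<Sum>a\<in>UNIV. \<Sum>b\<in>UNIV. \<Sum>j\<in>UNIV. \<beta> j * (W \<mu> a * (?DV a b * jac \<mu> j $ b)))"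
        unfolding \<beta> by (simp add: sum_distrib_left sum_distrib_right mult_ac)
      also have "\<dots> = (\<Sum>a\<in>UNIV. \<Sum>j\<in>UNIV. \<Sum>b\<in>UNIV. \<beta> j * (W \<mu> a * (?DV a b * jac \<mu> j $ b)))"
        by (intro sum.cong refl sum.swap)
      also have "\<dots> = (\<Sum>j\<in>UNIV. \<Sum>a\<in>UNIV. \<Sum>b\<in>UNIV. \<beta> j * (W \<mu> a * (?DV a b * jac \<mu> j $ b)))"
        by (rule sum.swap)
      also have "\<dots> = (\<Sum>j\<in>UNIV. \<beta> j * (\<Sum>a\<in>UNIV. W \<mu> a * (\<Sum>b\<in>UNIV. ?DV a b * jac \<mu> j $ b)))"
        by (simp add: sum_distrib_left)
      also have "\<dots> = (\<Sum>j\<in>UNIV. \<beta> j * - (\<Sum>a\<in>UNIV. W' j a * series_field V \<mu> $ a))"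
        using V'[OF V] by (intro sum.cong refl arg_cong2[of _ _ _ _ "(*)"]) (simp add: eq_neg_iff_add_eq_0 add.commute)
      finally have "\<Delta> * (\<Delta> * (\<Sum>a\<in>UNIV. W \<mu> a * (\<Sum>b\<in>UNIV. ?DV a b * series_field V' \<mu> $ b))) =
         (\<Sum>j\<in>UNIV. \<beta> j * - (\<Sum>a\<in>UNIV. W' j a * (\<Delta> * series_field V \<mu> $ a)))"
        by (simp add: sum_distrib_left mult_ac)
      also have "\<dots> = (\<Sum>j\<in>UNIV. \<beta> j * (\<Sum>l\<in>UNIV. \<alpha> l * - (\<Sum>a\<in>UNIV. W' j a * jac \<mu> l $ a)))"
      proof (intro sum.cong refl arg_cong2[of _ _ _ _ "(*)"])
        fix j
        have "(\<Sum>a\<in>UNIV. W' j a * (\<Delta> * series_field V \<mu> $ a)) = (\<Sum>l\<in>UNIV. \<alpha> l * (\<Sum>a\<in>UNIV. W' j a * jac \<mu> l $ a))"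
          unfolding \<alpha> sum_distrib_left by (subst sum.swap) (simp add: mult_ac)
        then show "- (\<Sum>a\<in>UNIV. W' j a * (\<Delta> * series_field V \<mu> $ a)) = (\<Sum>l\<in>UNIV. \<alpha> l * - (\<Sum>a\<in>UNIV. W' j a * jac \<mu> l $ a))"
          by (simp add: sum_negf)
      qed
      also have "\<dots> = (\<Sum>j\<in>UNIV. \<beta> j * (\<Sum>l\<in>UNIV. \<alpha> l * R j l))"
      proof -
        have "- (\<Sum>a\<in>UNIV. W' j a * jac \<mu> l $ a) = R j l" for j l
          using J'[of j l] unfolding R_def by (simp add: minus_unique)
        then show ?thesis by simp
      qed
      finally show ?thesis by (simp add: sum_distrib_left mult.assoc)
    qed
    have "(\<Sum>j\<in>UNIV. \<Sum>l\<in>UNIV. \<beta> j * \<alpha> l * R j l) = (\<Sum>j\<in>UNIV. \<Sum>l\<in>UNIV. \<alpha> j * \<beta> l * R j l)"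
      by (subst sum.swap, subst R_sym) (simp add: mult_ac)
    moreover have "(\<Sum>a\<in>UNIV. W \<mu> a * series_field (field_bracket Y Z) \<mu> $ a) =
      (\<Sum>a\<in>UNIV. W \<mu> a * (\<Sum>b\<in>UNIV. taylor (\<lambda>y. frechet_derivative Z (at (fst y)) (axis b 1) $ a) (q0, \<mu>) * series_field Y \<mu> $ b))
      - (\<Sum>a\<in>UNIV. W \<mu> a * (\<Sum>b\<in>UNIV. taylor (\<lambda>y. frechet_derivative Y (at (fst y)) (axis b 1) $ a) (q0, \<mu>) * series_field Z \<mu> $ b))"
      by (simp add: series_field_def taylor_field_bracket[OF Y(2) Z(2) in_phase] right_diff_distrib sum_subtractf)
    ultimately have "\<Delta> * (\<Delta> * (\<Sum>a\<in>UNIV. W \<mu> a * series_field (field_bracket Y Z) \<mu> $ a)) = 0"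
      using half[OF Y \<alpha> \<beta>] half[OF Z \<beta> \<alpha>] by (simp add: right_diff_distrib)
    then show ?thesis using a0 by (simp add: Wdet \<Delta>_def)
  qed
qed

lemma tangential_X:
  assumes I: "max_rank I"
  shows "tangential I (X i)"
  unfolding tangential_def
proof (intro allI impI)
  fix \<mu> c k
  assume k: "k \<notin> I"
  define W where "W a = det (\<chi> i. if i = k then axis a 1 else completed I \<mu> c i)" for a
  have Wdet: "det (\<chi> i. if i = k then v else completed I \<mu> c i) = (\<Sum>a\<in>UNIV. W a * v $ a)" for v
    unfolding W_def by (rule det_row_axis)
  have "(\<Sum>a\<in>UNIV. W a * taylor_d (ep j) (X\<^sub>c a) (q0, \<mu>)) = 0" for j
    using Wdet[of "jac \<mu> j"] det_jac_row[OF I k] by (simp add: jac_def)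
  from left_kernel_annihilates[OF in_phase this, of i]
  show "det (\<chi> l. if l = k then series_field (X i) \<mu> else completed I \<mu> c l) = 0"
    by (simp add: Wdet series_field_def)
qed

lemma tangential_bracket_fields:
  assumes "max_rank I" "Y \<in> bracket_fields X"
  shows "tangential I Y"
  using assms(2)
  by (induction rule: bracket_fields.induct)
    (auto intro: tangential_X tangential_bracket assms(1) smooth_bracket_fields)

theorem exists_spanning_covector:
  assumes gen: "\<And>\<eta>. \<eta> \<noteq> 0 \<Longrightarrow> \<exists>Y\<in>bracket_fields X. \<eta> \<bullet> Y q0 \<noteq> 0"
  shows "\<exists>\<mu>. \<forall>\<eta>. \<eta> \<noteq> 0 \<longrightarrow> (\<exists>l j. \<eta> \<bullet> lie_field l j (q0, \<mu>) \<noteq> 0)"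
proof -
  define P where "P = (\<lambda>(I, \<mu>, c). det (\<chi> i. completed I \<mu> c i) \<noteq> 0)"
  have "(\<chi> i. completed {} 0 (\<lambda>i. axis i 1) i) = mat 1"
    by (auto simp: completed_def mat_def vec_eq_iff axis_def)
  then have P0: "P ({}, 0, \<lambda>i. axis i 1)" by (simp add: P_def)
  have bound: "\<forall>x. P x \<longrightarrow> card (fst x) < Suc CARD('n)"
    by (simp add: less_Suc_eq_le card_mono)
  obtain x where x: "P x" "\<And>y. P y \<Longrightarrow> card (fst y) \<le> card (fst x)"
    using ex_has_greatest_nat[of P _ "\<lambda>x. card (fst x)" "Suc CARD('n)"] P0 bound by blast
  obtain I \<mu> c where Ic: "x = (I, \<mu>, c)" by (cases x)
  have I: "max_rank I"
    unfolding max_rank_def using x(2)[of "(_, _, _)"] by (fastforce simp: P_def Ic)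
  have d: "det (\<chi> i. completed I \<mu> c i) \<noteq> 0" using x(1) by (simp add: P_def Ic)
  have "\<exists>l j. \<eta> \<bullet> lie_field l j (q0, \<mu>) \<noteq> 0" if "\<eta> \<noteq> 0" for \<eta>
  proof (rule ccontr)
    assume "\<nexists>l j. \<eta> \<bullet> lie_field l j (q0, \<mu>) \<noteq> 0"
    then obtain w where w: "\<And>a. fps_nth (w a) 0 = \<eta> $ a"
      "\<And>j. (\<Sum>a\<in>UNIV. w a * taylor_d (ep j) (X\<^sub>c a) (q0, \<mu>)) = 0"
      using not_spanning_left_kernel[OF in_phase, of \<eta> \<mu>] by blast
    obtain Y where Y: "Y \<in> bracket_fields X" "\<eta> \<bullet> Y q0 \<noteq> 0" using gen[OF \<open>\<eta> \<noteq> 0\<close>] by blast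
    obtain \<alpha> where \<alpha>: "\<And>a. det (\<chi> i. completed I \<mu> c i) * series_field Y \<mu> $ a = (\<Sum>l\<in>UNIV. \<alpha> l * jac \<mu> l $ a)"
      using tangential_combination[OF tangential_bracket_fields[OF I Y(1)] d] by blast
    have "det (\<chi> i. completed I \<mu> c i) * (\<Sum>a\<in>UNIV. w a * series_field Y \<mu> $ a) =
       (\<Sum>a\<in>UNIV. w a * (det (\<chi> i. completed I \<mu> c i) * series_field Y \<mu> $ a))"
      by (simp add: sum_distrib_left mult_ac)
    also have "\<dots> = (\<Sum>l\<in>UNIV. \<alpha> l * (\<Sum>a\<in>UNIV. w a * jac \<mu> l $ a))"
      unfolding \<alpha> sum_distrib_left by (subst sum.swap) (simp add: mult_ac)
    also have "\<dots> = 0" using w(2) by (simp add: jac_def)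
    finally have "(\<Sum>a\<in>UNIV. w a * series_field Y \<mu> $ a) = 0" using d by simp
    then have "fps_nth (\<Sum>a\<in>UNIV. w a * series_field Y \<mu> $ a) 0 = 0" by simp
    then show False using Y(2) by (simp add: fps_sum_nth w(1) series_field_def taylor_0 inner_vec_def)
  qed
  then show ?thesis by blast
qed

end

section \<open>Ordinary differential equations\<close>

lemma small_time_bound:
  fixes e :: "real \<Rightarrow> 'a::euclidean_space"
  assumes "a \<le> b" "e a = 0" and e': "\<And>t. t \<in> {a..b} \<Longrightarrow> (e has_vector_derivative e' t) (at t within {a..b})"
    and bound: "\<And>t. t \<in> {a..b} \<Longrightarrow> norm (e' t) \<le> L * norm (e t) + \<eta>"
    and small: "(b - a) * L \<le> 1/2" and "0 \<le> L" "t \<in> {a..b}"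
  shows "norm (e t) \<le> 2 * (b - a) * \<eta>"
proof -
  have cont: "continuous_on {a..b} (\<lambda>t. norm (e t))"
    using e' by (intro continuous_on_norm continuous_on_vector_derivative) auto
  obtain s where s: "s \<in> {a..b}" "\<And>t. t \<in> {a..b} \<Longrightarrow> norm (e t) \<le> norm (e s)"
    using continuous_attains_sup[OF _ _ cont] \<open>a \<le> b\<close> by auto
  define m where "m = norm (e s)"
  have \<eta>: "0 \<le> L * m + \<eta>"
    using order_trans[OF norm_ge_zero bound[OF s(1)]] by (simp add: m_def)
  have "norm (e s - e a) \<le> (L * m + \<eta>) * norm (s - a)"
  proof (rule differentiable_bound[where S = "{a..b}" and f' = "\<lambda>t h. h *\<^sub>R e' t"])
    fix t assume t: "t \<in> {a..b}"
    show "(e has_derivative (\<lambda>h. h *\<^sub>R e' t)) (at t within {a..b})"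
      using e'[OF t] by (simp add: has_vector_derivative_def)
    have "norm (e' t) \<le> L * m + \<eta>"
      using bound[OF t] mult_left_mono[OF s(2)[OF t] \<open>0 \<le> L\<close>] by (simp add: m_def)
    then show "onorm (\<lambda>h. h *\<^sub>R e' t) \<le> L * m + \<eta>"
      by (intro onorm_bound \<eta>) (simp add: mult.commute mult_left_mono)
  qed (use s \<open>a \<le> b\<close> in auto)
  also have "\<dots> \<le> (L * m + \<eta>) * (b - a)"
    using s(1) \<eta> by (intro mult_left_mono) auto
  finally have "m \<le> (b - a) * L * m + (b - a) * \<eta>"
    using \<open>e a = 0\<close> by (simp add: m_def algebra_simps)
  also have "(b - a) * L * m \<le> 1/2 * m" using small by (intro mult_right_mono) (simp_all add: m_def)
  finally have "m \<le> 2 * ((b - a) * \<eta>)" by simp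
  then have "m \<le> 2 * (b - a) * \<eta>" by (simp only: mult.assoc)
  then show ?thesis using s(2)[OF \<open>t \<in> {a..b}\<close>] by (simp add: m_def)
qed

lemma real_agreement_induct:
  fixes \<alpha> \<beta> :: "real \<Rightarrow> 'z"
  assumes "0 \<le> t" "\<alpha> 0 = \<beta> 0"
    and closed: "\<And>\<tau>. 0 < \<tau> \<Longrightarrow> \<tau> \<le> t \<Longrightarrow> (\<And>s. 0 \<le> s \<Longrightarrow> s < \<tau> \<Longrightarrow> \<alpha> s = \<beta> s) \<Longrightarrow> \<alpha> \<tau> = \<beta> \<tau>"
    and opn: "\<And>\<tau>. 0 \<le> \<tau> \<Longrightarrow> \<tau> < t \<Longrightarrow> \<alpha> \<tau> = \<beta> \<tau> \<Longrightarrow>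
       \<exists>\<epsilon>>0. \<forall>s. \<tau> \<le> s \<and> s \<le> \<tau> + \<epsilon> \<and> s \<le> t \<longrightarrow> \<alpha> s = \<beta> s"
    and "0 \<le> s" "s \<le> t"
  shows "\<alpha> s = \<beta> s"
proof -
  define A where "A = {\<tau> \<in> {0..t}. \<forall>s\<in>{0..\<tau>}. \<alpha> s = \<beta> s}"
  have A0: "0 \<in> A" using assms(1,2) by (simp add: A_def)
  have bdd: "bdd_above A" by (auto simp: A_def)
  define \<tau> where "\<tau> = Sup A"
  have \<tau>: "0 \<le> \<tau>" "\<tau> \<le> t"
    unfolding \<tau>_def by (rule cSup_upper[OF A0 bdd], rule cSup_least) (use A0 in \<open>auto simp: A_def\<close>)
  have below: "\<alpha> s = \<beta> s" if s: "0 \<le> s" "s < \<tau>" for s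
  proof -
    obtain x where x: "x \<in> A" "s < x"
      using s(2) A0 bdd unfolding \<tau>_def by (metis less_cSup_iff empty_iff)
    then have "s \<in> {0..x}" using s(1) by simp
    then show ?thesis using x(1) unfolding A_def by blast
  qed
  have at: "\<alpha> \<tau> = \<beta> \<tau>"
  proof (cases "\<tau> = 0")
    case False
    with \<tau> have "0 < \<tau>" by simp
    then show ?thesis using \<tau>(2) below by (rule closed)
  qed (use assms(2) in simp)
  have "\<tau> = t"
  proof (rule ccontr)
    assume "\<tau> \<noteq> t"
    then have lt: "\<tau> < t" using \<tau> by simp
    obtain \<epsilon> where \<epsilon>: "\<epsilon> > 0" "\<And>s. \<tau> \<le> s \<Longrightarrow> s \<le> \<tau> + \<epsilon> \<Longrightarrow> s \<le> t \<Longrightarrow> \<alpha> s = \<beta> s"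
      using opn[OF \<tau>(1) lt at] by blast
    have "\<alpha> s = \<beta> s" if "s \<in> {0..min t (\<tau> + \<epsilon>)}" for s
      using that below[of s] \<epsilon>(2)[of s] by (cases "s < \<tau>") auto
    moreover have "min t (\<tau> + \<epsilon>) \<in> {0..t}" using \<tau> \<epsilon>(1) by auto
    ultimately have "min t (\<tau> + \<epsilon>) \<in> A" unfolding A_def by blast
    then have "min t (\<tau> + \<epsilon>) \<le> \<tau>" unfolding \<tau>_def by (rule cSup_upper[OF _ bdd])
    then show False using lt \<epsilon>(1) by linarith
  qed
  then show ?thesis using below[of s] at \<open>0 \<le> s\<close> \<open>s \<le> t\<close> by (cases "s < t") auto
qed

lemma picard_global:
  fixes V :: "real \<Rightarrow> 'a::euclidean_space \<Rightarrow> 'a"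
  assumes "0 \<le> T" "0 \<le> L" "T * L < 1"
    and cont: "continuous_on ({0..T} \<times> UNIV) (\<lambda>(t, q). V t q)"
    and lip: "\<And>t q q'. t \<in> {0..T} \<Longrightarrow> norm (V t q - V t q') \<le> L * norm (q - q')"
  shows "\<exists>y. y 0 = q0 \<and> (\<forall>t\<in>{0..T}. (y has_vector_derivative V t (y t)) (at t within {0..T}))"
proof -
  define cl where "cl t = max 0 (min t T)" for t
  have cl: "cl t \<in> {0..T}" "t \<in> {0..T} \<Longrightarrow> cl t = t" for t using \<open>0 \<le> T\<close> by (auto simp: cl_def)
  have cont_cl: "continuous_on A cl" for A
    unfolding cl_def by (intro continuous_intros)
  have contV: "continuous_on {0..T} (\<lambda>s. V s (y s))" if "continuous_on {0..T} y" for y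
  proof -
    have "continuous_on {0..T} (\<lambda>s. case (s, y s) of (t, q) \<Rightarrow> V t q)"
      by (rule continuous_on_compose2[OF cont]) (auto intro!: continuous_intros that)
    then show ?thesis by simp
  qed
  define G where "G y t = q0 + integral {0..cl t} (\<lambda>s. V s (y s))" for y t
  have contI: "continuous_on {0..T} (\<lambda>t. integral {0..t} (\<lambda>s. V s (y s)))" if "continuous_on {0..T} y" for y
    by (intro indefinite_integral_continuous_1 integrable_continuous_interval contV that)
  have G_bcont: "G y \<in> bcontfun" if "continuous_on {0..T} y" for y
  proof -
    have "continuous_on UNIV (G y)"
      unfolding G_def using cl
      by (intro continuous_intros continuous_on_compose2[OF contI[OF that] cont_cl]) auto
    moreover have "range (G y) \<subseteq> (\<lambda>t. q0 + integral {0..t} (\<lambda>s. V s (y s))) ` {0..T}"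
      using cl by (auto simp: G_def)
    moreover have "compact ((\<lambda>t. q0 + integral {0..t} (\<lambda>s. V s (y s))) ` {0..T})"
      by (intro compact_continuous_image continuous_intros contI that) simp
    ultimately show ?thesis
      using bounded_subset compact_imp_bounded by (auto simp: bcontfun_def)
  qed
  define F :: "(real \<Rightarrow>\<^sub>C 'a) \<Rightarrow> (real \<Rightarrow>\<^sub>C 'a)" where "F y = Bcontfun (G y)" for y
  have F: "apply_bcontfun (F y) = G y" for y
    unfolding F_def by (intro Bcontfun_inverse G_bcont continuous_on_apply_bcontfun)
  have "\<exists>!y\<in>UNIV. F y = y"
  proof (rule Banach_fix)
    show "complete (UNIV :: (real \<Rightarrow>\<^sub>C 'a) set)" by (rule complete_UNIV)
    show "0 \<le> T * L" using assms by simp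
    fix y z :: "real \<Rightarrow>\<^sub>C 'a"
    show "dist (F y) (F z) \<le> T * L * dist y z"
    proof (rule dist_bound)
      fix t
      have sub: "{0..cl t} \<subseteq> {0..T}" using cl[of t] by auto
      have int: "(\<lambda>s. V s (y s)) integrable_on {0..cl t}" for y :: "real \<Rightarrow>\<^sub>C 'a"
        using continuous_on_subset[OF contV sub]
        by (intro integrable_continuous_interval) (simp add: continuous_on_apply_bcontfun)
      have "dist (F y t) (F z t) = norm (integral {0..cl t} (\<lambda>s. V s (y s) - V s (z s)))"
        by (simp add: F G_def dist_norm integral_diff int)
      also have "\<dots> \<le> (L * dist y z) * (cl t - 0)"
      proof (rule integral_bound)
        show "0 \<le> cl t" using cl[of t] by simp
        show "continuous_on {0..cl t} (\<lambda>s. V s (y s) - V s (z s))"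
          by (intro continuous_intros continuous_on_subset[OF contV sub] continuous_on_apply_bcontfun)
        fix s assume "s \<in> {0..cl t}"
        then have "norm (V s (y s) - V s (z s)) \<le> L * norm (y s - z s)" using sub by (intro lip) auto
        also have "\<dots> \<le> L * dist y z"
          using dist_bounded[of y s z] \<open>0 \<le> L\<close> by (intro mult_left_mono) (simp_all add: dist_norm)
        finally show "norm (V s (y s) - V s (z s)) \<le> L * dist y z" .
      qed
      also have "\<dots> \<le> (L * dist y z) * T"
        using cl[of t] \<open>0 \<le> L\<close> by (intro mult_left_mono) auto
      finally show "dist (F y t) (F z t) \<le> T * L * dist y z" by (simp add: mult_ac)
    qed
  qed (use assms in auto)
  then obtain y where y: "F y = y" by blast
  have yG: "apply_bcontfun y t = q0 + integral {0..cl t} (\<lambda>s. V s (y s))" for t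
    using fun_cong[OF F[of y], of t] unfolding y G_def .
  have "(apply_bcontfun y has_vector_derivative V t (y t)) (at t within {0..T})" if t: "t \<in> {0..T}" for t
  proof -
    have "((\<lambda>u. q0 + integral {0..u} (\<lambda>s. V s (y s))) has_vector_derivative 0 + V t (y t)) (at t within {0..T})"
      by (intro has_vector_derivative_add has_vector_derivative_const integral_has_vector_derivative contV
          continuous_on_apply_bcontfun t)
    then have "((\<lambda>u. q0 + integral {0..u} (\<lambda>s. V s (y s))) has_vector_derivative V t (y t)) (at t within {0..T})"
      by simp
    then show ?thesis
    proof (rule has_vector_derivative_transform[OF t, rotated])
      show "apply_bcontfun y x = q0 + integral {0..x} (\<lambda>s. V s (y s))" if "x \<in> {0..T}" for x
        using yG[of x] unfolding cl(2)[OF that] .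
    qed
  qed
  moreover have "cl 0 = 0" using cl(2) \<open>0 \<le> T\<close> by simp
  then have "apply_bcontfun y 0 = q0" by (subst yG) simp
  ultimately show ?thesis by blast
qed

lemma linear_cauchy_problem:
  fixes A :: "real \<Rightarrow> 'a::euclidean_space \<Rightarrow> 'a"
  assumes "0 \<le> T" "0 \<le> L" "T * L \<le> 1/4"
    and lin: "\<And>t. t \<in> {0..T} \<Longrightarrow> bounded_linear (A t)"
    and bd: "\<And>t w. t \<in> {0..T} \<Longrightarrow> norm (A t w) \<le> L * norm w"
    and cont: "\<And>w. continuous_on {0..T} (\<lambda>t. A t w)"
  shows "\<exists>J. (\<forall>t. bounded_linear (J t)) \<and> (\<forall>w. J 0 w = w) \<and>
     (\<forall>t\<in>{0..T}. (\<forall>w. norm w \<le> 2 * norm (J t w)) \<and> (\<forall>w. ((\<lambda>s. J s w) has_vector_derivative A t (J t w)) (at t within {0..T})))"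
proof -
  have Asum: "A t w = (\<Sum>b\<in>Basis. (w \<bullet> b) *\<^sub>R A t b)" if "t \<in> {0..T}" for t w
  proof -
    interpret bounded_linear "A t" using lin[OF that] .
    have "A t w = A t (\<Sum>b\<in>Basis. (w \<bullet> b) *\<^sub>R b)" by (simp add: euclidean_representation)
    then show ?thesis by (simp add: sum scaleR)
  qed
  have contA: "continuous_on ({0..T} \<times> UNIV) (\<lambda>(t, w). A t w)"
  proof -
    have "continuous_on ({0..T} \<times> UNIV) (\<lambda>z. \<Sum>b\<in>Basis. (snd z \<bullet> b) *\<^sub>R A (fst z) b)"
      by (intro continuous_intros continuous_on_compose2[OF cont]) auto
    then show ?thesis
      by (rule continuous_on_eq) (auto simp: Asum)
  qed
  have "T * L < 1" using assms by simp
  moreover have "norm (A t q - A t q') \<le> L * norm (q - q')" if "t \<in> {0..T}" for t q q'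
    using bd[OF that, of "q - q'"] by (simp add: bounded_linear.linear[OF lin[OF that]] linear_diff)
  ultimately have "\<exists>y. y 0 = b \<and> (\<forall>t\<in>{0..T}. (y has_vector_derivative A t (y t)) (at t within {0..T}))" for b
    using picard_global[OF \<open>0 \<le> T\<close> \<open>0 \<le> L\<close> _ contA] by blast
  then obtain j where j: "\<And>b. j b 0 = b"
    "\<And>b t. t \<in> {0..T} \<Longrightarrow> (j b has_vector_derivative A t (j b t)) (at t within {0..T})" by metis
  define J where "J t w = (\<Sum>b\<in>Basis. (w \<bullet> b) *\<^sub>R j b t)" for t w
  have linJ: "bounded_linear (J t)" for t
    unfolding J_def by (intro bounded_linear_sum bounded_linear_scaleR_const bounded_linear_inner_left)
  have J0: "J 0 w = w" for w by (simp add: J_def j euclidean_representation)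
  have dJ: "((\<lambda>s. J s w) has_vector_derivative A t (J t w)) (at t within {0..T})" if t: "t \<in> {0..T}" for t w
  proof -
    have "((\<lambda>s. J s w) has_vector_derivative (\<Sum>b\<in>Basis. (w \<bullet> b) *\<^sub>R A t (j b t))) (at t within {0..T})"
      unfolding J_def
      by (intro has_vector_derivative_sum bounded_linear.has_vector_derivative[OF bounded_linear_scaleR_right] j t)
    moreover have "A t (J t w) = (\<Sum>b\<in>Basis. (w \<bullet> b) *\<^sub>R A t (j b t))"
      unfolding J_def using bounded_linear.linear[OF lin[OF t]] by (simp add: linear_sum linear_cmul)
    ultimately show ?thesis by simp
  qed
  have "norm w \<le> 2 * norm (J t w)" if t: "t \<in> {0..T}" for t w
  proof -
    have "norm (J t w - w) \<le> 2 * (T - 0) * (L * norm w)"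
    proof (rule small_time_bound[where e' = "\<lambda>t. A t (J t w)" and L = L])
      fix t assume t: "t \<in> {0..T}"
      show "((\<lambda>t. J t w - w) has_vector_derivative A t (J t w)) (at t within {0..T})"
        using has_vector_derivative_diff[OF dJ[OF t] has_vector_derivative_const[of w]] by simp
      have "norm (J t w) \<le> norm (J t w - w) + norm w" using norm_triangle_sub by (simp add: add.commute)
      from order_trans[OF bd[OF t] mult_left_mono[OF this \<open>0 \<le> L\<close>]]
      show "norm (A t (J t w)) \<le> L * norm (J t w - w) + L * norm w" by (simp add: distrib_left)
    qed (use assms t J0 in auto)
    also have "\<dots> = 2 * (T * L) * norm w" by simp
    also have "\<dots> \<le> 2 * (1/4) * norm w" using assms by (intro mult_right_mono) auto
    finally have "norm (w - J t w) \<le> 1/2 * norm w" by (simp add: norm_minus_commute)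
    then show ?thesis using norm_triangle_sub[of w "J t w"] by simp
  qed
  then show ?thesis using linJ J0 dJ by blast
qed

lemma local_flow:
  fixes V :: "real \<Rightarrow> 'a::euclidean_space \<Rightarrow> 'a" and A :: "real \<Rightarrow> 'a \<Rightarrow> 'a \<Rightarrow> 'a"
  assumes "0 < R" "0 < \<delta>" "0 \<le> L"
    and cont: "continuous_on ({0..\<delta>} \<times> cball q0 R) (\<lambda>(t, q). V t q)"
    and lip: "\<And>t q q'. t \<in> {0..\<delta>} \<Longrightarrow> q \<in> cball q0 R \<Longrightarrow> q' \<in> cball q0 R \<Longrightarrow>
       norm (V t q - V t q') \<le> L * norm (q - q')"
    and diff: "\<And>\<omega>. 0 < \<omega> \<Longrightarrow> \<exists>\<rho>>0. \<forall>t\<in>{0..\<delta>}. \<forall>q\<in>cball q0 R. \<forall>q'\<in>cball q0 R. dist q q' < \<rho> \<longrightarrow>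
       norm (V t q' - V t q - A t q (q' - q)) \<le> \<omega> * norm (q' - q)"
    and linA: "\<And>t q. t \<in> {0..\<delta>} \<Longrightarrow> q \<in> cball q0 R \<Longrightarrow> bounded_linear (A t q)"
    and bdA: "\<And>t q w. t \<in> {0..\<delta>} \<Longrightarrow> q \<in> cball q0 R \<Longrightarrow> norm (A t q w) \<le> L * norm w"
    and contA: "\<And>w. continuous_on ({0..\<delta>} \<times> cball q0 R) (\<lambda>(t, q). A t q w)"
  obtains T \<epsilon> \<phi> J where "0 < T" "T \<le> \<delta>" "0 < \<epsilon>"
    "\<And>q. q \<in> ball q0 \<epsilon> \<Longrightarrow> \<phi> 0 q = q"
    "\<And>q t. q \<in> ball q0 \<epsilon> \<Longrightarrow> t \<in> {0..T} \<Longrightarrow> \<phi> t q \<in> cball q0 R"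
    "\<And>q t. q \<in> ball q0 \<epsilon> \<Longrightarrow> t \<in> {0..T} \<Longrightarrow>
       ((\<lambda>s. \<phi> s q) has_vector_derivative V t (\<phi> t q)) (at t within {0..T})"
    "\<And>t. bounded_linear (J t)" "\<And>w. J 0 w = w"
    "\<And>t w. t \<in> {0..T} \<Longrightarrow> norm w \<le> 2 * norm (J t w)"
    "\<And>t. t \<in> {0..T} \<Longrightarrow> (\<phi> t has_derivative J t) (at q0)"
    "\<And>t w. t \<in> {0..T} \<Longrightarrow> ((\<lambda>s. J s w) has_vector_derivative A t (\<phi> t q0) (J t w)) (at t within {0..T})"
proof -
  have "compact ((\<lambda>(t, q). V t q) ` ({0..\<delta>} \<times> cball q0 R))"
    by (intro compact_continuous_image cont compact_Times) auto
  then obtain B where "B > 0" and B: "\<And>t q. t \<in> {0..\<delta>} \<Longrightarrow> q \<in> cball q0 R \<Longrightarrow> norm (V t q) \<le> B"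
    using compact_imp_bounded bounded_pos by (metis (mono_tags, lifting) SigmaI case_prod_conv imageI)
  define T where "T = min \<delta> (min (1 / (4 * (L + 1))) (R / (4 * B)))"
  have T: "0 < T" "T \<le> \<delta>" using assms \<open>B > 0\<close> by (auto simp: T_def)
  have TL: "T * L \<le> 1/4"
  proof -
    have "T * L \<le> T * (L + 1)" using T by simp
    also have "\<dots> \<le> 1 / (4 * (L + 1)) * (L + 1)" using assms by (intro mult_right_mono) (auto simp: T_def)
    also have "\<dots> = 1/4" using \<open>0 \<le> L\<close> by simp
    finally show ?thesis .
  qed
  have TB: "2 * T * B \<le> R / 2"
  proof -
    have "T * B \<le> R / (4 * B) * B" using \<open>B > 0\<close> by (intro mult_right_mono) (auto simp: T_def)
    then show ?thesis using \<open>B > 0\<close> by simp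
  qed
  have in\<delta>: "t \<in> {0..\<delta>}" if "t \<in> {0..T}" for t using that T by auto
  let ?cp = "closest_point (cball q0 R)"
  have cp: "?cp q \<in> cball q0 R" "q \<in> cball q0 R \<Longrightarrow> ?cp q = q" "norm (?cp q - ?cp q') \<le> norm (q - q')" for q q'
    using closest_point_in_set[of "cball q0 R" q] closest_point_self[of q "cball q0 R"]
      closest_point_lipschitz[of "cball q0 R" q q'] \<open>0 < R\<close> by (auto simp: dist_norm)
  have "\<exists>y. y 0 = q \<and> (\<forall>t\<in>{0..T}. (y has_vector_derivative V t (?cp (y t))) (at t within {0..T}))" for q
  proof (rule picard_global[where L = L])
    have "continuous_on ({0..T} \<times> UNIV) (\<lambda>z. case (fst z, ?cp (snd z)) of (t, q) \<Rightarrow> V t q)"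
      using in\<delta> cp(1) \<open>0 < R\<close>
      by (intro continuous_on_compose2[OF cont] continuous_on_Pair continuous_on_fst continuous_on_snd
          continuous_on_compose2[OF continuous_on_closest_point[of "cball q0 R" UNIV]] continuous_on_id) auto
    then show "continuous_on ({0..T} \<times> UNIV) (\<lambda>(t, q). V t (?cp q))"
      by (simp add: case_prod_beta)
    fix t q q' assume "t \<in> {0..T}"
    then have "norm (V t (?cp q) - V t (?cp q')) \<le> L * norm (?cp q - ?cp q')"
      by (intro lip in\<delta> cp)
    also have "\<dots> \<le> L * norm (q - q')" using cp(3) \<open>0 \<le> L\<close> by (intro mult_left_mono)
    finally show "norm (V t (?cp q) - V t (?cp q')) \<le> L * norm (q - q')" .
  qed (use T TL \<open>0 \<le> L\<close> in auto)
  then obtain y where y0: "\<And>q. y q 0 = q" and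
    y': "\<And>q t. t \<in> {0..T} \<Longrightarrow> (y q has_vector_derivative V t (?cp (y q t))) (at t within {0..T})"
    by metis
  have y_in: "y q t \<in> cball q0 R" if q: "q \<in> ball q0 (R/2)" and t: "t \<in> {0..T}" for q t
  proof -
    have "norm (y q t - q) \<le> 2 * (T - 0) * B"
    proof (rule small_time_bound[where L = 0 and e' = "\<lambda>t. V t (?cp (y q t))"])
      fix t assume t: "t \<in> {0..T}"
      show "((\<lambda>t. y q t - q) has_vector_derivative V t (?cp (y q t))) (at t within {0..T})"
        using has_vector_derivative_diff[OF y'[OF t] has_vector_derivative_const[of q]] by simp
      show "norm (V t (?cp (y q t))) \<le> 0 * norm (y q t - q) + B" using B[OF in\<delta>[OF t] cp(1)] by simp
    qed (use T y0 t in auto)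
    then have "norm (y q t - q) \<le> R / 2" using TB by simp
    then have "dist q0 (y q t) \<le> R/2 + R/2"
      using q dist_triangle[of q0 "y q t" q] by (simp add: dist_norm norm_minus_commute)
    then show ?thesis by simp
  qed
  have dy: "(y q has_vector_derivative V t (y q t)) (at t within {0..T})"
    if "q \<in> ball q0 (R/2)" "t \<in> {0..T}" for q t
    using y'[OF that(2), of q] cp(2)[OF y_in[OF that]] by simp
  have q0: "q0 \<in> ball q0 (R/2)" using \<open>0 < R\<close> by simp
  have cont_y0: "continuous_on {0..T} (y q0)"
    by (rule continuous_on_vector_derivative) (rule dy[OF q0])
  have contA0: "continuous_on {0..T} (\<lambda>t. A t (y q0 t) w)" for w
  proof -
    have "continuous_on {0..T} (\<lambda>t. case (t, y q0 t) of (t, q) \<Rightarrow> A t q w)"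
      using in\<delta> y_in[OF q0]
      by (intro continuous_on_compose2[OF contA] continuous_on_Pair cont_y0 continuous_on_id) auto
    then show ?thesis by simp
  qed
  obtain J where J: "\<And>t. bounded_linear (J t)" "\<And>w. J 0 w = w" "\<And>t w. t \<in> {0..T} \<Longrightarrow> norm w \<le> 2 * norm (J t w)"
    "\<And>t w. t \<in> {0..T} \<Longrightarrow> ((\<lambda>s. J s w) has_vector_derivative A t (y q0 t) (J t w)) (at t within {0..T})"
  proof -
    have "0 \<le> T" using T by simp
    from linear_cauchy_problem[of T L "\<lambda>t. A t (y q0 t)", OF this \<open>0 \<le> L\<close> TL
        linA[OF in\<delta> y_in[OF q0]] bdA[OF in\<delta> y_in[OF q0]] contA0]
    show ?thesis using that by blast
  qed
  have lip_y: "norm (y q t - y q0 t) \<le> 2 * norm (q - q0)" if q: "q \<in> ball q0 (R/2)" and t: "t \<in> {0..T}" for q t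
  proof -
    have "norm (y q t - y q0 t - (q - q0)) \<le> 2 * (T - 0) * (L * norm (q - q0))"
    proof (rule small_time_bound[where L = L and e' = "\<lambda>t. V t (y q t) - V t (y q0 t)"])
      fix t assume t: "t \<in> {0..T}"
      show "((\<lambda>t. y q t - y q0 t - (q - q0)) has_vector_derivative V t (y q t) - V t (y q0 t)) (at t within {0..T})"
        using has_vector_derivative_diff[OF has_vector_derivative_diff[OF dy[OF q t] dy[OF q0 t]]
            has_vector_derivative_const[of "q - q0"]] by simp
      have "norm (V t (y q t) - V t (y q0 t)) \<le> L * norm (y q t - y q0 t)"
        by (intro lip in\<delta> t y_in q q0)
      also have "\<dots> \<le> L * (norm (y q t - y q0 t - (q - q0)) + norm (q - q0))"
        using norm_triangle_sub[of "y q t - y q0 t" "q - q0"] \<open>0 \<le> L\<close>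
        by (intro mult_left_mono) (simp_all add: add.commute)
      finally show "norm (V t (y q t) - V t (y q0 t)) \<le> L * norm (y q t - y q0 t - (q - q0)) + L * norm (q - q0)"
        by (simp add: distrib_left)
    qed (use T TL \<open>0 \<le> L\<close> y0 t in auto)
    also have "\<dots> = 2 * (T * L) * norm (q - q0)" by simp
    also have "\<dots> \<le> 2 * (1/4) * norm (q - q0)" using TL by (intro mult_right_mono) auto
    finally have "norm (y q t - y q0 t) \<le> norm (q - q0) + 1/2 * norm (q - q0)"
      using norm_triangle_sub[of "y q t - y q0 t" "q - q0"] by simp
    then show ?thesis using norm_ge_zero[of "q - q0"] by linarith
  qed
  have deriv: "((\<lambda>q. y q t) has_derivative J t) (at q0)" if t: "t \<in> {0..T}" for t
  proof -
    have "\<exists>d>0. \<forall>q. norm (q - q0) < d \<longrightarrow> norm (y q t - y q0 t - J t (q - q0)) \<le> e * norm (q - q0)" if "e > 0" for e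
    proof -
      define \<omega> where "\<omega> = e / (4 * T)"
      have \<omega>: "\<omega> > 0" using \<open>e > 0\<close> T by (simp add: \<omega>_def)
      obtain \<rho> where \<rho>: "\<rho> > 0" "\<And>t q q'. t \<in> {0..\<delta>} \<Longrightarrow> q \<in> cball q0 R \<Longrightarrow> q' \<in> cball q0 R \<Longrightarrow> dist q q' < \<rho> \<Longrightarrow>
          norm (V t q' - V t q - A t q (q' - q)) \<le> \<omega> * norm (q' - q)" using diff[OF \<omega>] by blast
      have "norm (y q t - y q0 t - J t (q - q0)) \<le> e * norm (q - q0)" if d: "norm (q - q0) < min (R/2) (\<rho>/2)" for q
      proof -
        have q: "q \<in> ball q0 (R/2)" using d by (simp add: dist_norm norm_minus_commute)
        have "norm (y q t - y q0 t - J t (q - q0)) \<le> 2 * (T - 0) * (\<omega> * (2 * norm (q - q0)))"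
        proof (rule small_time_bound[where L = L and e' = "\<lambda>t. V t (y q t) - V t (y q0 t) - A t (y q0 t) (J t (q - q0))"])
          fix t assume t: "t \<in> {0..T}"
          show "((\<lambda>t. y q t - y q0 t - J t (q - q0)) has_vector_derivative
            V t (y q t) - V t (y q0 t) - A t (y q0 t) (J t (q - q0))) (at t within {0..T})"
            by (intro has_vector_derivative_diff dy q q0 t J)
          let ?A = "A t (y q0 t)" and ?d = "y q t - y q0 t"
          have A: "bounded_linear ?A" by (intro linA in\<delta> t y_in q0)
          have "V t (y q t) - V t (y q0 t) - ?A (J t (q - q0)) =
              (V t (y q t) - V t (y q0 t) - ?A ?d) + ?A (?d - J t (q - q0))"
            by (simp add: linear_diff[OF bounded_linear.linear[OF A]])
          then have "norm (V t (y q t) - V t (y q0 t) - ?A (J t (q - q0)))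
             \<le> norm (V t (y q t) - V t (y q0 t) - ?A ?d) + norm (?A (?d - J t (q - q0)))"
            by (metis norm_triangle_ineq)
          also have "norm (?A (?d - J t (q - q0))) \<le> L * norm (?d - J t (q - q0))"
            by (intro bdA in\<delta> t y_in q0)
          also have "norm (V t (y q t) - V t (y q0 t) - ?A ?d) \<le> \<omega> * norm ?d"
          proof (intro \<rho>(2) in\<delta> t y_in q q0)
            show "dist (y q0 t) (y q t) < \<rho>" using lip_y[OF q t] d by (simp add: dist_norm norm_minus_commute)
          qed
          also have "\<omega> * norm ?d \<le> \<omega> * (2 * norm (q - q0))"
            using lip_y[OF q t] \<omega> by (intro mult_left_mono) auto
          finally show "norm (V t (y q t) - V t (y q0 t) - ?A (J t (q - q0))) \<le>
            L * norm (?d - J t (q - q0)) + \<omega> * (2 * norm (q - q0))" by simp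
        qed (use T TL \<open>0 \<le> L\<close> y0 t J(2) in auto)
        also have "\<dots> = e * norm (q - q0)" using T by (simp add: \<omega>_def)
        finally show ?thesis .
      qed
      then show ?thesis using \<rho>(1) \<open>0 < R\<close> by (intro exI[of _ "min (R/2) (\<rho>/2)"]) auto
    qed
    then show ?thesis by (simp add: has_derivative_at_alt J(1))
  qed
  show ?thesis
  proof (rule that[of T "R/2" "\<lambda>t q. y q t" J])
  qed (use T \<open>0 < R\<close> y0 y_in dy J deriv in auto)
qed

section \<open>Charts, tangent and cotangent spaces\<close>

locale chart_of =
  fixes N :: "'z topology" and c :: "('z, 'f::euclidean_space) chart"
  assumes chart: "is_chart N c"
begin

lemma dom_open: "openin N (cdom c)" and im_open: "open (cmap c ` cdom c)"
  using chart by (auto simp: is_chart_def)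

lemma dom_sub: "cdom c \<subseteq> topspace N" using dom_open by (rule openin_subset)

lemma topspace_dom: "topspace (subtopology N (cdom c)) = cdom c"
  using dom_sub by auto

lemma inj: "inj_on (cmap c) (cdom c)"
  using chart homeomorphic_imp_injective_map topspace_dom unfolding is_chart_def by metis

lemma cinv_cmap: "x \<in> cdom c \<Longrightarrow> cinv c (cmap c x) = x"
  by (rule inv_into_f_f[OF inj])

lemma cmap_cinv: "q \<in> cmap c ` cdom c \<Longrightarrow> cmap c (cinv c q) = q"
  by (rule f_inv_into_f)

lemma cinv_dom: "q \<in> cmap c ` cdom c \<Longrightarrow> cinv c q \<in> cdom c"
  by (rule inv_into_into)

lemma cont: "continuous_map (subtopology N (cdom c)) euclidean (cmap c)"
  using chart homeomorphic_imp_continuous_map continuous_map_into_fulltopology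
  unfolding is_chart_def by blast

lemma open_image: "openin N V \<Longrightarrow> V \<subseteq> cdom c \<Longrightarrow> open (cmap c ` V)"
  using homeomorphic_map_openness[of "subtopology N (cdom c)" "top_of_set (cmap c ` cdom c)" "cmap c" V]
    chart im_open dom_open topspace_dom
  by (auto simp: is_chart_def openin_open_subtopology openin_open_eq)

lemma open_preimage: "open W \<Longrightarrow> openin N {x \<in> cdom c. cmap c x \<in> W}"
  using openin_continuous_map_preimage[OF cont, of W] dom_open
  unfolding topspace_dom by (simp add: openin_open_subtopology)

lemma cinv_cont: "continuous_map (top_of_set (cmap c ` cdom c)) N (cinv c)"
proof -
  have "continuous_map (top_of_set (cmap c ` cdom c)) (subtopology N (cdom c)) (cinv c)"
  proof (subst continuous_map_def, intro conjI allI impI)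
    show "cinv c \<in> topspace (top_of_set (cmap c ` cdom c)) \<rightarrow> topspace (subtopology N (cdom c))"
      using cinv_dom topspace_dom by auto
    fix U assume "openin (subtopology N (cdom c)) U"
    then have U: "openin N U" "U \<subseteq> cdom c" using dom_open by (auto simp: openin_open_subtopology)
    have "{x \<in> topspace (top_of_set (cmap c ` cdom c)). cinv c x \<in> U} = cmap c ` U"
      using U(2) cinv_cmap by auto
    then show "openin (top_of_set (cmap c ` cdom c)) {x \<in> topspace (top_of_set (cmap c ` cdom c)). cinv c x \<in> U}"
      using open_image[OF U] U(2) im_open by (auto simp: openin_open_eq)
  qed
  then show ?thesis using continuous_map_into_fulltopology by blast
qed

end

locale smooth_mfd =
  fixes M :: "('a, 'e::euclidean_space) mfd"
  assumes mfd: "smooth_manifold M"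
begin

lemma chartD: "c \<in> atlas M \<Longrightarrow> chart_of (mtop M) c"
  using mfd by (simp add: smooth_manifold_def chart_of_def)

lemma Hausdorff: "Hausdorff_space (mtop M)" using mfd by (simp add: smooth_manifold_def)

lemma charts_atD: "c \<in> charts_at M x \<Longrightarrow> c \<in> atlas M \<and> x \<in> cdom c"
  by (simp add: charts_at_def)

lemma charts_at_nonempty: "x \<in> mcarrier M \<Longrightarrow> \<exists>c. c \<in> charts_at M x"
  using mfd unfolding smooth_manifold_def charts_at_def by blast

lemma overlap_open: "c \<in> atlas M \<Longrightarrow> d \<in> atlas M \<Longrightarrow> open (cmap c ` (cdom c \<inter> cdom d))"
  by (intro chart_of.open_image[OF chartD] openin_Int chart_of.dom_open chartD) auto

lemma transition_smooth:
  "c \<in> atlas M \<Longrightarrow> d \<in> atlas M \<Longrightarrow> smooth_on (cmap c ` (cdom c \<inter> cdom d)) (cmap d \<circ> cinv c)"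
  using mfd by (simp add: smooth_manifold_def)

abbreviation trans where "trans c d x \<equiv> frechet_derivative (cmap d \<circ> cinv c) (at (cmap c x))"

lemma trans_has_derivative:
  assumes "c \<in> charts_at M x" "d \<in> charts_at M x"
  shows "((cmap d \<circ> cinv c) has_derivative trans c d x) (at (cmap c x))"
  using assms charts_atD by (intro smooth_on_has_derivative[OF transition_smooth[of c d]]) auto

lemma trans_linear: "c \<in> charts_at M x \<Longrightarrow> d \<in> charts_at M x \<Longrightarrow> linear (trans c d x)"
  using has_derivative_linear[OF trans_has_derivative] by blast

lemma trans_self: "c \<in> charts_at M x \<Longrightarrow> trans c c x = id"
proof -
  assume c: "c \<in> charts_at M x"
  interpret C: chart_of "mtop M" c using c charts_atD chartD by blast
  have "frechet_derivative (cmap c \<circ> cinv c) (at (cmap c x)) = frechet_derivative id (at (cmap c x))"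
    by (rule frechet_derivative_cong_open[OF C.im_open]) (use c charts_atD C.cmap_cinv in auto)
  then show ?thesis by (simp add: frechet_eq[OF has_derivative_id])
qed

lemma trans_trans:
  assumes c: "c \<in> charts_at M x" and d: "d \<in> charts_at M x" and e: "e \<in> charts_at M x"
  shows "trans d e x (trans c d x w) = trans c e x w"
proof -
  interpret C: chart_of "mtop M" c using c charts_atD chartD by blast
  interpret D: chart_of "mtop M" d using d charts_atD chartD by blast
  interpret E: chart_of "mtop M" e using e charts_atD chartD by blast
  have x: "x \<in> cdom c" "x \<in> cdom d" using c d charts_atD by auto
  have eq: "(cmap d \<circ> cinv c) (cmap c x) = cmap d x" by (simp add: C.cinv_cmap x)
  have "((cmap e \<circ> cinv d) \<circ> (cmap d \<circ> cinv c) has_derivative trans d e x \<circ> trans c d x) (at (cmap c x))"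
    using trans_has_derivative[OF c d] trans_has_derivative[OF d e] eq
    by (intro diff_chain_at) auto
  then have "((cmap e \<circ> cinv c) has_derivative trans d e x \<circ> trans c d x) (at (cmap c x))"
  proof (rule has_derivative_transform_within_open)
    show "open (cmap c ` (cdom c \<inter> cdom d))" using c d by (intro overlap_open) (auto simp: charts_at_def)
    fix q assume "q \<in> cmap c ` (cdom c \<inter> cdom d)"
    then show "((cmap e \<circ> cinv d) \<circ> (cmap d \<circ> cinv c)) q = (cmap e \<circ> cinv c) q"
      by (auto simp: C.cinv_cmap D.cinv_cmap)
  qed (use x in auto)
  from frechet_eq[OF this] show ?thesis by (simp add: fun_eq_iff)
qed

lemma coord_vec_tangent: "c \<in> charts_at M x \<Longrightarrow> coord_vec M c x w \<in> tangent_space M x"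
  by (auto simp: tangent_space_def coord_vec_def trans_trans)

lemma coord_vec_nth: "c \<in> charts_at M x \<Longrightarrow> coord_vec M c x w c = w"
  unfolding coord_vec_def by (simp only: trans_self if_True id_apply)

lemma tangent_coord_vec: "v \<in> tangent_space M x \<Longrightarrow> c \<in> charts_at M x \<Longrightarrow> v = coord_vec M c x (v c)"
proof (rule ext)
  fix d assume v: "v \<in> tangent_space M x" and c: "c \<in> charts_at M x"
  show "v d = coord_vec M c x (v c) d"
  proof (cases "d \<in> charts_at M x")
    case True
    then have "v d = trans c d x (v c)" using v c unfolding tangent_space_def by blast
    then show ?thesis using True by (simp only: coord_vec_def if_True)
  next
    case False
    then have "v d = 0" using v unfolding tangent_space_def by blast
    then show ?thesis using False by (simp only: coord_vec_def if_False)
  qed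
qed

lemma tangent_eqI:
  "v \<in> tangent_space M x \<Longrightarrow> w \<in> tangent_space M x \<Longrightarrow> c \<in> charts_at M x \<Longrightarrow> v c = w c \<Longrightarrow> v = w"
  using tangent_coord_vec[of v x c] tangent_coord_vec[of w x c] by simp

lemma coord_vec_add: "c \<in> charts_at M x \<Longrightarrow> coord_vec M c x (v + w) = coord_vec M c x v + coord_vec M c x w"
  by (rule ext) (simp add: coord_vec_def linear_add[OF trans_linear])

lemma coord_vec_scale: "c \<in> charts_at M x \<Longrightarrow> coord_vec M c x (s *\<^sub>R v) = s *\<^sub>R coord_vec M c x v"
  by (rule ext) (simp add: coord_vec_def linear_cmul[OF trans_linear] scaleR_fun_def)

lemma coord_vec_linear: "c \<in> charts_at M x \<Longrightarrow> linear (coord_vec M c x)"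
  by (rule linearI) (auto simp: coord_vec_add coord_vec_scale)

lemma tangent_space_range: "c \<in> charts_at M x \<Longrightarrow> tangent_space M x = range (coord_vec M c x)"
  using coord_vec_tangent tangent_coord_vec by blast

lemma tangent_subspace: "c \<in> charts_at M x \<Longrightarrow> subspace (tangent_space M x)"
  by (metis tangent_space_range coord_vec_linear linear_subspace_image subspace_UNIV)

lemma span_tangent_iff:
  assumes c: "c \<in> charts_at M x" and A: "A \<subseteq> tangent_space M x"
  shows "span A = tangent_space M x \<longleftrightarrow> span ((\<lambda>v. v c) ` A) = UNIV"
proof -
  have A': "A = coord_vec M c x ` (\<lambda>v. v c) ` A"
    using A tangent_coord_vec[OF _ c] by (force simp: image_image)
  have sp: "span A = coord_vec M c x ` span ((\<lambda>v. v c) ` A)"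
    by (subst A') (rule linear_span_image[OF coord_vec_linear[OF c]])
  have inj: "inj (coord_vec M c x)" by (metis injI coord_vec_nth c)
  show ?thesis unfolding sp tangent_space_range[OF c] using inj by (simp add: inj_image_eq_iff)
qed

end

lemma openin_mfd_of_charts:
  "c \<in> A \<Longrightarrow> open W \<Longrightarrow> openin (mtop (mfd_of_charts A)) (cdom c \<inter> cmap c -` W)"
  unfolding mfd_of_charts_def mfd.select_convs by (rule topology_generated_by_Basis) blast

lemma atlas_mfd_of_charts: "atlas (mfd_of_charts A) = A"
  by (simp add: mfd_of_charts_def)

lemma carrier_mfd_of_charts: "mcarrier (mfd_of_charts A) = (\<Union>c\<in>A. cdom c)"
proof -
  have "mcarrier (mfd_of_charts A) = \<Union>{cdom c \<inter> cmap c -` W |c W. c \<in> A \<and> open W}"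
    by (simp add: mfd_of_charts_def topology_generated_by_topspace)
  also have "\<dots> = (\<Union>c\<in>A. cdom c)"
  proof (intro equalityI subsetI)
    fix x assume "x \<in> (\<Union>c\<in>A. cdom c)"
    then obtain c where "c \<in> A" "x \<in> cdom c \<inter> cmap c -` UNIV" by auto
    then show "x \<in> \<Union>{cdom c \<inter> cmap c -` W |c W. c \<in> A \<and> open W}" by blast
  qed blast
  finally show ?thesis .
qed

context smooth_mfd
begin

definition covec_of :: "('a, 'e) chart \<Rightarrow> 'a \<Rightarrow> 'e \<Rightarrow> ('a, 'e) covec" where
  "covec_of c x p v = (if v \<in> tangent_space M x then v c \<bullet> p else 0)"

definition covec_coord :: "('a, 'e) chart \<Rightarrow> 'a \<Rightarrow> ('a, 'e) covec \<Rightarrow> 'e" where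
  "covec_coord c x l = (\<Sum>b\<in>Basis. l (coord_vec M c x b) *\<^sub>R b)"

lemma covec_of_cotangent: "c \<in> charts_at M x \<Longrightarrow> covec_of c x p \<in> cotangent_space M x"
  using subspace_add[OF tangent_subspace] subspace_mul[OF tangent_subspace]
  by (auto simp: cotangent_space_def covec_of_def inner_add_left scaleR_fun_def)

lemma covec_coord_of: "c \<in> charts_at M x \<Longrightarrow> covec_coord c x (covec_of c x p) = p"
  using euclidean_representation[of p]
  by (simp only: covec_coord_def covec_of_def coord_vec_tangent coord_vec_nth if_True inner_commute[of p])

lemma covec_apply:
  assumes l: "l \<in> cotangent_space M x" and c: "c \<in> charts_at M x" and v: "v \<in> tangent_space M x"
  shows "l v = v c \<bullet> covec_coord c x l"
proof -
  have add: "l (v + w) = l v + l w" if "v \<in> tangent_space M x" "w \<in> tangent_space M x" for v w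
    using l that by (simp add: cotangent_space_def)
  have scale: "l (s *\<^sub>R v) = s * l v" if "v \<in> tangent_space M x" for s v
    using l that by (simp add: cotangent_space_def)
  have "linear (\<lambda>w. l (coord_vec M c x w))"
    by (rule linearI) (simp_all add: coord_vec_add coord_vec_scale c add scale coord_vec_tangent)
  then interpret lin: linear "\<lambda>w. l (coord_vec M c x w)" .
  have "l v = l (coord_vec M c x (\<Sum>b\<in>Basis. (v c \<bullet> b) *\<^sub>R b))"
    using tangent_coord_vec[OF v c] by (simp add: euclidean_representation)
  also have "\<dots> = (\<Sum>b\<in>Basis. (v c \<bullet> b) * l (coord_vec M c x b))"
    by (simp add: lin.sum lin.scale)
  finally show ?thesis by (simp add: covec_coord_def inner_sum_right mult.commute)
qed

lemma covec_of_coord: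
  assumes l: "l \<in> cotangent_space M x" and c: "c \<in> charts_at M x"
  shows "covec_of c x (covec_coord c x l) = l"
proof
  fix v
  show "covec_of c x (covec_coord c x l) v = l v"
  proof (cases "v \<in> tangent_space M x")
    case True
    then show ?thesis using covec_apply[OF l c True] by (simp add: covec_of_def)
  next
    case False
    then have "l v = 0" using l unfolding cotangent_space_def by blast
    then show ?thesis using False by (simp add: covec_of_def)
  qed
qed

abbreviation "ct c \<equiv> cotangent_chart M c"

lemma ct_dom: "cdom (ct c) = Sigma (cdom c) (cotangent_space M)"
  and ct_map: "cmap (ct c) (x, l) = (cmap c x, covec_coord c x l)"
  by (simp_all add: cotangent_chart_def covec_coord_def)

lemma ct_atlas: "atlas (cotangent_bundle M) = ct ` atlas M"
  by (simp add: cotangent_bundle_def atlas_mfd_of_charts)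

lemma ct_inj:
  assumes "c \<in> atlas M"
  shows "inj_on (cmap (ct c)) (cdom (ct c))"
proof (rule inj_onI)
  interpret C: chart_of "mtop M" c using chartD[OF assms] .
  fix z z' assume z: "z \<in> cdom (ct c)" "z' \<in> cdom (ct c)" "cmap (ct c) z = cmap (ct c) z'"
  obtain x l where zz1: "z = (x, l)" by (cases z)
  obtain x' l' where zz2: "z' = (x', l')" by (cases z')
  note zz = zz1 zz2
  have x: "x \<in> cdom c" "x' \<in> cdom c" "l \<in> cotangent_space M x" "l' \<in> cotangent_space M x'"
    using z zz by (auto simp: ct_dom)
  have "cmap c x = cmap c x'" "covec_coord c x l = covec_coord c x' l'" using z zz by (auto simp: ct_map)
  then have xx: "x = x'" using inj_onD[OF C.inj _ x(1,2)] by blast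
  have ch: "c \<in> charts_at M x" using x(1) assms by (simp add: charts_at_def)
  have "covec_of c x (covec_coord c x l) = covec_of c x (covec_coord c x l')"
    using \<open>covec_coord c x l = covec_coord c x' l'\<close> xx by simp
  then have "l = l'" using covec_of_coord[OF x(3) ch] covec_of_coord[OF _ ch, of l'] x(4) xx by simp
  with \<open>x = x'\<close> show "z = z'" by (simp add: zz)
qed

lemma ct_preimage:
  assumes "c \<in> atlas M" "open W"
  shows "openin (mtop (cotangent_bundle M)) {z \<in> cdom (ct c). cmap (ct c) z \<in> W}"
proof -
  have "{z \<in> cdom (ct c). cmap (ct c) z \<in> W} = cdom (ct c) \<inter> cmap (ct c) -` W" by auto
  then show ?thesis
    using assms by (simp add: cotangent_bundle_def openin_mfd_of_charts)
qed

lemma ct_cinv: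
  assumes "c \<in> atlas M" "q \<in> cmap c ` cdom c"
  shows "cinv (ct c) (q, p) = (cinv c q, covec_of c (cinv c q) p)" "(q, p) \<in> cmap (ct c) ` cdom (ct c)"
proof -
  interpret C: chart_of "mtop M" c using chartD[OF assms(1)] .
  have x: "cinv c q \<in> cdom c" "cmap c (cinv c q) = q" using C.cinv_dom C.cmap_cinv assms by auto
  then have ch: "c \<in> charts_at M (cinv c q)" using assms by (simp add: charts_at_def)
  have mem: "(cinv c q, covec_of c (cinv c q) p) \<in> cdom (ct c)"
    using x covec_of_cotangent[OF ch] by (simp add: ct_dom)
  have eq: "cmap (ct c) (cinv c q, covec_of c (cinv c q) p) = (q, p)"
    by (simp add: ct_map x covec_coord_of[OF ch])
  show "cinv (ct c) (q, p) = (cinv c q, covec_of c (cinv c q) p)"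
    using inv_into_f_f[OF ct_inj[OF assms(1)] mem] eq by simp
  show "(q, p) \<in> cmap (ct c) ` cdom (ct c)" using mem eq by (metis imageI)
qed

lemma carrier_cotangent: "z \<in> mcarrier (cotangent_bundle M) \<longleftrightarrow> fst z \<in> mcarrier M \<and> snd z \<in> cotangent_space M (fst z)"
proof -
  have "z \<in> mcarrier (cotangent_bundle M) \<longleftrightarrow> (\<exists>c\<in>atlas M. fst z \<in> cdom c \<and> snd z \<in> cotangent_space M (fst z))"
    by (cases z) (simp add: cotangent_bundle_def carrier_mfd_of_charts ct_dom)
  moreover have "fst z \<in> mcarrier M \<longleftrightarrow> (\<exists>c\<in>atlas M. fst z \<in> cdom c)"
    using mfd unfolding smooth_manifold_def by blast
  ultimately show ?thesis by blast
qed

lemma cotangent_projection_preimage: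
  assumes V: "openin (mtop M) V"
  shows "openin (mtop (cotangent_bundle M)) {z \<in> mcarrier (cotangent_bundle M). fst z \<in> V}"
proof -
  let ?W = "\<lambda>c. {z \<in> cdom (ct c). cmap (ct c) z \<in> (cmap c ` (V \<inter> cdom c)) \<times> UNIV}"
  have W: "(x, l) \<in> ?W c \<longleftrightarrow> x \<in> V \<and> x \<in> cdom c \<and> l \<in> cotangent_space M x" if c: "c \<in> atlas M" for c x l
  proof -
    interpret C: chart_of "mtop M" c using chartD[OF c] .
    have "cmap c x \<in> cmap c ` (V \<inter> cdom c) \<longleftrightarrow> x \<in> V" if "x \<in> cdom c"
      using inj_on_image_mem_iff[OF C.inj that Int_lower2] that by simp
    then show ?thesis unfolding ct_dom mem_Collect_eq ct_map mem_Sigma_iff by blast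
  qed
  have opn: "openin (mtop (cotangent_bundle M)) (?W c)" if c: "c \<in> atlas M" for c
  proof -
    interpret C: chart_of "mtop M" c using chartD[OF c] .
    have "open (cmap c ` (V \<inter> cdom c))" by (rule C.open_image[OF openin_Int[OF V C.dom_open]]) blast
    then show ?thesis by (rule ct_preimage[OF c open_Times[OF _ open_UNIV]])
  qed
  have "z \<in> mcarrier (cotangent_bundle M) \<and> fst z \<in> V \<longleftrightarrow> z \<in> (\<Union>c\<in>atlas M. ?W c)" for z
  proof -
    obtain x l where z: "z = (x, l)" by (cases z)
    have "x \<in> mcarrier M \<longleftrightarrow> (\<exists>c\<in>atlas M. x \<in> cdom c)"
      using mfd unfolding smooth_manifold_def by blast
    moreover have "(x, l) \<in> (\<Union>c\<in>atlas M. ?W c) \<longleftrightarrow> x \<in> V \<and> (\<exists>c\<in>atlas M. x \<in> cdom c) \<and> l \<in> cotangent_space M x"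
    proof -
      have "(x, l) \<in> (\<Union>c\<in>atlas M. ?W c) \<longleftrightarrow> (\<exists>c\<in>atlas M. (x, l) \<in> ?W c)" by (rule UN_iff)
      also have "\<dots> \<longleftrightarrow> (\<exists>c\<in>atlas M. x \<in> V \<and> x \<in> cdom c \<and> l \<in> cotangent_space M x)"
        by (intro bex_cong refl W)
      finally show ?thesis by blast
    qed
    ultimately show ?thesis unfolding carrier_cotangent z fst_conv snd_conv by (simp only: conj_ac)
  qed
  then have "{z \<in> mcarrier (cotangent_bundle M). fst z \<in> V} = (\<Union>c\<in>atlas M. ?W c)"
    by (intro set_eqI) (simp only: mem_Collect_eq)
  also have "openin (mtop (cotangent_bundle M)) (\<Union>c\<in>atlas M. ?W c)"
    by (rule openin_Union, erule imageE, simp only: opn)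
  finally show ?thesis .
qed

lemma cotangent_Hausdorff: "Hausdorff_space (mtop (cotangent_bundle M))"
  unfolding Hausdorff_space_def
proof (intro allI impI, elim conjE)
  fix z z' assume z: "z \<in> mcarrier (cotangent_bundle M)" "z' \<in> mcarrier (cotangent_bundle M)" "z \<noteq> z'"
  show "\<exists>A B. openin (mtop (cotangent_bundle M)) A \<and> openin (mtop (cotangent_bundle M)) B \<and> z \<in> A \<and> z' \<in> B \<and> disjnt A B"
  proof (cases "fst z = fst z'")
    case False
    then obtain A B where AB: "openin (mtop M) A" "openin (mtop M) B" "fst z \<in> A" "fst z' \<in> B" "disjnt A B"
      using Hausdorff z(1,2) unfolding Hausdorff_space_def carrier_cotangent by blast
    have "disjnt {z \<in> mcarrier (cotangent_bundle M). fst z \<in> A} {z \<in> mcarrier (cotangent_bundle M). fst z \<in> B}"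
      using AB(5) unfolding disjnt_def by blast
    moreover have "z \<in> {z \<in> mcarrier (cotangent_bundle M). fst z \<in> A}" "z' \<in> {z \<in> mcarrier (cotangent_bundle M). fst z \<in> B}"
      using AB(3,4) z(1,2) by simp_all
    moreover have "openin (mtop (cotangent_bundle M)) {z \<in> mcarrier (cotangent_bundle M). fst z \<in> A}"
      by (rule cotangent_projection_preimage[OF AB(1)])
    moreover have "openin (mtop (cotangent_bundle M)) {z \<in> mcarrier (cotangent_bundle M). fst z \<in> B}"
      by (rule cotangent_projection_preimage[OF AB(2)])
    ultimately show ?thesis
      by - (rule exI[of _ "{z \<in> mcarrier (cotangent_bundle M). fst z \<in> A}"],
          rule exI[of _ "{z \<in> mcarrier (cotangent_bundle M). fst z \<in> B}"], intro conjI)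
  next
    case True
    obtain c where c: "c \<in> charts_at M (fst z)" using charts_at_nonempty[of "fst z"] z(1) unfolding carrier_cotangent by blast
    have dom: "z \<in> cdom (ct c)" "z' \<in> cdom (ct c)" and ca: "c \<in> atlas M"
      using c z(1,2) True by (cases z; cases z'; simp add: ct_dom charts_at_def carrier_cotangent)+
    have "cmap (ct c) z \<noteq> cmap (ct c) z'"
    proof
      assume "cmap (ct c) z = cmap (ct c) z'"
      from inj_onD[OF ct_inj[OF ca] this dom] z(3) show False by contradiction
    qed
    from hausdorff[OF this] obtain A B
      where AB: "open A" "open B" "cmap (ct c) z \<in> A" "cmap (ct c) z' \<in> B" "A \<inter> B = {}" by blast
    have "disjnt {z \<in> cdom (ct c). cmap (ct c) z \<in> A} {z \<in> cdom (ct c). cmap (ct c) z \<in> B}"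
      using AB(5) unfolding disjnt_def by blast
    moreover have "z \<in> {z \<in> cdom (ct c). cmap (ct c) z \<in> A}" "z' \<in> {z \<in> cdom (ct c). cmap (ct c) z \<in> B}"
      using AB(3,4) dom by simp_all
    moreover note ct_preimage[OF ca AB(1)] ct_preimage[OF ca AB(2)]
    ultimately show ?thesis
      by - (rule exI[of _ "{z \<in> cdom (ct c). cmap (ct c) z \<in> A}"],
          rule exI[of _ "{z \<in> cdom (ct c). cmap (ct c) z \<in> B}"], intro conjI)
  qed
qed

end

section \<open>Integral curves and flows\<close>

lemma continuous_curve_near:
  assumes \<Gamma>: "continuous_map (top_of_set I) N \<Gamma>" and U: "openin N U" and \<tau>: "\<tau> \<in> I" "\<Gamma> \<tau> \<in> U"
  obtains e where "e > 0" "\<And>s. s \<in> I \<Longrightarrow> dist s \<tau> < e \<Longrightarrow> \<Gamma> s \<in> U"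
proof -
  have "openin (top_of_set I) {s \<in> topspace (top_of_set I). \<Gamma> s \<in> U}"
    using \<Gamma> U by (rule openin_continuous_map_preimage)
  moreover have "\<tau> \<in> {s \<in> topspace (top_of_set I). \<Gamma> s \<in> U}" using \<tau> by simp
  ultimately have "\<exists>e>0. \<forall>s\<in>I. dist s \<tau> < e \<longrightarrow> s \<in> {s \<in> topspace (top_of_set I). \<Gamma> s \<in> U}"
    unfolding openin_euclidean_subtopology_iff by blast
  then show ?thesis using that by blast
qed

lemma flow_eq:
  fixes N :: "('z, 'f::euclidean_space) mfd" and \<Gamma> :: "real \<Rightarrow> 'z" and t :: real
  assumes Haus: "Hausdorff_space (mtop N)" and c: "c \<in> atlas N"
    and pre: "\<And>W. open W \<Longrightarrow> openin (mtop N) {x \<in> cdom c. cmap c x \<in> W}" and inj: "inj_on (cmap c) (cdom c)"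
    and "0 \<le> t" and dom: "\<And>s. s \<in> {0..t} \<Longrightarrow> \<Gamma> s \<in> cdom c" and \<Gamma>: "integral_curve N V {0..t} \<Gamma>"
    and lip: "\<And>\<tau>. \<tau> \<in> {0..t} \<Longrightarrow> \<exists>\<epsilon>>0. \<exists>L\<ge>0. \<forall>s\<in>{0..t}. \<forall>z1\<in>cdom c. \<forall>z2\<in>cdom c.
       cmap c z1 \<in> ball (cmap c (\<Gamma> \<tau>)) \<epsilon> \<longrightarrow> cmap c z2 \<in> ball (cmap c (\<Gamma> \<tau>)) \<epsilon> \<longrightarrow>
       norm (V s z1 c - V s z2 c) \<le> L * norm (cmap c z1 - cmap c z2)"
  shows "flow N V t (\<Gamma> 0) = \<Gamma> t"
  unfolding flow_def
proof (rule the_equality)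
  have seg: "closed_segment 0 t = {0..t}" using \<open>0 \<le> t\<close> by (simp add: closed_segment_eq_real_ivl)
  show "\<exists>\<Gamma>'. integral_curve N V (closed_segment 0 t) \<Gamma>' \<and> \<Gamma>' 0 = \<Gamma> 0 \<and> \<Gamma>' t = \<Gamma> t"
    using \<Gamma> seg by auto
  fix z assume "\<exists>\<Gamma>'. integral_curve N V (closed_segment 0 t) \<Gamma>' \<and> \<Gamma>' 0 = \<Gamma> 0 \<and> \<Gamma>' t = z"
  then obtain \<Gamma>' where \<Gamma>': "integral_curve N V {0..t} \<Gamma>'" "\<Gamma>' 0 = \<Gamma> 0" "\<Gamma>' t = z" using seg by auto
  have cont: "continuous_map (top_of_set {0..t}) (mtop N) \<Gamma>" "continuous_map (top_of_set {0..t}) (mtop N) \<Gamma>'"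
    using \<Gamma> \<Gamma>' by (auto simp: integral_curve_def)
  have "\<Gamma> t = \<Gamma>' t"
  proof (rule real_agreement_induct[where \<alpha> = \<Gamma> and \<beta> = \<Gamma>' and t = t and s = t, OF \<open>0 \<le> t\<close> \<Gamma>'(2)[symmetric] _ _ \<open>0 \<le> t\<close> order_refl])
    fix \<tau> assume \<tau>: "0 < \<tau>" "\<tau> \<le> t" and eq: "\<And>s. 0 \<le> s \<Longrightarrow> s < \<tau> \<Longrightarrow> \<Gamma> s = \<Gamma>' s"
    show "\<Gamma> \<tau> = \<Gamma>' \<tau>"
    proof (rule ccontr)
      assume ne: "\<Gamma> \<tau> \<noteq> \<Gamma>' \<tau>"
      have \<tau>I: "\<tau> \<in> {0..t}" using \<tau> by simp
      have "\<Gamma> \<tau> \<in> topspace (mtop N)" "\<Gamma>' \<tau> \<in> topspace (mtop N)"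
        using cont \<tau>I by (auto simp: continuous_map_def)
      then obtain U U' where U: "openin (mtop N) U" "openin (mtop N) U'" "\<Gamma> \<tau> \<in> U" "\<Gamma>' \<tau> \<in> U'" "disjnt U U'"
        using Haus ne unfolding Hausdorff_space_def by blast
      obtain e where e: "e > 0" "\<And>s. s \<in> {0..t} \<Longrightarrow> dist s \<tau> < e \<Longrightarrow> \<Gamma> s \<in> U"
        using continuous_curve_near[OF cont(1) U(1) \<tau>I U(3)] by blast
      obtain e' where e': "e' > 0" "\<And>s. s \<in> {0..t} \<Longrightarrow> dist s \<tau> < e' \<Longrightarrow> \<Gamma>' s \<in> U'"
        using continuous_curve_near[OF cont(2) U(2) \<tau>I U(4)] by blast
      define s where "s = max 0 (\<tau> - min e e' / 2)"
      have s: "0 \<le> s" "s < \<tau>" "dist s \<tau> < e" "dist s \<tau> < e'"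
        using e(1) e'(1) \<tau> by (auto simp: s_def dist_real_def)
      have "s \<in> {0..t}" using s \<tau> by simp
      then have "\<Gamma> s \<in> U" "\<Gamma>' s \<in> U'" using e(2) e'(2) s by blast+
      then show False using U(5) eq[OF s(1,2)] by (auto simp: disjnt_def)
    qed
  next
    fix \<tau> assume \<tau>: "0 \<le> \<tau>" "\<tau> < t" and eq: "\<Gamma> \<tau> = \<Gamma>' \<tau>"
    have \<tau>I: "\<tau> \<in> {0..t}" using \<tau> by simp
    obtain \<epsilon> L where \<epsilon>: "\<epsilon> > 0" "L \<ge> 0" and L: "\<And>s z1 z2. s \<in> {0..t} \<Longrightarrow> z1 \<in> cdom c \<Longrightarrow> z2 \<in> cdom c \<Longrightarrow>
       cmap c z1 \<in> ball (cmap c (\<Gamma> \<tau>)) \<epsilon> \<Longrightarrow> cmap c z2 \<in> ball (cmap c (\<Gamma> \<tau>)) \<epsilon> \<Longrightarrow>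
       norm (V s z1 c - V s z2 c) \<le> L * norm (cmap c z1 - cmap c z2)"
      using lip[OF \<tau>I] by blast
    let ?U = "{x \<in> cdom c. cmap c x \<in> ball (cmap c (\<Gamma> \<tau>)) \<epsilon>}"
    have U: "openin (mtop N) ?U" "\<Gamma> \<tau> \<in> ?U" "\<Gamma>' \<tau> \<in> ?U"
      using pre[OF open_ball] dom[OF \<tau>I] \<epsilon>(1) eq by auto
    obtain e where e: "e > 0" "\<And>s. s \<in> {0..t} \<Longrightarrow> dist s \<tau> < e \<Longrightarrow> \<Gamma> s \<in> ?U"
      using continuous_curve_near[OF cont(1) U(1) \<tau>I U(2)] by blast
    obtain e' where e': "e' > 0" "\<And>s. s \<in> {0..t} \<Longrightarrow> dist s \<tau> < e' \<Longrightarrow> \<Gamma>' s \<in> ?U"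
      using continuous_curve_near[OF cont(2) U(1) \<tau>I U(3)] by blast
    define h where "h = min (min (e/2) (e'/2)) (min (t - \<tau>) (1 / (2 * (L + 1))))"
    have h: "0 < h" "h < e" "h < e'" "\<tau> + h \<le> t" using e(1) e'(1) \<tau> \<epsilon> by (auto simp: h_def)
    have hL: "h * L \<le> 1/2"
    proof -
      have "h * L \<le> h * (L + 1)" using h by simp
      also have "\<dots> \<le> 1 / (2 * (L + 1)) * (L + 1)" using \<epsilon> by (intro mult_right_mono) (auto simp: h_def)
      also have "\<dots> = 1/2" using \<epsilon> by simp
      finally show ?thesis .
    qed
    have "\<Gamma> s = \<Gamma>' s" if s: "s \<in> {\<tau>..\<tau> + h}" for s
    proof -
      have sub: "{\<tau>..\<tau> + h} \<subseteq> {0..t}" using \<tau> h by auto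
      have inU: "\<Gamma> s \<in> ?U" "\<Gamma>' s \<in> ?U" if "s \<in> {\<tau>..\<tau> + h}" for s
        using that e(2)[of s] e'(2)[of s] sub h by (auto simp: dist_real_def)
      have "norm (cmap c (\<Gamma> s) - cmap c (\<Gamma>' s)) \<le> 2 * (\<tau> + h - \<tau>) * 0"
      proof (rule small_time_bound[where e' = "\<lambda>s. V s (\<Gamma> s) c - V s (\<Gamma>' s) c" and L = L])
        fix s assume s: "s \<in> {\<tau>..\<tau> + h}"
        have ch: "c \<in> charts_at N (\<Gamma> s)" "c \<in> charts_at N (\<Gamma>' s)" using inU[OF s] c by (auto simp: charts_at_def)
        have sI: "s \<in> {0..t}" using s sub by blast
        show "((\<lambda>s. cmap c (\<Gamma> s) - cmap c (\<Gamma>' s)) has_vector_derivative V s (\<Gamma> s) c - V s (\<Gamma>' s) c) (at s within {\<tau>..\<tau> + h})"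
          using \<Gamma> \<Gamma>' ch sI
          by (intro has_vector_derivative_diff has_vector_derivative_within_subset[OF _ sub])
            (auto simp: integral_curve_def)
        show "norm (V s (\<Gamma> s) c - V s (\<Gamma>' s) c) \<le> L * norm (cmap c (\<Gamma> s) - cmap c (\<Gamma>' s)) + 0"
          using L[OF sI] inU[OF s] by simp
      qed (use h hL eq \<epsilon> s in auto)
      then have "cmap c (\<Gamma> s) = cmap c (\<Gamma>' s)" by simp
      then show ?thesis using inj inU[OF s] by (auto simp: inj_on_def)
    qed
    then show "\<exists>\<epsilon>>0. \<forall>s. \<tau> \<le> s \<and> s \<le> \<tau> + \<epsilon> \<and> s \<le> t \<longrightarrow> \<Gamma> s = \<Gamma>' s"
      using h(1) by auto
  qed
  then show "z = \<Gamma> t" using \<Gamma>'(3) by simp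
qed

lemma integral_curve_subset:
  assumes "integral_curve N V I \<Gamma>" "J \<subseteq> I"
  shows "integral_curve N V J \<Gamma>"
proof -
  have "continuous_map (subtopology (top_of_set I) J) (mtop N) \<Gamma>"
    by (rule continuous_map_from_subtopology) (use assms(1) in \<open>simp add: integral_curve_def\<close>)
  moreover have "subtopology (top_of_set I) J = top_of_set J"
    using assms(2) by (simp add: subtopology_subtopology Int_absorb1)
  ultimately have "continuous_map (top_of_set J) (mtop N) \<Gamma>" by simp
  then show ?thesis using assms unfolding integral_curve_def
    by (meson has_vector_derivative_within_subset subset_eq)
qed

context smooth_mfd
begin

lemma integral_curve_from_chart:
  assumes c: "c \<in> atlas M" and y: "continuous_on I y" "\<And>s. s \<in> I \<Longrightarrow> y s \<in> cmap c ` cdom c"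
    and dy: "\<And>s. s \<in> I \<Longrightarrow> (y has_vector_derivative V s (cinv c (y s)) c) (at s within I)"
    and V: "\<And>s x. s \<in> I \<Longrightarrow> x \<in> cdom c \<Longrightarrow> V s x \<in> tangent_space M x"
  shows "integral_curve M V I (\<lambda>s. cinv c (y s))"
  unfolding integral_curve_def
proof (intro conjI ballI)
  interpret C: chart_of "mtop M" c using chartD[OF c] .
  have "continuous_map (top_of_set I) (top_of_set (cmap c ` cdom c)) y"
    using y by (auto simp: continuous_map_in_subtopology)
  from continuous_map_compose[OF this C.cinv_cont]
  show "continuous_map (top_of_set I) (mtop M) (\<lambda>s. cinv c (y s))" by (simp add: o_def)
  fix s d assume s: "s \<in> I" and d: "d \<in> charts_at M (cinv c (y s))"
  let ?x = "cinv c (y s)"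
  have x: "?x \<in> cdom c" "cmap c ?x = y s" using C.cinv_dom C.cmap_cinv y(2)[OF s] by auto
  have cx: "c \<in> charts_at M ?x" using c x by (simp add: charts_at_def)
  have "((\<lambda>s. (cmap d \<circ> cinv c) (y s)) has_derivative (\<lambda>h. trans c d ?x (h *\<^sub>R V s ?x c))) (at s within I)"
    using dy[OF s] trans_has_derivative[OF cx d] unfolding x(2) has_vector_derivative_def
    by (rule has_derivative_compose)
  moreover have "trans c d ?x (h *\<^sub>R V s ?x c) = h *\<^sub>R V s ?x d" for h
  proof -
    have "V s ?x d = trans c d ?x (V s ?x c)"
      using tangent_coord_vec[OF V[OF s x(1)] cx] d by (metis coord_vec_def)
    then show ?thesis by (simp add: linear_cmul[OF trans_linear[OF cx d]])
  qed
  ultimately show "((\<lambda>s. cmap d (cinv c (y s))) has_vector_derivative V s ?x d) (at s within I)"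
    by (simp add: has_vector_derivative_def)
qed

end

section \<open>Sub-Riemannian structures in a chart\<close>

text \<open>The bound below on \<open>J\<close> replaces continuity of the inverse: it transfers \<open>o(s - t)\<close> estimates
  from \<open>J s (G s)\<close> to \<open>G s\<close>.\<close>

lemma has_vector_derivative_solve_linear:
  fixes G z :: "real \<Rightarrow> 'a::euclidean_space" and J :: "real \<Rightarrow> 'a \<Rightarrow> 'a"
  assumes t: "t \<in> I" and lin: "\<And>s. s \<in> I \<Longrightarrow> linear (J s)"
    and lower: "\<And>s w. s \<in> I \<Longrightarrow> norm w \<le> 2 * norm (J s w)"
    and J': "\<And>w. ((\<lambda>s. J s w) has_vector_derivative J' w) (at t within I)"
    and z': "(z has_vector_derivative z') (at t within I)"
    and G: "\<And>s. s \<in> I \<Longrightarrow> J s (G s) = z s"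
    and g: "J t g = z' - J' (G t)"
  shows "(G has_vector_derivative g) (at t within I)"
proof -
  define e where "e s = z s - J s (G t) - (s - t) *\<^sub>R J s g" for s
  have "(e has_vector_derivative (z' - J' (G t) - ((t - t) *\<^sub>R J' g + 1 *\<^sub>R J t g))) (at t within I)"
    unfolding e_def
    by (intro has_vector_derivative_diff z' J' has_vector_derivative_scaleR) (auto intro!: derivative_eq_intros)
  then have e': "(e has_vector_derivative 0) (at t within I)" by (simp add: g)
  have e_t: "e t = 0" using G[OF t] by (simp add: e_def)
  define d where "d s = G s - G t - (s - t) *\<^sub>R g" for s
  have le: "norm (d s) \<le> 2 * norm (e s)" if "s \<in> I" for s
  proof -
    have "J s (d s) = e s"
      using lin[OF that] by (simp add: d_def e_def linear_diff linear_cmul G[OF that])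
    then show ?thesis using lower[OF that, of "d s"] by simp
  qed
  have "(d has_vector_derivative 0) (at t within I)"
    unfolding has_vector_derivative_def has_derivative_within_alt
  proof (intro conjI allI impI)
    fix \<epsilon> :: real assume "\<epsilon> > 0"
    then obtain \<delta> where "\<delta> > 0" "\<And>s. s \<in> I \<Longrightarrow> norm (s - t) < \<delta> \<Longrightarrow> norm (e s) \<le> \<epsilon> / 2 * norm (s - t)"
      using e' e_t unfolding has_vector_derivative_def has_derivative_within_alt
      by (auto dest!: spec[of _ "\<epsilon> / 2"])
    then show "\<exists>\<delta>>0. \<forall>s\<in>I. norm (s - t) < \<delta> \<longrightarrow> norm (d s - d t - (s - t) *\<^sub>R 0) \<le> \<epsilon> * norm (s - t)"
      using le by (intro exI[of _ \<delta>]) (fastforce simp: d_def[of t])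
  qed (simp add: bounded_linear_scaleR_left)
  then have "((\<lambda>s. d s + (G t + (s - t) *\<^sub>R g)) has_vector_derivative 0 + (0 + ((t - t) *\<^sub>R 0 + 1 *\<^sub>R g))) (at t within I)"
    by (intro has_vector_derivative_add has_vector_derivative_const has_vector_derivative_scaleR)
      (auto intro!: derivative_eq_intros)
  then show ?thesis by (simp add: d_def)
qed

lemma span_det_nonzero:
  fixes g :: "'n::finite \<Rightarrow> real^'n"
  assumes "det (\<chi> i. g i) \<noteq> 0"
  shows "span (range g) = UNIV"
proof -
  have "invertible (\<chi> i. g i)" using assms by (simp add: invertible_det_nz)
  then obtain B where "B ** (\<chi> i. g i) = mat 1" unfolding invertible_def by blast
  then have "span (rows (\<chi> i. g i)) = UNIV" using matrix_left_invertible_span_rows by blast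
  moreover have "rows (\<chi> i. g i) = range g" by (auto simp: rows_def row_def)
  ultimately show ?thesis by simp
qed

lemma spanning_family_det:
  fixes F :: "'k \<Rightarrow> real^'n"
  assumes "span (range F) = UNIV"
  obtains k :: "'n \<Rightarrow> 'k" where "det (\<chi> i. F (k i)) \<noteq> 0"
proof -
  obtain B where B: "B \<subseteq> range F" "independent B" "range F \<subseteq> span B" "card B = dim (range F)"
    using basis_exists[of "range F"] by blast
  have "dim (range F) = CARD('n)" using dim_span[of "range F"] assms by simp
  then have card: "card B = CARD('n)" using B(4) by simp
  then have "finite B" by (metis card.infinite finite_UNIV zero_less_card_finite less_irrefl)
  then obtain b :: "'n \<Rightarrow> real^'n" where b: "bij_betw b UNIV B"
    using finite_same_card_bij[of "UNIV :: 'n set" B] card by auto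
  have "\<forall>i. \<exists>k. b i = F k" using b B(1) by (auto simp: bij_betw_def)
  then obtain k where k: "\<And>i. b i = F (k i)" by metis
  have "UNIV \<subseteq> span B"
    using span_mono[OF B(3)] assms by (simp add: span_span)
  moreover have "rows (\<chi> i. b i) = B" using b by (auto simp: rows_def row_def bij_betw_def)
  ultimately have "span (rows (\<chi> i. b i)) = UNIV" by auto
  then obtain A where "A ** (\<chi> i. b i) = mat 1" using matrix_left_invertible_span_rows by metis
  then have "invertible (\<chi> i. b i)" using invertible_left_inverse by blast
  then have "det (\<chi> i. b i) \<noteq> 0" by (simp add: invertible_det_nz)
  then show ?thesis using that[of k] by (simp add: k)
qed

lemma sub_riemannian_smooth_mfd: "sub_riemannian_manifold M U f \<sigma> \<Longrightarrow> smooth_mfd M"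
  by (simp add: sub_riemannian_manifold_def smooth_mfd_def)

lemma openin_preimage:
  "continuous_map (subtopology X (topspace X)) Y g \<Longrightarrow> openin Y V \<Longrightarrow> openin X {x \<in> topspace X. g x \<in> V}"
  by (simp add: openin_continuous_map_preimage)

lemma frame_fields_tangent:
  assumes sr: "sub_riemannian_manifold M U f \<sigma>" and x: "x \<in> mcarrier M"
  shows "\<sigma> i x \<in> mcarrier (total U)" "fst (f (\<sigma> i x)) = x" "frame_fields f \<sigma> i x \<in> tangent_space M x"
proof -
  have fib: "\<sigma> i x \<in> fibre U x"
    using sr x by (simp add: sub_riemannian_manifold_def orthonormal_frame_def)
  then show tot: "\<sigma> i x \<in> mcarrier (total U)" by (simp add: fibre_def)
  show fst: "fst (f (\<sigma> i x)) = x"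
    using sr fib by (simp add: sub_riemannian_manifold_def bundle_map_to_tangent_def fibre_def)
  have "continuous_map (mtop (total U)) (mtop (tangent_bundle M)) f"
    using sr by (simp add: sub_riemannian_manifold_def bundle_map_to_tangent_def smooth_map_on_def)
  then have "f (\<sigma> i x) \<in> mcarrier (tangent_bundle M)" using tot by (auto simp: continuous_map_def)
  then obtain c where "f (\<sigma> i x) \<in> Sigma (cdom c) (tangent_space M)"
    by (auto simp: tangent_bundle_def carrier_mfd_of_charts tangent_chart_def)
  then show "frame_fields f \<sigma> i x \<in> tangent_space M x"
    using fst by (cases "f (\<sigma> i x)") (simp add: frame_fields_def)
qed

lemma frame_fields_smooth:
  assumes sr: "sub_riemannian_manifold M U f \<sigma>" and c: "c \<in> atlas M"
  shows "smooth_on (cmap c ` cdom c) (\<lambda>q. frame_fields f \<sigma> i (cinv c q) c)"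
proof (rule smooth_on_local)
  interpret M: smooth_mfd M by (rule sub_riemannian_smooth_mfd[OF sr])
  interpret U: smooth_mfd "total U"
    using sr by (simp add: sub_riemannian_manifold_def euclidean_vector_bundle_def smooth_mfd_def)
  interpret C: chart_of "mtop M" c by (rule M.chartD[OF c])
  have \<sigma>: "smooth_map M (total U) (\<sigma> i)"
    using sr by (simp add: sub_riemannian_manifold_def orthonormal_frame_def)
  have f: "smooth_map (total U) (tangent_bundle M) f"
    using sr by (simp add: sub_riemannian_manifold_def bundle_map_to_tangent_def)
  let ?tc = "tangent_chart M c"
  have tc: "?tc \<in> atlas (tangent_bundle M)" "openin (mtop (tangent_bundle M)) (cdom ?tc)"
    using c openin_mfd_of_charts[of ?tc "tangent_chart M ` atlas M" UNIV]
    by (auto simp: tangent_bundle_def atlas_mfd_of_charts)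
  fix q assume q: "q \<in> cmap c ` cdom c"
  define x where "x = cinv c q"
  have x: "x \<in> cdom c" "cmap c x = q" using C.cinv_dom C.cmap_cinv q by (auto simp: x_def)
  have xM: "x \<in> mcarrier M" using C.dom_sub x(1) by blast
  obtain d where d: "d \<in> atlas (total U)" "\<sigma> i x \<in> cdom d"
    using U.charts_at_nonempty[OF frame_fields_tangent(1)[OF sr xM, of i]] by (auto simp: charts_at_def)
  interpret D: chart_of "mtop (total U)" d by (rule U.chartD[OF d(1)])
  define V1 where "V1 = mcarrier M \<inter> cdom c \<inter> \<sigma> i -` cdom d"
  define V2 where "V2 = mcarrier (total U) \<inter> cdom d \<inter> f -` cdom ?tc"
  have "V1 = cdom c \<inter> {x \<in> mcarrier M. \<sigma> i x \<in> cdom d}" by (auto simp: V1_def)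
  moreover have "openin (mtop M) {x \<in> mcarrier M. \<sigma> i x \<in> cdom d}"
    by (rule openin_preimage[OF _ D.dom_open]) (use \<sigma> in \<open>simp add: smooth_map_on_def\<close>)
  ultimately have V1: "openin (mtop M) V1" using C.dom_open by (simp add: openin_Int)
  have "V2 = cdom d \<inter> {b \<in> mcarrier (total U). f b \<in> cdom ?tc}" by (auto simp: V2_def)
  moreover have "openin (mtop (total U)) {b \<in> mcarrier (total U). f b \<in> cdom ?tc}"
    by (rule openin_preimage[OF _ tc(2)]) (use f in \<open>simp add: smooth_map_on_def\<close>)
  ultimately have V2: "openin (mtop (total U)) V2" using D.dom_open by (simp add: openin_Int)
  have o1: "open (cmap c ` V1)" by (rule C.open_image[OF V1]) (auto simp: V1_def)
  have o2: "open (cmap d ` V2)" by (rule D.open_image[OF V2]) (auto simp: V2_def)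
  have s1: "smooth_on (cmap c ` V1) (cmap d \<circ> \<sigma> i \<circ> cinv c)"
    using \<sigma> c d(1) unfolding smooth_map_on_def V1_def by blast
  have s2: "smooth_on (cmap d ` V2) (cmap ?tc \<circ> f \<circ> cinv d)"
    using f d(1) tc(1) unfolding smooth_map_on_def V2_def by blast
  have V12: "\<sigma> i x \<in> V2" "f (\<sigma> i x) = (x, frame_fields f \<sigma> i x)" if "x \<in> V1" for x
  proof -
    have x: "x \<in> mcarrier M" "x \<in> cdom c" "\<sigma> i x \<in> cdom d" using that by (auto simp: V1_def)
    show eq: "f (\<sigma> i x) = (x, frame_fields f \<sigma> i x)"
      using frame_fields_tangent(2)[OF sr x(1), of i] by (simp add: frame_fields_def prod_eq_iff)
    show "\<sigma> i x \<in> V2"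
      using frame_fields_tangent(1,3)[OF sr x(1), of i] x by (simp add: V2_def eq tangent_chart_def)
  qed
  have "smooth_on (cmap c ` V1) (\<lambda>q. snd ((cmap ?tc \<circ> f \<circ> cinv d) ((cmap d \<circ> \<sigma> i \<circ> cinv c) q)))"
  proof (rule smooth_on_compose_linear[OF bounded_linear_snd o1], rule smooth_on_comp[OF o1 o2 _ s1 s2])
    fix q assume "q \<in> cmap c ` V1"
    then obtain x where x: "x \<in> V1" "x \<in> cdom c" "q = cmap c x" by (auto simp: V1_def)
    then show "(cmap d \<circ> \<sigma> i \<circ> cinv c) q \<in> cmap d ` V2" using V12(1)[OF x(1)] C.cinv_cmap by simp
  qed
  then have "smooth_on (cmap c ` V1) (\<lambda>q. frame_fields f \<sigma> i (cinv c q) c)"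
  proof (rule smooth_on_cong[OF o1])
    fix q assume "q \<in> cmap c ` V1"
    then obtain x where x: "x \<in> V1" "x \<in> cdom c" "\<sigma> i x \<in> cdom d" "q = cmap c x" by (auto simp: V1_def)
    show "snd ((cmap ?tc \<circ> f \<circ> cinv d) ((cmap d \<circ> \<sigma> i \<circ> cinv c) q)) = frame_fields f \<sigma> i (cinv c q) c"
      using x V12(2)[OF x(1)] by (simp add: C.cinv_cmap D.cinv_cmap tangent_chart_def)
  qed
  moreover have "q \<in> cmap c ` V1" using x xM d(2) by (auto simp: V1_def)
  ultimately show "\<exists>V. open V \<and> q \<in> V \<and> smooth_on V (\<lambda>q. frame_fields f \<sigma> i (cinv c q) c)"
    using o1 by blast
qed

lemma iterated_brackets_in_chart:
  fixes M :: "('a, 'e::euclidean_space) mfd" and X :: "'r \<Rightarrow> 'a \<Rightarrow> ('a, 'e) tvec"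
  assumes M: "smooth_manifold M" and c: "c \<in> atlas M" and Y: "Y \<in> iterated_brackets M X"
  shows "\<exists>Z\<in>bracket_fields (\<lambda>i q. X i (cinv c q) c). \<forall>q\<in>cmap c ` cdom c. Y (cinv c q) c = Z q"
proof -
  interpret M: smooth_mfd M using M by (simp add: smooth_mfd_def)
  interpret C: chart_of "mtop M" c by (rule M.chartD[OF c])
  from Y show ?thesis
  proof induction
    case (1 i)
    show ?case by (rule bexI[OF _ bracket_fields.intros(1)[of _ i]]) simp
  next
    case (2 Y1 Y2)
    then obtain Z1 Z2 where Z: "Z1 \<in> bracket_fields (\<lambda>i q. X i (cinv c q) c)" "Z2 \<in> bracket_fields (\<lambda>i q. X i (cinv c q) c)"
      "\<And>q. q \<in> cmap c ` cdom c \<Longrightarrow> Y1 (cinv c q) c = Z1 q" "\<And>q. q \<in> cmap c ` cdom c \<Longrightarrow> Y2 (cinv c q) c = Z2 q"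
      by blast
    have "lie_bracket M Y1 Y2 (cinv c q) c = field_bracket Z1 Z2 q" if q: "q \<in> cmap c ` cdom c" for q
    proof -
      have ch: "c \<in> charts_at M (cinv c q)" using c C.cinv_dom[OF q] by (simp add: charts_at_def)
      have "frechet_derivative (\<lambda>q. Y1 (cinv c q) c) (at q) = frechet_derivative Z1 (at q)"
        "frechet_derivative (\<lambda>q. Y2 (cinv c q) c) (at q) = frechet_derivative Z2 (at q)"
        by (rule frechet_derivative_cong_open[OF C.im_open q], rule Z, assumption)+
      then show ?thesis using ch Z(3,4)[OF q]
        by (simp add: lie_bracket_def field_bracket_def C.cmap_cinv[OF q])
    qed
    then show ?case using bracket_fields.intros(2)[OF Z(1,2)] by blast
  qed
qed

lemma sum_fun_apply: "(\<Sum>i\<in>I. F i) x = (\<Sum>i\<in>I. F i x)"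
  by (induction I rule: infinite_finite_induct) simp_all

lemma continuous_on_det:
  fixes G :: "real \<Rightarrow> 'n::finite \<Rightarrow> real^'n"
  assumes "\<And>i. continuous_on I (\<lambda>s. G s i)"
  shows "continuous_on I (\<lambda>s. det (\<chi> i. G s i))"
  unfolding det_def vec_lambda_beta
  by (intro continuous_on_sum continuous_on_mult continuous_on_const continuous_on_prod
      continuous_on_component assms)

lemma has_vector_derivative_compose_smooth:
  assumes "smooth_on S g" "y t \<in> S" "(y has_vector_derivative y') (at t within I)"
  shows "((\<lambda>s. g (y s)) has_vector_derivative frechet_derivative g (at (y t)) y') (at t within I)"
proof -
  have "((\<lambda>s. g (y s)) has_derivative (\<lambda>h. frechet_derivative g (at (y t)) (h *\<^sub>R y'))) (at t within I)"
    using assms(3)[unfolded has_vector_derivative_def] smooth_on_has_derivative[OF assms(1,2)]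
    by (rule has_derivative_compose)
  then show ?thesis
    unfolding has_vector_derivative_def linear_cmul[OF linear_frechet_smooth[OF assms(1,2)]] .
qed

locale sr_chart = smooth_mfd M for M :: "('a, real^'n) mfd" +
  fixes X :: "'r::finite \<Rightarrow> 'a \<Rightarrow> ('a, real^'n) tvec" and c :: "('a, real^'n) chart"
  assumes c: "c \<in> atlas M"
    and X_tangent: "x \<in> mcarrier M \<Longrightarrow> X i x \<in> tangent_space M x"
    and X_smooth: "smooth_on (cmap c ` cdom c) (\<lambda>q. X i (cinv c q) c)"
begin

sublocale C: chart_of "mtop M" c by (rule chartD[OF c])

sublocale F: sr_frame "cmap c ` cdom c" "\<lambda>i q. X i (cinv c q) c"
  by standard (rule C.im_open, rule X_smooth)

lemma c_chart: "x \<in> cdom c \<Longrightarrow> c \<in> charts_at M x"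
  using c by (simp add: charts_at_def)

lemma X_tangent_dom: "x \<in> cdom c \<Longrightarrow> X i x \<in> tangent_space M x"
  using X_tangent C.dom_sub by blast

lemma ct_in_phase: "z \<in> cdom (ct c) \<Longrightarrow> cmap (ct c) z \<in> F.phase"
  by (cases z) (auto simp: ct_dom ct_map)

lemma momentum_ctrl:
  assumes "z \<in> cdom (ct c)"
  shows "snd z (X i (fst z)) = F.ctrl i (cmap (ct c) z)"
proof -
  obtain x l where z: "z = (x, l)" by (cases z)
  have x: "x \<in> cdom c" "l \<in> cotangent_space M x" using assms by (auto simp: z ct_dom)
  show ?thesis
    using covec_apply[OF x(2) c_chart[OF x(1)] X_tangent_dom[OF x(1)], of i]
    by (simp add: z ct_map F.ctrl_def C.cinv_cmap[OF x(1)] inner_commute)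
qed

lemma sr_field_chart:
  assumes z: "z \<in> cdom (ct c)"
  shows "sr_field M X z (ct c) = F.Hv (cmap (ct c) z)"
proof -
  have ch: "ct c \<in> charts_at (cotangent_bundle M) z" using z c by (simp add: charts_at_def ct_atlas)
  have "frechet_derivative (sr_hamiltonian X \<circ> cinv (ct c)) (at (cmap (ct c) z)) =
      frechet_derivative F.ham (at (cmap (ct c) z))"
  proof (rule frechet_derivative_cong_open[OF F.open_phase ct_in_phase[OF z]])
    fix y assume "y \<in> F.phase"
    then obtain q p where y: "y = (q, p)" "q \<in> cmap c ` cdom c" by auto
    have w: "cinv (ct c) y \<in> cdom (ct c)" "cmap (ct c) (cinv (ct c) y) = y"
      using ct_cinv(2)[OF c y(2), of p] y(1) by (auto simp: inv_into_into f_inv_into_f)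
    show "(sr_hamiltonian X \<circ> cinv (ct c)) y = F.ham y"
      using momentum_ctrl[OF w(1)] by (simp add: sr_hamiltonian_def F.ham_def w(2))
  qed
  then show ?thesis using ch by (simp add: hamiltonian_field_def hvec_def)
qed

lemma cotangent_flow_eq:
  assumes "0 \<le> t" "\<And>s. s \<in> {0..t} \<Longrightarrow> \<Gamma> s \<in> cdom (ct c)"
    "integral_curve (cotangent_bundle M) (\<lambda>_. sr_field M X) {0..t} \<Gamma>"
  shows "flow (cotangent_bundle M) (\<lambda>_. sr_field M X) t (\<Gamma> 0) = \<Gamma> t"
proof (rule flow_eq[OF cotangent_Hausdorff _ ct_preimage[OF c] ct_inj[OF c] assms])
  show "ct c \<in> atlas (cotangent_bundle M)" using c by (simp add: ct_atlas)
  fix \<tau> assume "\<tau> \<in> {0..t}"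
  then have "cmap (ct c) (\<Gamma> \<tau>) \<in> F.phase" by (intro ct_in_phase assms)
  then obtain R where R: "R > 0" "cball (cmap (ct c) (\<Gamma> \<tau>)) R \<subseteq> F.phase"
    using F.open_phase open_contains_cball by metis
  obtain L where L: "0 \<le> L" "\<And>x y. x \<in> cball (cmap (ct c) (\<Gamma> \<tau>)) R \<Longrightarrow> y \<in> cball (cmap (ct c) (\<Gamma> \<tau>)) R \<Longrightarrow>
      norm (F.Hv x - F.Hv y) \<le> L * norm (x - y)"
    using smooth_cball_bounds[OF F.smooth_Hv R(2)] by metis
  have main: "\<forall>s\<in>{0..t}. \<forall>z1\<in>cdom (ct c). \<forall>z2\<in>cdom (ct c).
       cmap (ct c) z1 \<in> ball (cmap (ct c) (\<Gamma> \<tau>)) R \<longrightarrow> cmap (ct c) z2 \<in> ball (cmap (ct c) (\<Gamma> \<tau>)) R \<longrightarrow>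
       norm (sr_field M X z1 (ct c) - sr_field M X z2 (ct c)) \<le> L * norm (cmap (ct c) z1 - cmap (ct c) z2)"
  proof (intro ballI impI)
    fix z1 z2 assume "z1 \<in> cdom (ct c)" "z2 \<in> cdom (ct c)"
      "cmap (ct c) z1 \<in> ball (cmap (ct c) (\<Gamma> \<tau>)) R" "cmap (ct c) z2 \<in> ball (cmap (ct c) (\<Gamma> \<tau>)) R"
    then show "norm (sr_field M X z1 (ct c) - sr_field M X z2 (ct c)) \<le> L * norm (cmap (ct c) z1 - cmap (ct c) z2)"
      using L(2)[of "cmap (ct c) z1" "cmap (ct c) z2"] by (simp add: sr_field_chart)
  qed
  show "\<exists>\<epsilon>>0. \<exists>L\<ge>0. \<forall>s\<in>{0..t}. \<forall>z1\<in>cdom (ct c). \<forall>z2\<in>cdom (ct c).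
       cmap (ct c) z1 \<in> ball (cmap (ct c) (\<Gamma> \<tau>)) \<epsilon> \<longrightarrow> cmap (ct c) z2 \<in> ball (cmap (ct c) (\<Gamma> \<tau>)) \<epsilon> \<longrightarrow>
       norm (sr_field M X z1 (ct c) - sr_field M X z2 (ct c)) \<le> L * norm (cmap (ct c) z1 - cmap (ct c) z2)"
    by (rule exI[of _ R], rule conjI[OF R(1)], rule exI[of _ L], rule conjI[OF L(1) main])
qed

lemma control_field_chart: "control_field X u t x d = (\<Sum>i\<in>UNIV. u i t *\<^sub>R X i x d)"
  by (simp add: sum_fun_apply scaleR_fun_def)

lemma control_field_tangent: "x \<in> cdom c \<Longrightarrow> control_field X u t x \<in> tangent_space M x"
  by (intro subspace_sum subspace_mul tangent_subspace[OF c_chart] X_tangent_dom)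

lemma control_flow_eq:
  assumes u: "\<And>i s. s \<in> {0..t} \<Longrightarrow> \<bar>u i s\<bar> \<le> K"
    and t: "0 \<le> t" and dom: "\<And>s. s \<in> {0..t} \<Longrightarrow> y s \<in> cmap c ` cdom c"
    and y: "\<And>s. s \<in> {0..t} \<Longrightarrow> (y has_vector_derivative (\<Sum>i\<in>UNIV. u i s *\<^sub>R X i (cinv c (y s)) c)) (at s within {0..t})"
  shows "flow M (control_field X u) t (cinv c (y 0)) = cinv c (y t)"
proof (rule flow_eq[where \<Gamma> = "\<lambda>s. cinv c (y s)", OF Hausdorff c C.open_preimage C.inj t])
  show "cinv c (y s) \<in> cdom c" if "s \<in> {0..t}" for s using C.cinv_dom[OF dom[OF that]] .
  show "integral_curve M (control_field X u) {0..t} (\<lambda>s. cinv c (y s))"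
    using y by (intro integral_curve_from_chart c dom continuous_on_vector_derivative[OF y] control_field_tangent)
      (simp_all add: control_field_chart)
  fix \<tau> assume \<tau>: "\<tau> \<in> {0..t}"
  then have "y \<tau> \<in> cmap c ` cdom c" by (rule dom)
  then obtain R where R: "R > 0" "cball (y \<tau>) R \<subseteq> cmap c ` cdom c"
    using C.im_open open_contains_cball by metis
  have "\<forall>i. \<exists>L\<ge>0. \<forall>x\<in>cball (y \<tau>) R. \<forall>x'\<in>cball (y \<tau>) R. norm (X i (cinv c x) c - X i (cinv c x') c) \<le> L * norm (x - x')"
    using smooth_cball_bounds[OF X_smooth R(2)] by metis
  then obtain L where L: "\<And>i. 0 \<le> L i" "\<And>i x x'. x \<in> cball (y \<tau>) R \<Longrightarrow> x' \<in> cball (y \<tau>) R \<Longrightarrow>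
     norm (X i (cinv c x) c - X i (cinv c x') c) \<le> L i * norm (x - x')" by metis
  have K: "0 \<le> K" using u[OF \<tau>] abs_ge_zero order_trans by blast
  have main: "\<forall>s\<in>{0..t}. \<forall>z1\<in>cdom c. \<forall>z2\<in>cdom c.
       cmap c z1 \<in> ball (cmap c (cinv c (y \<tau>))) R \<longrightarrow> cmap c z2 \<in> ball (cmap c (cinv c (y \<tau>))) R \<longrightarrow>
       norm (control_field X u s z1 c - control_field X u s z2 c) \<le> (\<Sum>i\<in>UNIV. K * L i) * norm (cmap c z1 - cmap c z2)"
  proof (intro ballI impI)
    fix s z1 z2 assume s: "s \<in> {0..t}" and z: "z1 \<in> cdom c" "z2 \<in> cdom c"
      "cmap c z1 \<in> ball (cmap c (cinv c (y \<tau>))) R" "cmap c z2 \<in> ball (cmap c (cinv c (y \<tau>))) R"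
    have b: "cmap c z1 \<in> cball (y \<tau>) R" "cmap c z2 \<in> cball (y \<tau>) R"
      using z(3,4) by (auto simp: C.cmap_cinv[OF dom[OF \<tau>]])
    have "norm (control_field X u s z1 c - control_field X u s z2 c) =
       norm (\<Sum>i\<in>UNIV. u i s *\<^sub>R (X i z1 c - X i z2 c))"
      by (simp add: control_field_chart scaleR_diff_right sum_subtractf)
    also have "\<dots> \<le> (\<Sum>i\<in>UNIV. K * L i * norm (cmap c z1 - cmap c z2))"
    proof (rule sum_norm_le)
      fix i
      have "norm (X i z1 c - X i z2 c) \<le> L i * norm (cmap c z1 - cmap c z2)"
        using L(2)[OF b, of i] by (simp add: C.cinv_cmap z)
      then show "norm (u i s *\<^sub>R (X i z1 c - X i z2 c)) \<le> K * L i * norm (cmap c z1 - cmap c z2)"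
        unfolding norm_scaleR mult.assoc using u[OF s, of i] K by (intro mult_mono) auto
    qed
    finally show "norm (control_field X u s z1 c - control_field X u s z2 c) \<le>
       (\<Sum>i\<in>UNIV. K * L i) * norm (cmap c z1 - cmap c z2)" by (simp add: sum_distrib_right)
  qed
  have "0 \<le> (\<Sum>i\<in>UNIV. K * L i)" using K L(1) by (intro sum_nonneg mult_nonneg_nonneg)
  note this main
  then show "\<exists>\<epsilon>>0. \<exists>L\<ge>0. \<forall>s\<in>{0..t}. \<forall>z1\<in>cdom c. \<forall>z2\<in>cdom c.
       cmap c z1 \<in> ball (cmap c (cinv c (y \<tau>))) \<epsilon> \<longrightarrow> cmap c z2 \<in> ball (cmap c (cinv c (y \<tau>))) \<epsilon> \<longrightarrow>
       norm (control_field X u s z1 c - control_field X u s z2 c) \<le> L * norm (cmap c z1 - cmap c z2)"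
    by - (rule exI[of _ R], rule conjI[OF R(1)], rule exI[of _ "\<Sum>i\<in>UNIV. K * L i"], rule conjI)
qed

lemma local_control_flow:
  assumes S: "q0 \<in> cmap c ` cdom c" and "0 < \<delta>" and u: "\<And>i. continuous_on {0..\<delta>} (u i)"
  obtains T \<epsilon> \<phi> J where "0 < T" "T \<le> \<delta>" "0 < \<epsilon>"
    "\<And>q. q \<in> ball q0 \<epsilon> \<Longrightarrow> \<phi> 0 q = q"
    "\<And>q t. q \<in> ball q0 \<epsilon> \<Longrightarrow> t \<in> {0..T} \<Longrightarrow> \<phi> t q \<in> cmap c ` cdom c"
    "\<And>q t. q \<in> ball q0 \<epsilon> \<Longrightarrow> t \<in> {0..T} \<Longrightarrow>
       ((\<lambda>s. \<phi> s q) has_vector_derivative (\<Sum>i\<in>UNIV. u i t *\<^sub>R X i (cinv c (\<phi> t q)) c)) (at t within {0..T})"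
    "\<And>t. bounded_linear (J t)"
    "\<And>t w. t \<in> {0..T} \<Longrightarrow> norm w \<le> 2 * norm (J t w)"
    "\<And>t. t \<in> {0..T} \<Longrightarrow> (\<phi> t has_derivative J t) (at q0)"
    "\<And>t w. t \<in> {0..T} \<Longrightarrow> ((\<lambda>s. J s w) has_vector_derivative
       (\<Sum>i\<in>UNIV. u i t *\<^sub>R frechet_derivative (\<lambda>q. X i (cinv c q) c) (at (\<phi> t q0)) (J t w))) (at t within {0..T})"
proof -
  let ?X = "\<lambda>i q. X i (cinv c q) c"
  let ?D = "\<lambda>i q. frechet_derivative (?X i) (at q)"
  obtain R where R: "R > 0" "cball q0 R \<subseteq> cmap c ` cdom c"
    using S C.im_open open_contains_cball by metis
  have "\<forall>i. \<exists>L. 0 \<le> L \<and> (\<forall>x\<in>cball q0 R. \<forall>v. norm (?D i x v) \<le> L * norm v) \<and>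
     (\<forall>x\<in>cball q0 R. \<forall>x'\<in>cball q0 R. norm (?X i x - ?X i x') \<le> L * norm (x - x'))"
  proof
    fix i
    obtain L where "0 \<le> L" "\<And>x v. x \<in> cball q0 R \<Longrightarrow> norm (?D i x v) \<le> L * norm v"
      "\<And>x y. x \<in> cball q0 R \<Longrightarrow> y \<in> cball q0 R \<Longrightarrow> norm (?X i x - ?X i y) \<le> L * norm (x - y)"
      by (rule smooth_cball_bounds[OF X_smooth R(2)]) blast
    then show "\<exists>L. 0 \<le> L \<and> (\<forall>x\<in>cball q0 R. \<forall>v. norm (?D i x v) \<le> L * norm v) \<and>
     (\<forall>x\<in>cball q0 R. \<forall>x'\<in>cball q0 R. norm (?X i x - ?X i x') \<le> L * norm (x - x'))" by blast
  qed
  from choice[OF this] obtain L where L: "\<And>i. 0 \<le> L i"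
    "\<And>i x v. x \<in> cball q0 R \<Longrightarrow> norm (?D i x v) \<le> L i * norm v"
    "\<And>i x x'. x \<in> cball q0 R \<Longrightarrow> x' \<in> cball q0 R \<Longrightarrow> norm (?X i x - ?X i x') \<le> L i * norm (x - x')"
    by blast
  have "\<forall>i. \<exists>K. \<forall>s\<in>{0..\<delta>}. \<bar>u i s\<bar> \<le> K"
  proof
    fix i
    have "compact (u i ` {0..\<delta>})" by (intro compact_continuous_image u compact_Icc)
    from bounded_iff[THEN iffD1, OF compact_imp_bounded[OF this]]
    show "\<exists>K. \<forall>s\<in>{0..\<delta>}. \<bar>u i s\<bar> \<le> K" by auto
  qed
  from choice[OF this] obtain K where K: "\<And>i s. s \<in> {0..\<delta>} \<Longrightarrow> \<bar>u i s\<bar> \<le> K i" by blast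
  have K0: "0 \<le> K i" for i
    using K[of 0 i] \<open>0 < \<delta>\<close> by (meson abs_ge_zero atLeastAtMost_iff less_imp_le order_refl order_trans)
  let ?L = "\<Sum>i\<in>UNIV. K i * L i"
  have ctrl_bound: "norm (\<Sum>i\<in>UNIV. u i t *\<^sub>R v i) \<le> (\<Sum>i\<in>UNIV. K i * B i)"
    if t: "t \<in> {0..\<delta>}" and v: "\<And>i. norm (v i) \<le> B i" for t v B
  proof (rule sum_norm_le)
    fix i
    show "norm (u i t *\<^sub>R v i) \<le> K i * B i"
      unfolding norm_scaleR using K[OF t, of i] v[of i] K0[of i] by (intro mult_mono) auto
  qed
  have contX: "continuous_on (cball q0 R) (?X i)" for i
    by (rule smooth_on_continuous[OF smooth_on_subset[OF X_smooth R(2)]])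
  have contD: "continuous_on (cball q0 R) (\<lambda>q. ?D i q w)" for i w
    by (rule smooth_on_continuous[OF smooth_on_deriv_const[OF smooth_on_subset[OF X_smooth R(2)]]])
  have linD: "bounded_linear (?D i q)" if "q \<in> cball q0 R" for i q
    using linear_frechet_smooth[OF smooth_on_subset[OF X_smooth R(2)] that] by (simp add: linear_conv_bounded_linear)
  show ?thesis
  proof (rule local_flow[where R = R and \<delta> = \<delta> and L = ?L and ?q0.0 = q0
        and V = "\<lambda>t q. \<Sum>i\<in>UNIV. u i t *\<^sub>R ?X i q" and A = "\<lambda>t q w. \<Sum>i\<in>UNIV. u i t *\<^sub>R ?D i q w"])
    show "0 \<le> ?L" using K0 L(1) by (intro sum_nonneg mult_nonneg_nonneg)
    show "continuous_on ({0..\<delta>} \<times> cball q0 R) (\<lambda>(t, q). \<Sum>i\<in>UNIV. u i t *\<^sub>R ?X i q)"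
      unfolding case_prod_beta
      by (intro continuous_on_sum continuous_on_scaleR continuous_on_compose2[OF u]
          continuous_on_compose2[OF contX] continuous_on_fst continuous_on_snd continuous_on_id) auto
    show "continuous_on ({0..\<delta>} \<times> cball q0 R) (\<lambda>(t, q). \<Sum>i\<in>UNIV. u i t *\<^sub>R ?D i q w)" for w
      unfolding case_prod_beta
      by (intro continuous_on_sum continuous_on_scaleR continuous_on_compose2[OF u]
          continuous_on_compose2[OF contD] continuous_on_fst continuous_on_snd continuous_on_id) auto
    fix t q assume t: "t \<in> {0..\<delta>}" and q: "q \<in> cball q0 R"
    show "bounded_linear (\<lambda>w. \<Sum>i\<in>UNIV. u i t *\<^sub>R ?D i q w)"
      by (intro bounded_linear_sum bounded_linear_const_scaleR linD q)
    show "norm (\<Sum>i\<in>UNIV. u i t *\<^sub>R ?D i q w) \<le> ?L * norm w" for w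
      using ctrl_bound[OF t L(2)[OF q]] by (simp add: sum_distrib_right mult.assoc)
    fix q' assume q': "q' \<in> cball q0 R"
    have "(\<Sum>i\<in>UNIV. u i t *\<^sub>R ?X i q) - (\<Sum>i\<in>UNIV. u i t *\<^sub>R ?X i q') = (\<Sum>i\<in>UNIV. u i t *\<^sub>R (?X i q - ?X i q'))"
      by (simp add: scaleR_diff_right sum_subtractf)
    then show "norm ((\<Sum>i\<in>UNIV. u i t *\<^sub>R ?X i q) - (\<Sum>i\<in>UNIV. u i t *\<^sub>R ?X i q')) \<le> ?L * norm (q - q')"
      using ctrl_bound[OF t L(3)[OF q q']] by (simp add: sum_distrib_right mult.assoc)
  next
    fix \<omega> :: real assume \<omega>: "0 < \<omega>"
    define \<omega>' where "\<omega>' = \<omega> / (\<Sum>i\<in>(UNIV::'r set). K i + 1)"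
    have pos: "0 < (\<Sum>i\<in>(UNIV::'r set). K i + 1)"
      using K0 by (intro sum_pos) (auto simp: add_nonneg_pos)
    have \<omega>': "0 < \<omega>'" using \<omega> pos by (simp add: \<omega>'_def)
    have "\<forall>i. \<exists>\<rho>>0. \<forall>x\<in>cball q0 R. \<forall>y\<in>cball q0 R. dist x y < \<rho> \<longrightarrow>
        norm (?X i y - ?X i x - ?D i x (y - x)) \<le> \<omega>' * norm (y - x)"
      by (intro allI smooth_uniformly_differentiable[OF X_smooth R(2) \<omega>'])
    from choice[OF this] obtain \<rho> where \<rho>: "\<And>i. 0 < \<rho> i" "\<And>i x y. x \<in> cball q0 R \<Longrightarrow> y \<in> cball q0 R \<Longrightarrow> dist x y < \<rho> i \<Longrightarrow>
        norm (?X i y - ?X i x - ?D i x (y - x)) \<le> \<omega>' * norm (y - x)" by blast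
    define \<rho>' where "\<rho>' = Min (range \<rho>)"
    have \<rho>': "0 < \<rho>'" "\<And>i. \<rho>' \<le> \<rho> i" using \<rho>(1) by (auto simp: \<rho>'_def)
    have "norm ((\<Sum>i\<in>UNIV. u i t *\<^sub>R ?X i q') - (\<Sum>i\<in>UNIV. u i t *\<^sub>R ?X i q) - (\<Sum>i\<in>UNIV. u i t *\<^sub>R ?D i q (q' - q)))
        \<le> \<omega> * norm (q' - q)"
      if t: "t \<in> {0..\<delta>}" and q: "q \<in> cball q0 R" and q': "q' \<in> cball q0 R" and d: "dist q q' < \<rho>'" for t q q'
    proof -
      have d': "dist q q' < \<rho> i" for i using d \<rho>'(2)[of i] by linarith
      have "(\<Sum>i\<in>UNIV. u i t *\<^sub>R ?X i q') - (\<Sum>i\<in>UNIV. u i t *\<^sub>R ?X i q) - (\<Sum>i\<in>UNIV. u i t *\<^sub>R ?D i q (q' - q))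
         = (\<Sum>i\<in>UNIV. u i t *\<^sub>R (?X i q' - ?X i q - ?D i q (q' - q)))"
        by (simp add: scaleR_diff_right sum_subtractf)
      also have "norm \<dots> \<le> (\<Sum>i\<in>UNIV. K i * (\<omega>' * norm (q' - q)))"
        by (rule ctrl_bound[OF t \<rho>(2)[OF q q' d']])
      also have "\<dots> \<le> (\<Sum>i\<in>UNIV. (K i + 1) * (\<omega>' * norm (q' - q)))"
        using \<omega>' by (intro sum_mono mult_right_mono) auto
      also have "\<dots> = (\<Sum>i\<in>(UNIV::'r set). K i + 1) * \<omega>' * norm (q' - q)"
        by (simp only: sum_distrib_right mult.assoc)
      also have "(\<Sum>i\<in>(UNIV::'r set). K i + 1) * \<omega>' = \<omega>" using pos by (simp add: \<omega>'_def)
      finally show ?thesis .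
    qed
    then show "\<exists>\<rho>>0. \<forall>t\<in>{0..\<delta>}. \<forall>q\<in>cball q0 R. \<forall>q'\<in>cball q0 R. dist q q' < \<rho> \<longrightarrow>
       norm ((\<Sum>i\<in>UNIV. u i t *\<^sub>R ?X i q') - (\<Sum>i\<in>UNIV. u i t *\<^sub>R ?X i q) - (\<Sum>i\<in>UNIV. u i t *\<^sub>R ?D i q (q' - q)))
        \<le> \<omega> * norm (q' - q)" using \<rho>'(1) by blast
  next
    fix T \<epsilon> \<phi> J
    assume *: "0 < T" "T \<le> \<delta>" "0 < \<epsilon>" "\<And>q. q \<in> ball q0 \<epsilon> \<Longrightarrow> \<phi> 0 q = q"
      "\<And>q t. q \<in> ball q0 \<epsilon> \<Longrightarrow> t \<in> {0..T} \<Longrightarrow> \<phi> t q \<in> cball q0 R"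
      "\<And>q t. q \<in> ball q0 \<epsilon> \<Longrightarrow> t \<in> {0..T} \<Longrightarrow>
         ((\<lambda>s. \<phi> s q) has_vector_derivative (\<Sum>i\<in>UNIV. u i t *\<^sub>R ?X i (\<phi> t q))) (at t within {0..T})"
      "\<And>t. bounded_linear (J t)"
      "\<And>t w. t \<in> {0..T} \<Longrightarrow> norm w \<le> 2 * norm (J t w)"
      "\<And>t. t \<in> {0..T} \<Longrightarrow> (\<phi> t has_derivative J t) (at q0)"
      "\<And>t w. t \<in> {0..T} \<Longrightarrow> ((\<lambda>s. J s w) has_vector_derivative (\<Sum>i\<in>UNIV. u i t *\<^sub>R ?D i (\<phi> t q0) (J t w))) (at t within {0..T})"
    have "\<phi> t q \<in> cmap c ` cdom c" if "q \<in> ball q0 \<epsilon>" "t \<in> {0..T}" for q t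
      using *(5)[OF that] R(2) by blast
    then show ?thesis by (intro that[OF *(1-4) _ *(6-10)])
  qed (use R(1) \<open>0 < \<delta>\<close> in auto)
qed

lemma differential_local_flow:
  assumes some: "c = (SOME c. c \<in> charts_at M x0)" and x0: "x0 \<in> cdom c" and "0 < \<epsilon>"
    and g: "\<And>q. q \<in> ball (cmap c x0) \<epsilon> \<Longrightarrow> g (cinv c q) = cinv c (\<psi> q)"
    and \<psi>: "\<And>q. q \<in> ball (cmap c x0) \<epsilon> \<Longrightarrow> \<psi> q \<in> cmap c ` cdom c"
    and J: "(\<psi> has_derivative J) (at (cmap c x0))"
  shows "differential M M g x0 v = coord_vec M c (g x0) (J (v c))"
proof
  fix d
  have q0: "cmap c x0 \<in> ball (cmap c x0) \<epsilon>" using \<open>0 < \<epsilon>\<close> by simp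
  have gx0: "g x0 = cinv c (\<psi> (cmap c x0))" using g[OF q0] by (simp add: C.cinv_cmap[OF x0])
  have gc: "g x0 \<in> cdom c" "cmap c (g x0) = \<psi> (cmap c x0)"
    using C.cinv_dom[OF \<psi>[OF q0]] C.cmap_cinv[OF \<psi>[OF q0]] by (simp_all add: gx0)
  show "differential M M g x0 v d = coord_vec M c (g x0) (J (v c)) d"
  proof (cases "d \<in> charts_at M (g x0)")
    case True
    have "((cmap d \<circ> cinv c) \<circ> \<psi> has_derivative trans c d (g x0) \<circ> J) (at (cmap c x0))"
      using J trans_has_derivative[OF c_chart[OF gc(1)] True] unfolding gc(2) by (rule diff_chain_at)
    then have "(cmap d \<circ> g \<circ> cinv c has_derivative trans c d (g x0) \<circ> J) (at (cmap c x0))"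
      by (rule has_derivative_transform_within_open[OF _ open_ball q0]) (simp add: g)
    from frechet_eq[OF this] True show ?thesis
      by (simp add: differential_def coord_vec_def some[symmetric])
  qed (simp add: differential_def coord_vec_def)
qed

lemma tvec_deriv_coord:
  assumes T: "0 < T" and x: "x \<in> cdom c"
    and G0: "\<And>t. t \<in> {0..T} \<Longrightarrow> V t = coord_vec M c x (G 0 t)"
    and G': "\<And>j t. t \<in> {0..T} \<Longrightarrow> (G j has_vector_derivative G (Suc j) t) (at t within {0..T})"
    and t: "t \<in> {0..T}"
  shows "tvec_deriv {0..T} V j t = coord_vec M c x (G j t)"
  using t
proof (induction j arbitrary: t)
  case 0
  then show ?case by (simp add: G0)
next
  case (Suc j)
  show ?case
  proof
    fix d
    have "linear (\<lambda>w. coord_vec M c x w d)"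
      using coord_vec_add[OF c_chart[OF x]] coord_vec_scale[OF c_chart[OF x]]
      by (intro linearI) (simp_all add: scaleR_fun_def)
    then have "bounded_linear (\<lambda>w. coord_vec M c x w d)" by (simp add: linear_conv_bounded_linear)
    from bounded_linear.has_vector_derivative[OF this G'[OF Suc.prems]]
    have "((\<lambda>s. coord_vec M c x (G j s) d) has_vector_derivative coord_vec M c x (G (Suc j) t) d) (at t within {0..T})" .
    then have "((\<lambda>s. tvec_deriv {0..T} V j s d) has_vector_derivative coord_vec M c x (G (Suc j) t) d) (at t within {0..T})"
      by (rule has_vector_derivative_transform[OF Suc.prems, rotated]) (simp add: Suc.IH)
    then show "tvec_deriv {0..T} V (Suc j) t d = coord_vec M c x (G (Suc j) t) d"
      using vector_derivative_within_closed_interval[OF T Suc.prems] by simp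
  qed
qed

lemma exists_ample_geodesic:
  assumes some: "c = (SOME c. c \<in> charts_at M x0)" and x0: "x0 \<in> cdom c"
    and complete: "complete_field (cotangent_bundle M) (sr_field M X)"
    and span: "span (range (\<lambda>(l, j). F.lie_field l j (cmap c x0, \<mu>))) = UNIV"
  shows "\<exists>T>0. \<exists>\<gamma> u. geodesic M X x0 T \<gamma> u \<and> (\<forall>t\<in>{0..T}. ample_at M X T \<gamma> u t)"
proof -
  let ?S = "cmap c ` cdom c" and ?q0 = "cmap c x0"
  define l where "l = covec_of c x0 \<mu>"
  have l: "l \<in> cotangent_space M x0" "covec_coord c x0 l = \<mu>"
    by (simp_all add: l_def covec_of_cotangent covec_coord_of c_chart[OF x0])
  have z0: "(x0, l) \<in> cdom (ct c)" using x0 l by (simp add: ct_dom)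
  have "(x0, l) \<in> mcarrier (cotangent_bundle M)"
    using l C.dom_sub x0 by (auto simp: carrier_cotangent)
  then obtain \<Gamma> where \<Gamma>: "integral_curve (cotangent_bundle M) (\<lambda>_. sr_field M X) UNIV \<Gamma>" "\<Gamma> 0 = (x0, l)"
    using complete unfolding complete_field_def by blast
  have opn: "openin (mtop (cotangent_bundle M)) (cdom (ct c))"
    using ct_preimage[OF c open_UNIV] by simp
  have cont: "continuous_map (top_of_set UNIV) (mtop (cotangent_bundle M)) \<Gamma>"
    using \<Gamma>(1) unfolding integral_curve_def by blast
  have "\<Gamma> 0 \<in> cdom (ct c)" using z0 \<Gamma>(2) by simp
  from continuous_curve_near[OF cont opn UNIV_I this]
  obtain e where e: "e > 0" "\<And>s. s \<in> UNIV \<Longrightarrow> dist s 0 < e \<Longrightarrow> \<Gamma> s \<in> cdom (ct c)" by blast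
  define \<delta> where "\<delta> = e / 2"
  have \<delta>: "\<delta> > 0" using e(1) by (simp add: \<delta>_def)
  have dom: "\<Gamma> s \<in> cdom (ct c)" if "s \<in> {0..\<delta>}" for s
    using that e(1) by (intro e(2)) (auto simp: \<delta>_def)
  define y where "y s = cmap (ct c) (\<Gamma> s)" for s
  have y0: "y 0 = (?q0, \<mu>)" by (simp add: y_def \<Gamma> ct_map l)
  have yOm: "y s \<in> F.phase" if "s \<in> {0..\<delta>}" for s unfolding y_def by (rule ct_in_phase[OF dom[OF that]])
  have fst_y: "cinv c (fst (y s)) = fst (\<Gamma> s)" if "s \<in> {0..\<delta>}" for s
    using dom[OF that] by (cases "\<Gamma> s") (simp add: y_def ct_map ct_dom C.cinv_cmap)
  have y': "(y has_vector_derivative F.Hv (y s)) (at s within {0..\<delta>})" if s: "s \<in> {0..\<delta>}" for s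
  proof -
    have "ct c \<in> charts_at (cotangent_bundle M) (\<Gamma> s)" using dom[OF s] c by (simp add: charts_at_def ct_atlas)
    then have "(y has_vector_derivative sr_field M X (\<Gamma> s) (ct c)) (at s within UNIV)"
      using \<Gamma>(1) unfolding integral_curve_def y_def by blast
    then show ?thesis unfolding sr_field_chart[OF dom[OF s]] y_def
      by (rule has_vector_derivative_within_subset) simp
  qed
  have cont_y: "continuous_on {0..\<delta>} y" by (rule continuous_on_vector_derivative[OF y'])
  obtain k :: "'n \<Rightarrow> 'r \<times> nat" where k: "det (\<chi> i. F.lie_field (fst (k i)) (snd (k i)) (y 0)) \<noteq> 0"
    using spanning_family_det[OF span] unfolding y0 case_prod_beta by blast
  define D where "D s = det (\<chi> i. F.lie_field (fst (k i)) (snd (k i)) (y s))" for s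
  have "continuous_on {0..\<delta>} (\<lambda>s. F.lie_field l j (y s))" for l j
    by (rule continuous_on_compose2[OF smooth_on_continuous[OF F.smooth_lie_field] cont_y])
      (rule image_subsetI, rule yOm)
  then have contD: "continuous_on {0..\<delta>} D" unfolding D_def by (rule continuous_on_det)
  have "0 \<in> {0..\<delta>}" "0 < \<bar>D 0\<bar>" using \<delta> k by (simp_all add: D_def)
  from contD[unfolded continuous_on_iff, rule_format, OF this]
  obtain e' where e': "e' > 0" "\<And>s. s \<in> {0..\<delta>} \<Longrightarrow> dist s 0 < e' \<Longrightarrow> dist (D s) (D 0) < \<bar>D 0\<bar>" by blast
  define \<delta>' where "\<delta>' = min \<delta> (e' / 2)"
  have \<delta>': "0 < \<delta>'" "{0..\<delta>'} \<subseteq> {0..\<delta>}" using \<delta> e'(1) by (auto simp: \<delta>'_def)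
  have det: "det (\<chi> i. F.lie_field (fst (k i)) (snd (k i)) (y s)) \<noteq> 0" if s: "s \<in> {0..\<delta>'}" for s
  proof -
    have "s \<in> {0..\<delta>}" using s \<delta>'(2) by blast
    moreover have "dist s 0 < e'" using s e'(1) by (simp add: \<delta>'_def dist_real_def)
    ultimately have "dist (D s) (D 0) < \<bar>D 0\<bar>" by (rule e'(2))
    then have "D s \<noteq> 0" by (auto simp: dist_real_def)
    then show ?thesis unfolding D_def .
  qed
  have cont_u: "continuous_on {0..\<delta>'} (\<lambda>s. F.ctrl i (y s))" for i
    by (rule continuous_on_compose2[OF smooth_on_continuous[OF F.smooth_ctrl] continuous_on_subset[OF cont_y \<delta>'(2)]])
      (rule image_subsetI, rule yOm, rule subsetD[OF \<delta>'(2)])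
  have q0: "?q0 \<in> ?S" using x0 by simp
  obtain T \<epsilon> \<phi> J where T: "0 < T" "T \<le> \<delta>'" and \<epsilon>: "0 < \<epsilon>"
    and \<phi>0: "\<And>q. q \<in> ball ?q0 \<epsilon> \<Longrightarrow> \<phi> 0 q = q"
    and \<phi>S: "\<And>q t. q \<in> ball ?q0 \<epsilon> \<Longrightarrow> t \<in> {0..T} \<Longrightarrow> \<phi> t q \<in> ?S"
    and \<phi>': "\<And>q t. q \<in> ball ?q0 \<epsilon> \<Longrightarrow> t \<in> {0..T} \<Longrightarrow>
       ((\<lambda>s. \<phi> s q) has_vector_derivative (\<Sum>i\<in>UNIV. F.ctrl i (y t) *\<^sub>R X i (cinv c (\<phi> t q)) c)) (at t within {0..T})"
    and J: "\<And>t. bounded_linear (J t)" "\<And>t w. t \<in> {0..T} \<Longrightarrow> norm w \<le> 2 * norm (J t w)"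
      "\<And>t. t \<in> {0..T} \<Longrightarrow> (\<phi> t has_derivative J t) (at ?q0)"
    and J': "\<And>t w. t \<in> {0..T} \<Longrightarrow> ((\<lambda>s. J s w) has_vector_derivative
       (\<Sum>i\<in>UNIV. F.ctrl i (y t) *\<^sub>R frechet_derivative (\<lambda>q. X i (cinv c q) c) (at (\<phi> t ?q0)) (J t w))) (at t within {0..T})"
    by (rule local_control_flow[where u = "\<lambda>i s. F.ctrl i (y s)", OF q0 \<delta>'(1) cont_u]) (rule that)
  have T\<delta>: "t \<in> {0..\<delta>}" "t \<in> {0..\<delta>'}" if "t \<in> {0..T}" for t
  proof -
    show "t \<in> {0..\<delta>'}" using that T(2) by simp
    then show "t \<in> {0..\<delta>}" using \<delta>'(2) by blast
  qed
  define \<gamma> where "\<gamma> t = fst (\<Gamma> t)" for t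
  define u where "u i t = snd (\<Gamma> t) (X i (fst (\<Gamma> t)))" for i t
  have u: "u i t = F.ctrl i (y t)" if "t \<in> {0..\<delta>}" for i t
    unfolding u_def y_def by (rule momentum_ctrl[OF dom[OF that]])
  have geo: "geodesic M X x0 T \<gamma> u"
  proof -
    have "flow (cotangent_bundle M) (\<lambda>_. sr_field M X) t (x0, l) = \<Gamma> t" if t: "t \<in> {0..T}" for t
    proof -
      have "0 \<le> t" and sub: "{0..t} \<subseteq> {0..\<delta>}" using T\<delta>(1)[OF t] by auto
      then have "flow (cotangent_bundle M) (\<lambda>_. sr_field M X) t (\<Gamma> 0) = \<Gamma> t"
        by (intro cotangent_flow_eq dom integral_curve_subset[OF \<Gamma>(1) subset_UNIV] subsetD[OF sub])
      then show ?thesis unfolding \<Gamma>(2) .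
    qed
    then show ?thesis
      unfolding geodesic_def Let_def using l(1) by (intro bexI[of _ l]) (simp_all add: \<gamma>_def u_def)
  qed
  have bound: "\<exists>K. \<forall>i. \<forall>s\<in>{0..T}. \<bar>u i s\<bar> \<le> K"
  proof -
    have "\<forall>i. \<exists>K. \<forall>s\<in>{0..\<delta>'}. \<bar>F.ctrl i (y s)\<bar> \<le> K"
    proof
      fix i
      have "compact ((\<lambda>s. F.ctrl i (y s)) ` {0..\<delta>'})" by (intro compact_continuous_image cont_u compact_Icc)
      from bounded_iff[THEN iffD1, OF compact_imp_bounded[OF this]]
      show "\<exists>K. \<forall>s\<in>{0..\<delta>'}. \<bar>F.ctrl i (y s)\<bar> \<le> K" by auto
    qed
    from choice[OF this] obtain K where K: "\<And>i s. s \<in> {0..\<delta>'} \<Longrightarrow> \<bar>F.ctrl i (y s)\<bar> \<le> K i" by blast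
    have "\<bar>u i s\<bar> \<le> Max (range K)" if "s \<in> {0..T}" for i s
    proof -
      have "K i \<le> Max (range K)" by (rule Max_ge) auto
      then show ?thesis using K[OF T\<delta>(2)[OF that], of i] unfolding u[OF T\<delta>(1)[OF that], of i] by linarith
    qed
    then show ?thesis by blast
  qed
  then obtain K where K: "\<And>i s. s \<in> {0..T} \<Longrightarrow> \<bar>u i s\<bar> \<le> K" by blast
  have flow_chart: "flow M (control_field X u) t (cinv c (\<psi> 0)) = cinv c (\<psi> t)"
    if t: "t \<in> {0..T}" and \<psi>S: "\<And>s. s \<in> {0..T} \<Longrightarrow> \<psi> s \<in> ?S"
      and \<psi>': "\<And>s. s \<in> {0..T} \<Longrightarrow> (\<psi> has_vector_derivative (\<Sum>i\<in>UNIV. F.ctrl i (y s) *\<^sub>R X i (cinv c (\<psi> s)) c)) (at s within {0..T})"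
    for t \<psi>
  proof (rule control_flow_eq)
    have sub: "{0..t} \<subseteq> {0..T}" using t by auto
    show "\<bar>u i s\<bar> \<le> K" if "s \<in> {0..t}" for i s using K that sub by blast
    show "0 \<le> t" using t by simp
    show "\<psi> s \<in> ?S" if "s \<in> {0..t}" for s using \<psi>S that sub by blast
    show "(\<psi> has_vector_derivative (\<Sum>i\<in>UNIV. u i s *\<^sub>R X i (cinv c (\<psi> s)) c)) (at s within {0..t})"
      if s: "s \<in> {0..t}" for s
    proof -
      have sT: "s \<in> {0..T}" using s sub by blast
      show ?thesis unfolding u[OF T\<delta>(1)[OF sT]] by (rule has_vector_derivative_within_subset[OF \<psi>'[OF sT] sub])
    qed
  qed
  have flow_\<phi>: "flow M (control_field X u) t (cinv c q) = cinv c (\<phi> t q)" if "t \<in> {0..T}" "q \<in> ball ?q0 \<epsilon>" for t q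
    using flow_chart[OF that(1) \<phi>S[OF that(2)] \<phi>'[OF that(2)]] \<phi>0[OF that(2)] by simp
  have q0b: "?q0 \<in> ball ?q0 \<epsilon>" using \<epsilon> by simp
  have flow_\<gamma>: "flow M (control_field X u) t x0 = \<gamma> t" if t: "t \<in> {0..T}" for t
  proof -
    have "flow M (control_field X u) t (cinv c (fst (y 0))) = cinv c (fst (y t))"
    proof (rule flow_chart[OF t])
      fix s assume s: "s \<in> {0..T}"
      show "fst (y s) \<in> ?S" using yOm[OF T\<delta>(1)[OF s]] by auto
      have "{0..T} \<subseteq> {0..\<delta>}" using T\<delta> by blast
      from bounded_linear.has_vector_derivative[OF bounded_linear_fst has_vector_derivative_within_subset[OF y'[OF T\<delta>(1)[OF s]] this]]
      show "((\<lambda>s. fst (y s)) has_vector_derivative (\<Sum>i\<in>UNIV. F.ctrl i (y s) *\<^sub>R X i (cinv c (fst (y s))) c)) (at s within {0..T})"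
        unfolding F.fst_Hv[OF yOm[OF T\<delta>(1)[OF s]]] .
    qed
    then show ?thesis using fst_y[OF T\<delta>(1)[OF t]] by (simp add: y0 \<gamma>_def C.cinv_cmap[OF x0])
  qed
  have \<phi>q0: "\<phi> t ?q0 = fst (y t)" if t: "t \<in> {0..T}" for t
  proof -
    have "cinv c (\<phi> t ?q0) = cinv c (fst (y t))"
      using flow_\<gamma>[OF t] flow_\<phi>[OF t q0b] fst_y[OF T\<delta>(1)[OF t]] by (simp add: \<gamma>_def C.cinv_cmap[OF x0])
    moreover have "\<phi> t ?q0 \<in> ?S" "fst (y t) \<in> ?S" using \<phi>S[OF q0b t] yOm[OF T\<delta>(1)[OF t]] by auto
    ultimately show ?thesis by (metis C.cmap_cinv)
  qed
  have \<gamma>0: "\<gamma> 0 = x0" by (simp add: \<gamma>_def \<Gamma>)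
  have \<gamma>c: "\<gamma> t \<in> cdom c" "cinv c (fst (y t)) = \<gamma> t" if "t \<in> {0..T}" for t
    using dom[OF T\<delta>(1)[OF that]] fst_y[OF T\<delta>(1)[OF that]] by (auto simp: \<gamma>_def ct_dom)
  have bij: "bij (J t)" if t: "t \<in> {0..T}" for t
  proof -
    have lin: "linear (J t)" using J(1) by (rule bounded_linear.linear)
    have "inj (J t)" unfolding linear_injective_0[OF lin]
    proof (intro allI impI)
      fix w assume "J t w = 0"
      then show "w = 0" using J(2)[OF t, of w] by simp
    qed
    then show ?thesis using linear_injective_imp_surjective[OF lin] by (simp add: bij_def)
  qed
  define G where "G l j t = inv (J t) (F.lie_field l j (y t))" for l j t
  have JG: "J t (G l j t) = F.lie_field l j (y t)" if "t \<in> {0..T}" for t l j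
    unfolding G_def by (rule surj_f_inv_f[OF bij_is_surj[OF bij[OF that]]])
  have pulled: "pulled_back_field M X \<gamma> u i t = coord_vec M c x0 (G i 0 t)" if t: "t \<in> {0..T}" for i t
  proof -
    let ?g = "flow M (control_field X u) t"
    have diff: "differential M M ?g x0 v = coord_vec M c (\<gamma> t) (J t (v c))" for v
      using differential_local_flow[OF some x0 \<epsilon> flow_\<phi>[OF t] \<phi>S[OF _ t] J(3)[OF t], of v]
      unfolding flow_\<gamma>[OF t] .
    have inj: "inj_on (differential M M ?g x0) (tangent_space M x0)"
    proof (rule inj_onI)
      fix v w assume vw: "v \<in> tangent_space M x0" "w \<in> tangent_space M x0"
        "differential M M ?g x0 v = differential M M ?g x0 w"
      then have "J t (v c) = J t (w c)"
        unfolding diff by (metis coord_vec_nth c_chart \<gamma>c(1) t)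
      then have "v c = w c" using bij[OF t] by (auto simp: bij_def inj_def)
      then show "v = w" by (rule tangent_eqI[OF vw(1,2) c_chart[OF x0]])
    qed
    have "differential M M ?g x0 (coord_vec M c x0 (G i 0 t)) = coord_vec M c (\<gamma> t) (X i (\<gamma> t) c)"
      unfolding diff coord_vec_nth[OF c_chart[OF x0]] JG[OF t] by (simp add: \<gamma>c(2)[OF t])
    also have "\<dots> = X i (\<gamma> t)"
      using tangent_coord_vec[OF X_tangent_dom[OF \<gamma>c(1)[OF t]] c_chart[OF \<gamma>c(1)[OF t]], of i] by simp
    finally show ?thesis
      unfolding pulled_back_field_def \<gamma>0
      by (intro inv_into_f_eq inj coord_vec_tangent c_chart x0)
  qed
  have G': "(G l j has_vector_derivative G l (Suc j) t) (at t within {0..T})" if t: "t \<in> {0..T}" for l j t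
  proof (rule has_vector_derivative_solve_linear[OF t _ J(2) J'[OF t] _ JG])
    show "linear (J s)" for s using J(1) by (rule bounded_linear.linear)
    have "{0..T} \<subseteq> {0..\<delta>}" using T\<delta> by blast
    then show "((\<lambda>s. F.lie_field l j (y s)) has_vector_derivative F.ham_lie (F.lie_field l j) (y t)) (at t within {0..T})"
      unfolding F.ham_lie_def
      by (intro has_vector_derivative_compose_smooth[where y = y and t = t, OF F.smooth_lie_field yOm[OF T\<delta>(1)[OF t]]]
          has_vector_derivative_within_subset[OF y'[OF T\<delta>(1)[OF t]]])
    show "J t (G l (Suc j) t) = F.ham_lie (F.lie_field l j) (y t) -
       (\<Sum>i\<in>UNIV. F.ctrl i (y t) *\<^sub>R frechet_derivative (\<lambda>q. X i (cinv c q) c) (at (\<phi> t ?q0)) (J t (G l j t)))"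
      unfolding JG[OF t] \<phi>q0[OF t] by simp
  qed
  define m where "m = Suc (Max (range (\<lambda>i. snd (k i))))"
  have km: "snd (k i) < m" for i unfolding m_def by (simp add: less_Suc_eq_le)
  have "ample_at M X T \<gamma> u t" if t: "t \<in> {0..T}" for t
    unfolding ample_at_def
  proof (intro exI[of _ m] conjI)
    show "1 \<le> m" by (simp add: m_def)
    let ?A = "{tvec_deriv {0..T} (pulled_back_field M X \<gamma> u l) j t |j l. j < m}"
    have td: "tvec_deriv {0..T} (pulled_back_field M X \<gamma> u l) j t = coord_vec M c x0 (G l j t)" for l j
      by (rule tvec_deriv_coord[OF T(1) x0 pulled G' t])
    have sub: "?A \<subseteq> tangent_space M x0" unfolding td using coord_vec_tangent[OF c_chart[OF x0]] by blast
    have "range (\<lambda>i. G (fst (k i)) (snd (k i)) t) \<subseteq> (\<lambda>v. v c) ` ?A"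
    proof
      fix v assume "v \<in> range (\<lambda>i. G (fst (k i)) (snd (k i)) t)"
      then obtain i where "v = G (fst (k i)) (snd (k i)) t" by blast
      then have "v = (coord_vec M c x0 (G (fst (k i)) (snd (k i)) t)) c" by (simp add: coord_vec_nth[OF c_chart[OF x0]])
      then show "v \<in> (\<lambda>v. v c) ` ?A" unfolding td using km by blast
    qed
    moreover have "span (range (\<lambda>i. G (fst (k i)) (snd (k i)) t)) = UNIV"
    proof -
      have lin: "linear (J t)" using J(1) by (rule bounded_linear.linear)
      have "J t ` span (range (\<lambda>i. G (fst (k i)) (snd (k i)) t)) = span (range (\<lambda>i. F.lie_field (fst (k i)) (snd (k i)) (y t)))"
        unfolding linear_span_image[OF lin, symmetric] image_image JG[OF t] ..
      also have "\<dots> = J t ` UNIV"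
        using span_det_nonzero[OF det[OF T\<delta>(2)[OF t]]] bij_is_surj[OF bij[OF t]] by simp
      finally show ?thesis using bij_is_inj[OF bij[OF t]] by (simp add: inj_image_eq_iff)
    qed
    ultimately have "span ((\<lambda>v. v c) ` ?A) = UNIV" using span_mono by blast
    then have "span ?A = tangent_space M x0" using span_tangent_iff[OF c_chart[OF x0] sub] by blast
    then show "geodesic_flag M X T \<gamma> u m t = tangent_space M (\<gamma> 0)" unfolding geodesic_flag_def \<gamma>0 .
  qed
  then show ?thesis using T(1) geo by blast
qed

end

theorem theorem5p17:
  fixes M :: "('a, real^'n) mfd"
    and U :: "('b, 'a, real^'n, 'r::finite) vbundle"
    and f :: "'b \<Rightarrow> 'a \<times> ('a, real^'n) tvec"
    and \<sigma> :: "'r \<Rightarrow> 'a \<Rightarrow> 'b"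
    and x0 :: 'a
  defines "X \<equiv> frame_fields f \<sigma>"
  assumes sub_riemannian: "sub_riemannian_manifold M U f \<sigma>"
    and complete: "complete_field (cotangent_bundle M) (sr_field M X)"
    and base_point: "x0 \<in> mcarrier M"
  shows "\<exists>T>0. \<exists>\<gamma> u. geodesic M X x0 T \<gamma> u \<and> (\<forall>t\<in>{0..T}. ample_at M X T \<gamma> u t)"
proof -
  interpret M: smooth_mfd M by (rule sub_riemannian_smooth_mfd[OF sub_riemannian])
  define c where "c = (SOME c. c \<in> charts_at M x0)"
  have cx0: "c \<in> charts_at M x0" unfolding c_def by (rule someI_ex[OF M.charts_at_nonempty[OF base_point]])
  then have ca: "c \<in> atlas M" and x0: "x0 \<in> cdom c" by (auto simp: charts_at_def)
  interpret sr_chart M X c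
    by unfold_locales (use ca frame_fields_tangent(3)[OF sub_riemannian] frame_fields_smooth[OF sub_riemannian ca]
        in \<open>simp_all add: X_def\<close>)
  interpret P: sr_frame_point "cmap c ` cdom c" "\<lambda>i q. X i (cinv c q) c" "cmap c x0"
    by unfold_locales (use x0 in simp)
  have gen: "span {Y x0 |Y. Y \<in> iterated_brackets M X} = tangent_space M x0"
    using sub_riemannian base_point by (simp add: sub_riemannian_manifold_def bracket_generating_def X_def)
  have "\<exists>Z\<in>bracket_fields (\<lambda>i q. X i (cinv c q) c). \<eta> \<bullet> Z (cmap c x0) \<noteq> 0" if \<eta>: "\<eta> \<noteq> 0" for \<eta>
  proof (rule ccontr)
    assume *: "\<not> ?thesis"
    let ?A = "{Y x0 |Y. Y \<in> iterated_brackets M X}"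
    have "\<eta> \<bullet> v = 0" if v: "v \<in> (\<lambda>v. v c) ` ?A" for v
    proof -
      obtain Y where Y: "Y \<in> iterated_brackets M X" "v = Y x0 c" using v by blast
      obtain Z where "Z \<in> bracket_fields (\<lambda>i q. X i (cinv c q) c)" "\<forall>q\<in>cmap c ` cdom c. Y (cinv c q) c = Z q"
        using iterated_brackets_in_chart[OF M.mfd ca Y(1)] by blast
      then show ?thesis using * Y(2) x0 by (auto simp: C.cinv_cmap)
    qed
    then have "span ((\<lambda>v. v c) ` ?A) \<subseteq> {v. \<eta> \<bullet> v = 0}"
      by (intro span_minimal subspace_hyperplane) blast
    moreover have "?A \<subseteq> tangent_space M x0" unfolding gen[symmetric] by (rule span_superset)
    then have "span ((\<lambda>v. v c) ` ?A) = UNIV" using M.span_tangent_iff[OF cx0] gen by blast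
    ultimately have "\<eta> \<bullet> \<eta> = 0" by blast
    then show False using \<eta> by simp
  qed
  from P.exists_spanning_covector[OF this]
  obtain \<mu> where \<mu>: "\<And>\<eta>. \<eta> \<noteq> 0 \<Longrightarrow> \<exists>l j. \<eta> \<bullet> F.lie_field l j (cmap c x0, \<mu>) \<noteq> 0" by blast
  have "span (range (\<lambda>(l, j). F.lie_field l j (cmap c x0, \<mu>))) = UNIV" (is "span ?R = UNIV")
  proof (rule ccontr)
    assume "span ?R \<noteq> UNIV"
    then obtain \<eta> where "\<eta> \<noteq> 0" "\<And>v. v \<in> span ?R \<Longrightarrow> \<eta> \<bullet> v = 0"
      using span_not_UNIV_orthogonal[of ?R] by auto
    moreover have "F.lie_field l j (cmap c x0, \<mu>) \<in> span ?R" for l j by (rule span_base) force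
    ultimately show False using \<mu> by blast
  qed
  from exists_ample_geodesic[OF c_def x0 complete this] show ?thesis .
qed

end
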